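(* For any given finite simple connected graph $G=(V,E)$ without node capacity constraints, a solution (an orientation of the edges of $G$, equivalently a star coloring of $G$) that is optimal for MinMaxStar and for MinMaxInd simultaneously can be computed in time $\mathcal{O}\bigl(\log(\Delta)\cdot|E|\cdot\min\{|V|^{2/3},|E|^{1/2}\}\bigr)$, where $\Delta=\Delta(G)$ is the maximum degree of $G$.
   Context: Let $G=(V,E)$ be a finite simple connected graph. Each node $v\in V$ has its own distinct color $C(v)$. A star coloring $C$ assigns to each edge $e\in E$ a color $C(e)$ with $C(e)=C(v)$ for some endpoint $v\in e$. Star colorings and orientations of $G$ correspond bijectively: an edge $\{v,w\}$ with color $C(v)$ is directed from $v$ to $w$, and conversely an edge directed from $v$ to $w$ gets color $C(v)$. For a star coloring $C$ and $v\in V$ let $x(G,C,v)=|\{C(e):e\in E,\ v\in e\}|$ be the number of different colors of edges incident to $v$, and $x(G,C)=\max_{v\in V}x(G,C,v)$. Without node capacity constraints, a star coloring is optimal for MinMaxStar if it minimizes $x(G,C)$ over all star colorings of $G$. An orientation is optimal for MinMaxInd if it minimizes the maximum indegree over all nodes among all orientations of $G$. An orientation is called optimal for MinMaxStar if the corresponding star coloring is. *)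

theory Defs
  imports Complex_Main
begin

section \<open>Graphs\<close>

definition simple_graph :: "'a set \<Rightarrow> 'a set set \<Rightarrow> bool" where
  "simple_graph V E \<longleftrightarrow> finite V \<and> V \<noteq> {} \<and> (\<forall>e\<in>E. e \<subseteq> V \<and> card e = 2)"

definition connected_graph :: "'a set \<Rightarrow> 'a set set \<Rightarrow> bool" where
  "connected_graph V E \<longleftrightarrow> (\<forall>u\<in>V. \<forall>v\<in>V. (u, v) \<in> {(a, b). {a, b} \<in> E}\<^sup>*)"

definition max_degree :: "'a set \<Rightarrow> 'a set set \<Rightarrow> nat" where
  "max_degree V E = Max ((\<lambda>v. card {e\<in>E. v \<in> e}) ` V)"


section \<open>Star colorings\<close>

text \<open>Throughout, \<open>C\<close> is the coloring of the nodes (assumed injective on \<open>V\<close> where it is used)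
  and \<open>K\<close> a coloring of the edges.  Values of \<open>K\<close> outside \<open>E\<close> are irrelevant.\<close>

definition star_coloring :: "'a set set \<Rightarrow> ('a \<Rightarrow> 'c) \<Rightarrow> ('a set \<Rightarrow> 'c) \<Rightarrow> bool" where
  "star_coloring E C K \<longleftrightarrow> (\<forall>e\<in>E. \<exists>v\<in>e. K e = C v)"

definition node_colors :: "'a set set \<Rightarrow> ('a set \<Rightarrow> 'c) \<Rightarrow> 'a \<Rightarrow> nat" where
  "node_colors E K v = card {K e |e. e \<in> E \<and> v \<in> e}"

definition max_node_colors :: "'a set \<Rightarrow> 'a set set \<Rightarrow> ('a set \<Rightarrow> 'c) \<Rightarrow> nat" where
  "max_node_colors V E K = Max (node_colors E K ` V)"

definition optimal_star_coloring ::
    "'a set \<Rightarrow> 'a set set \<Rightarrow> ('a \<Rightarrow> 'c) \<Rightarrow> ('a set \<Rightarrow> 'c) \<Rightarrow> bool" where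
  "optimal_star_coloring V E C K \<longleftrightarrow> star_coloring E C K \<and>
     (\<forall>K'. star_coloring E C K' \<longrightarrow> max_node_colors V E K \<le> max_node_colors V E K')"


section \<open>Orientations\<close>

text \<open>An orientation is a set of arcs; \<open>(v, w)\<close> is directed from \<open>v\<close> to \<open>w\<close>.\<close>

definition orientation :: "'a set set \<Rightarrow> ('a \<times> 'a) set \<Rightarrow> bool" where
  "orientation E D \<longleftrightarrow> (\<forall>(v, w)\<in>D. {v, w} \<in> E) \<and>
     (\<forall>v w. {v, w} \<in> E \<longrightarrow> ((v, w) \<in> D \<longleftrightarrow> (w, v) \<notin> D))"

definition indegree :: "('a \<times> 'a) set \<Rightarrow> 'a \<Rightarrow> nat" where
  "indegree D w = card {v. (v, w) \<in> D}"

definition max_indegree :: "'a set \<Rightarrow> ('a \<times> 'a) set \<Rightarrow> nat" where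
  "max_indegree V D = Max (indegree D ` V)"

definition MinMaxInd_optimal :: "'a set \<Rightarrow> 'a set set \<Rightarrow> ('a \<times> 'a) set \<Rightarrow> bool" where
  "MinMaxInd_optimal V E D \<longleftrightarrow> orientation E D \<and>
     (\<forall>D'. orientation E D' \<longrightarrow> max_indegree V D \<le> max_indegree V D')"

definition coloring_of_orientation ::
    "('a \<Rightarrow> 'c) \<Rightarrow> ('a \<times> 'a) set \<Rightarrow> 'a set \<Rightarrow> 'c" where
  "coloring_of_orientation C D e = C (THE v. \<exists>w. (v, w) \<in> D \<and> e = {v, w})"

definition MinMaxStar_optimal ::
    "'a set \<Rightarrow> 'a set set \<Rightarrow> ('a \<Rightarrow> 'c) \<Rightarrow> ('a \<times> 'a) set \<Rightarrow> bool" where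
  "MinMaxStar_optimal V E C D \<longleftrightarrow> orientation E D \<and>
     optimal_star_coloring V E C (coloring_of_orientation C D)"


section \<open>Word RAM\<close>

text \<open>Programs of a random access machine with finitely many scalar registers and arrays, addition,
  truncated subtraction, indirect access and structured control flow.  Every instruction and every
  test takes one time step.  The semantics is parametrized by a bound \<open>W\<close>: a write of a value
  that is at least \<open>W\<close>, and an array access at an index that is at least \<open>W\<close>, is stuck.  Hence all
  words have \<open>log 2 W\<close> bits, and unit cost per operation is realistic for \<open>W\<close> polynomial in the
  input size.\<close>

type_synonym name = string

datatype atom = Const nat | Var name

datatype test = Less atom atom | LessEq atom atom | Equal atom atom | NotEqual atom atom

datatype com =
    Skip
  | Copy name atom
  | Add name atom atom
  | Sub name atom atom
  | Load name name atom
  | Store name atom atom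
  | Seq com com
  | Cond test com com
  | While test com

type_synonym state = "(name \<Rightarrow> nat) \<times> (name \<Rightarrow> nat \<Rightarrow> nat)"

fun aval :: "atom \<Rightarrow> state \<Rightarrow> nat" where
  "aval (Const k) s = k"
| "aval (Var x) s = fst s x"

fun tval :: "test \<Rightarrow> state \<Rightarrow> bool" where
  "tval (Less a b) s \<longleftrightarrow> aval a s < aval b s"
| "tval (LessEq a b) s \<longleftrightarrow> aval a s \<le> aval b s"
| "tval (Equal a b) s \<longleftrightarrow> aval a s = aval b s"
| "tval (NotEqual a b) s \<longleftrightarrow> aval a s \<noteq> aval b s"

definition set_var :: "name \<Rightarrow> nat \<Rightarrow> state \<Rightarrow> state" where
  "set_var x k s = ((fst s)(x := k), snd s)"

definition set_cell :: "name \<Rightarrow> nat \<Rightarrow> nat \<Rightarrow> state \<Rightarrow> state" where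
  "set_cell A i k s = (fst s, (snd s)(A := (snd s A)(i := k)))"

text \<open>\<open>runs W c s t s'\<close>: started in \<open>s\<close>, the program \<open>c\<close> halts in \<open>s'\<close> after exactly \<open>t\<close> steps.\<close>

inductive runs :: "nat \<Rightarrow> com \<Rightarrow> state \<Rightarrow> nat \<Rightarrow> state \<Rightarrow> bool" for W :: nat where
  Skip: "runs W Skip s 1 s"
| Copy: "aval a s < W \<Longrightarrow> runs W (Copy x a) s 1 (set_var x (aval a s) s)"
| Add: "aval a s + aval b s < W \<Longrightarrow>
    runs W (Add x a b) s 1 (set_var x (aval a s + aval b s) s)"
| Sub: "aval a s - aval b s < W \<Longrightarrow>
    runs W (Sub x a b) s 1 (set_var x (aval a s - aval b s) s)"
| Load: "aval i s < W \<Longrightarrow> snd s A (aval i s) < W \<Longrightarrow>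
    runs W (Load x A i) s 1 (set_var x (snd s A (aval i s)) s)"
| Store: "aval i s < W \<Longrightarrow> aval a s < W \<Longrightarrow>
    runs W (Store A i a) s 1 (set_cell A (aval i s) (aval a s) s)"
| Seq: "runs W c1 s t1 s' \<Longrightarrow> runs W c2 s' t2 s'' \<Longrightarrow> runs W (Seq c1 c2) s (t1 + t2) s''"
| CondTrue: "tval b s \<Longrightarrow> runs W c1 s t s' \<Longrightarrow> runs W (Cond b c1 c2) s (Suc t) s'"
| CondFalse: "\<not> tval b s \<Longrightarrow> runs W c2 s t s' \<Longrightarrow> runs W (Cond b c1 c2) s (Suc t) s'"
| WhileFalse: "\<not> tval b s \<Longrightarrow> runs W (While b c) s 1 s"
| WhileTrue: "tval b s \<Longrightarrow> runs W c s t1 s' \<Longrightarrow> runs W (While b c) s' t2 s'' \<Longrightarrow>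
    runs W (While b c) s (Suc (t1 + t2)) s''"

inductive_cases runs_elims:
  "runs W Skip s t s'" "runs W (Copy x a) s t s'" "runs W (Add x a b) s t s'"
  "runs W (Sub x a b) s t s'" "runs W (Load x A i) s t s'" "runs W (Store A i a) s t s'"
  "runs W (Seq c1 c2) s t s'" "runs W (Cond b c1 c2) s t s'"

inductive_cases runs_WhileE: "runs W (While b c) s t s'"

lemma runs_deterministic:
  "runs W c s t s' \<Longrightarrow> runs W c s u s'' \<Longrightarrow> t = u \<and> s' = s''"
proof (induction arbitrary: u s'' rule: runs.induct)
  case (WhileTrue b s c t1 s1 t2 s2)
  from WhileTrue.prems WhileTrue.hyps(1) show ?case
    by (cases rule: runs_WhileE) (use WhileTrue.IH in blast)+
next
  case (WhileFalse b s c)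
  from WhileFalse.prems WhileFalse.hyps show ?case
    by (cases rule: runs_WhileE) auto
qed (fastforce elim!: runs_elims)+


section \<open>Input and output encoding\<close>

text \<open>A graph is presented to the machine as an edge list: \<open>vs\<close> numbers the nodes, and \<open>es\<close> lists
  every edge exactly once, as a pair of node numbers in either order.\<close>

definition encodes_graph ::
    "'a list \<Rightarrow> (nat \<times> nat) list \<Rightarrow> 'a set \<Rightarrow> 'a set set \<Rightarrow> bool" where
  "encodes_graph vs es V E \<longleftrightarrow>
     distinct vs \<and> set vs = V \<and>
     (\<forall>(i, j)\<in>set es. i < length vs \<and> j < length vs) \<and>
     distinct (map (\<lambda>(i, j). {vs ! i, vs ! j}) es) \<and>
     set (map (\<lambda>(i, j). {vs ! i, vs ! j}) es) = E"

definition input_state :: "nat \<Rightarrow> (nat \<times> nat) list \<Rightarrow> state" where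
  "input_state n es =
     ((\<lambda>_. 0)(''n'' := n, ''m'' := length es),
      (\<lambda>_ _. 0)(''src'' := (\<lambda>i. if i < length es then fst (es ! i) else 0),
               ''dst'' := (\<lambda>i. if i < length es then snd (es ! i) else 0)))"

text \<open>The output array has one entry per edge: 0 directs the edge as it is listed, anything else
  reverses it.\<close>

definition output_orientation ::
    "'a list \<Rightarrow> (nat \<times> nat) list \<Rightarrow> state \<Rightarrow> ('a \<times> 'a) set" where
  "output_orientation vs es s =
     {if snd s ''out'' k = 0 then (vs ! fst (es ! k), vs ! snd (es ! k))
      else (vs ! snd (es ! k), vs ! fst (es ! k)) |k. k < length es}"

end

theory Submission
  imports Defs
begin

text \<open>
  An edge directed from \<open>u\<close> to \<open>w\<close> has the color of \<open>u\<close>. The colors at a node \<open>v\<close> are therefore the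
  pairwise different colors of the tails of the edges that enter \<open>v\<close>, together with the color of
  \<open>v\<close> itself if some edge leaves \<open>v\<close>: the number of colors at \<open>v\<close> is the indegree of \<open>v\<close>, plus one
  if the indegree is smaller than the degree. At most \<open>k\<close> colors at every node thus means indegree
  less than \<open>k\<close> at the nodes of degree more than \<open>k\<close>, and nothing at the others. Likewise, indegree
  at most \<open>k\<close> is a condition on the nodes of degree more than \<open>k\<close> only. So both problems ask for
  indegrees below a capacity function, and the two families of capacity functions interleave into
  one increasing chain \<open>level_cap\<close>: level \<open>2 * k - 1\<close> stands for \<open>k\<close> colors, level \<open>2 * k\<close> for
  indegree \<open>k\<close>. An orientation that meets the least feasible level is optimal for both problems
  (\<open>least_level_optimal\<close>), and binary search finds that level with \<open>log 2 \<Delta> + O(1)\<close> tests.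

  A test starts from any orientation and moves surplus indegree around: reversing an edge from \<open>u\<close>
  to \<open>v\<close> takes one unit from \<open>v\<close> to \<open>u\<close>. This is a flow in a network with unit capacities. Let
  \<open>L\<close> be least with \<open>m \<le> L\<^sup>2\<close> or \<open>n\<^sup>2 \<le> L\<^sup>3\<close>, so that \<open>L\<close> is about
  \<open>min (n powr (2/3)) (m powr (1/2))\<close>. Push-relabel with labels up to \<open>L\<close> takes time \<open>O(L * m)\<close>,
  because with unit capacities every push saturates its arc and needs a relabeling before it can
  be undone and repeated. Afterwards every node with surplus has label \<open>L\<close>. The arcs between
  consecutive label layers form \<open>L\<close> disjoint cuts, each of which bounds the surplus if the
  capacities can be met at all. By averaging some cut has at most \<open>m / L\<close> arcs, and, as the graph
  is simple, some cut lies between layers with so few nodes that it has at most \<open>(n / L)\<^sup>2\<close> arcs.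
  Either way the surplus is at most \<open>L\<close> (\<open>excess_le_labels\<close>), so that \<open>L\<close> searches for an
  augmenting path of linear time each complete the test.

  Running times are proved with potentials: a loop whose body is free of loops takes a number of
  iterations bounded by a potential that every iteration decreases (\<open>tri_While_potential\<close>), and
  correctness of such a body is a weakest precondition that the simplifier computes. A connected
  graph with an edge has at most \<open>2 * m\<close> nodes, which turns times linear in \<open>n + m\<close> into \<open>O(m)\<close>.
\<close>

section \<open>Timed total correctness\<close>

text \<open>States are pairs; without these rules the simplifier keeps them as single variables.\<close>

declare split_paired_Ex [simp del] split_paired_All [simp del]

notation Seq (infixr ";;" 60)

fun written_vars :: "com \<Rightarrow> name set" where
  "written_vars Skip = {}"
| "written_vars (Copy x a) = {x}"
| "written_vars (Add x a b) = {x}"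
| "written_vars (Sub x a b) = {x}"
| "written_vars (Load x A i) = {x}"
| "written_vars (Store A i a) = {}"
| "written_vars (c1 ;; c2) = written_vars c1 \<union> written_vars c2"
| "written_vars (Cond b c1 c2) = written_vars c1 \<union> written_vars c2"
| "written_vars (While b c) = written_vars c"

fun written_arrays :: "com \<Rightarrow> name set" where
  "written_arrays (Store A i a) = {A}"
| "written_arrays (c1 ;; c2) = written_arrays c1 \<union> written_arrays c2"
| "written_arrays (Cond b c1 c2) = written_arrays c1 \<union> written_arrays c2"
| "written_arrays (While b c) = written_arrays c"
| "written_arrays _ = {}"

definition unchanged :: "com \<Rightarrow> state \<Rightarrow> state \<Rightarrow> bool" where
  "unchanged c s s' \<longleftrightarrow> (\<forall>x. x \<notin> written_vars c \<longrightarrow> fst s' x = fst s x) \<and>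
     (\<forall>A. A \<notin> written_arrays c \<longrightarrow> snd s' A = snd s A)"

lemma unchanged_var: "unchanged c s s' \<Longrightarrow> x \<notin> written_vars c \<Longrightarrow> fst s' x = fst s x"
  and unchanged_array: "unchanged c s s' \<Longrightarrow> A \<notin> written_arrays c \<Longrightarrow> snd s' A = snd s A"
  by (auto simp: unchanged_def)

lemma unchanged_refl: "unchanged c s s"
  by (simp add: unchanged_def)

lemma unchanged_trans: "unchanged c s s' \<Longrightarrow> unchanged c s' s'' \<Longrightarrow> unchanged c s s''"
  by (simp add: unchanged_def)

lemma fst_set_var [simp]: "fst (set_var x k s) = (fst s)(x := k)"
  and snd_set_var [simp]: "snd (set_var x k s) = snd s"
  and fst_set_cell [simp]: "fst (set_cell A i k s) = fst s"
  and snd_set_cell [simp]: "snd (set_cell A i k s) = (snd s)(A := (snd s A)(i := k))"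
  by (simp_all add: set_var_def set_cell_def)

lemma runs_unchanged: "runs W c s t s' \<Longrightarrow> unchanged c s s'"
  by (induction rule: runs.induct) (auto simp: unchanged_def)

text \<open>A Hoare triple for total correctness with a time bound, for a single initial state.\<close>

definition tri :: "nat \<Rightarrow> com \<Rightarrow> state \<Rightarrow> nat \<Rightarrow> (state \<Rightarrow> bool) \<Rightarrow> bool" where
  "tri W c s T Q \<longleftrightarrow> (\<exists>t s'. runs W c s t s' \<and> t \<le> T \<and> Q s')"

lemma tri_mono:
  "tri W c s T Q \<Longrightarrow> T \<le> T' \<Longrightarrow> (\<And>s'. unchanged c s s' \<Longrightarrow> Q s' \<Longrightarrow> Q' s') \<Longrightarrow> tri W c s T' Q'"
  unfolding tri_def by (meson order_trans runs_unchanged)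

lemma tri_Seq:
  assumes "tri W c1 s T1 R"
    and "\<And>s'. R s' \<Longrightarrow> unchanged c1 s s' \<Longrightarrow> tri W c2 s' T2 Q"
    and "T1 + T2 \<le> T"
  shows "tri W (c1 ;; c2) s T Q"
proof -
  obtain t1 s1 where 1: "runs W c1 s t1 s1" "t1 \<le> T1" "R s1"
    using assms(1) by (auto simp: tri_def)
  obtain t2 s2 where 2: "runs W c2 s1 t2 s2" "t2 \<le> T2" "Q s2"
    using assms(2)[OF 1(3) runs_unchanged[OF 1(1)]] by (auto simp: tri_def)
  show ?thesis
    unfolding tri_def using runs.Seq[OF 1(1) 2(1)] 1(2) 2 assms(3) by (intro exI[of _ "t1 + t2"]) auto
qed

lemma tri_Copy_Seq:
  "aval a s < W \<Longrightarrow> tri W c (set_var x (aval a s) s) T Q \<Longrightarrow> Suc T \<le> T' \<Longrightarrow> tri W (Copy x a ;; c) s T' Q"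
  unfolding tri_def by (metis One_nat_def Suc_le_mono le_trans plus_1_eq_Suc runs.Copy runs.Seq)

lemma tri_Add_Seq:
  "aval a s + aval b s < W \<Longrightarrow> tri W c (set_var x (aval a s + aval b s) s) T Q \<Longrightarrow> Suc T \<le> T' \<Longrightarrow>
    tri W (Add x a b ;; c) s T' Q"
  unfolding tri_def by (metis One_nat_def Suc_le_mono le_trans plus_1_eq_Suc runs.Add runs.Seq)

lemma tri_Sub_Seq:
  "aval a s - aval b s < W \<Longrightarrow> tri W c (set_var x (aval a s - aval b s) s) T Q \<Longrightarrow> Suc T \<le> T' \<Longrightarrow>
    tri W (Sub x a b ;; c) s T' Q"
  unfolding tri_def by (metis One_nat_def Suc_le_mono le_trans plus_1_eq_Suc runs.Sub runs.Seq)

lemma tri_Cond: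
  assumes "tval b s \<Longrightarrow> tri W c1 s T Q" "\<not> tval b s \<Longrightarrow> tri W c2 s T Q" "T < T'"
  shows "tri W (Cond b c1 c2) s T' Q"
proof (cases "tval b s")
  case True
  then show ?thesis
    using assms(1,3) unfolding tri_def
    by (metis (no_types) True runs.CondTrue Suc_leI le_less_trans)
next
  case False
  then show ?thesis
    using assms(2,3) unfolding tri_def
    by (metis (no_types) False runs.CondFalse Suc_leI le_less_trans)
qed

text \<open>The precondition of a loop is \<open>False\<close>: the function serves for the loop-free bodies of loops,
  and sequences that contain loops are composed with \<open>tri_Seq\<close>.\<close>

fun wp :: "nat \<Rightarrow> com \<Rightarrow> (state \<Rightarrow> bool) \<Rightarrow> state \<Rightarrow> bool" where
  "wp W Skip Q s \<longleftrightarrow> Q s"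
| "wp W (Copy x a) Q s \<longleftrightarrow> aval a s < W \<and> Q (set_var x (aval a s) s)"
| "wp W (Add x a b) Q s \<longleftrightarrow> aval a s + aval b s < W \<and> Q (set_var x (aval a s + aval b s) s)"
| "wp W (Sub x a b) Q s \<longleftrightarrow> aval a s - aval b s < W \<and> Q (set_var x (aval a s - aval b s) s)"
| "wp W (Load x A i) Q s \<longleftrightarrow> aval i s < W \<and> snd s A (aval i s) < W \<and>
     Q (set_var x (snd s A (aval i s)) s)"
| "wp W (Store A i a) Q s \<longleftrightarrow> aval i s < W \<and> aval a s < W \<and> Q (set_cell A (aval i s) (aval a s) s)"
| "wp W (c1 ;; c2) Q s \<longleftrightarrow> wp W c1 (wp W c2 Q) s"
| "wp W (Cond b c1 c2) Q s \<longleftrightarrow> (if tval b s then wp W c1 Q s else wp W c2 Q s)"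
| "wp W (While b c) Q s \<longleftrightarrow> False"

lemma wp_mono: "wp W c Q s \<Longrightarrow> (\<And>s. Q s \<Longrightarrow> Q' s) \<Longrightarrow> wp W c Q' s"
proof (induction c arbitrary: Q Q' s)
  case (Seq c1 c2)
  show ?case
    using Seq.IH(1)[of "wp W c2 Q" s "wp W c2 Q'"] Seq.IH(2)[of Q _ Q'] Seq.prems by simp
next
  case (Cond b c1 c2)
  show ?case
    using Cond.IH(1)[of Q s Q'] Cond.IH(2)[of Q s Q'] Cond.prems by (simp split: if_splits)
qed simp_all

fun cost :: "com \<Rightarrow> nat" where
  "cost (c1 ;; c2) = cost c1 + cost c2"
| "cost (Cond b c1 c2) = Suc (max (cost c1) (cost c2))"
| "cost _ = 1"

lemma tri_straight:
  assumes "wp W c Q s" "cost c \<le> T"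
  shows "tri W c s T Q"
proof -
  have "wp W c Q s \<Longrightarrow> \<exists>t s'. runs W c s t s' \<and> t \<le> cost c \<and> Q s'"
  proof (induction c arbitrary: Q s)
    case (Seq c1 c2)
    from Seq.IH(1)[of "wp W c2 Q" s] Seq.prems
    obtain t1 s1 where 1: "runs W c1 s t1 s1" "t1 \<le> cost c1" "wp W c2 Q s1"
      by auto
    then obtain t2 s2 where "runs W c2 s1 t2 s2" "t2 \<le> cost c2" "Q s2"
      using Seq.IH(2) by blast
    with 1 show ?case
      by (intro exI[of _ "t1 + t2"] exI[of _ s2]) (auto intro: runs.intros)
  next
    case (Cond b c1 c2)
    show ?case
    proof (cases "tval b s")
      case True
      then obtain t s' where "runs W c1 s t s'" "t \<le> cost c1" "Q s'"
        using Cond.IH(1)[of Q s] Cond.prems by auto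
      then show ?thesis
        using runs.CondTrue[OF True] by (intro exI[of _ "Suc t"] exI[of _ s']) auto
    next
      case False
      then obtain t s' where "runs W c2 s t s'" "t \<le> cost c2" "Q s'"
        using Cond.IH(2)[of Q s] Cond.prems by auto
      then show ?thesis
        using runs.CondFalse[OF False] by (intro exI[of _ "Suc t"] exI[of _ s']) auto
    qed
  qed (simp only: wp.simps cost.simps, blast intro: runs.intros order_refl | simp)+
  then show ?thesis
    using assms by (fastforce simp: tri_def)
qed

text \<open>The index \<open>q\<close> of the invariant bounds the number of remaining iterations. A ghost index,
  rather than a function of the state, suits binary search, where it is the logarithm of a bound on
  the length of the interval.\<close>

lemma tri_While:
  assumes "I q s"
    and body: "\<And>q s'. I q s' \<Longrightarrow> unchanged c s s' \<Longrightarrow> tval b s' \<Longrightarrow>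
       tri W c s' T (\<lambda>s''. \<exists>q'<q. I q' s'')"
    and "q * (T + 1) + 1 \<le> T'"
  shows "tri W (While b c) s T' (\<lambda>s'. (\<exists>q. I q s') \<and> \<not> tval b s')"
proof -
  have "unchanged c s s' \<Longrightarrow> I q s' \<Longrightarrow>
    tri W (While b c) s' (q * (T + 1) + 1) (\<lambda>s'. (\<exists>q. I q s') \<and> \<not> tval b s')" for s'
  proof (induction q arbitrary: s' rule: less_induct)
    case (less q)
    show ?case
    proof (cases "tval b s'")
      case True
      then obtain t1 s1 q1 where 1: "runs W c s' t1 s1" "t1 \<le> T" "q1 < q" "I q1 s1"
        using body[OF less.prems(2,1)] by (auto simp: tri_def)
      then obtain t2 s2 where 2: "runs W (While b c) s1 t2 s2" "t2 \<le> q1 * (T + 1) + 1"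
          "\<exists>q. I q s2" "\<not> tval b s2"
        using less.IH[OF 1(3) unchanged_trans[OF less.prems(1) runs_unchanged[OF 1(1)]] 1(4)]
        unfolding tri_def by blast
      have "Suc (t1 + t2) \<le> Suc q1 * (T + 1) + 1"
        using 1 2 by simp
      also have "\<dots> \<le> q * (T + 1) + 1"
        using 1(3) by (intro add_right_mono mult_right_mono) auto
      finally show ?thesis
        unfolding tri_def using runs.WhileTrue[OF True 1(1) 2(1)] 2 by blast
    next
      case False
      then show ?thesis
        unfolding tri_def using runs.WhileFalse[OF False] less.prems
        by (intro exI[of _ 1] exI[of _ s']) auto
    qed
  qed
  from this[OF unchanged_refl assms(1)] show ?thesis
    by (rule tri_mono) (use assms(3) in simp_all)
qed

lemma tri_While_potential:
  assumes "I s"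
    and body: "\<And>s'. I s' \<Longrightarrow> unchanged c s s' \<Longrightarrow> tval b s' \<Longrightarrow> wp W c (\<lambda>s''. I s'' \<and> \<Phi> s'' < \<Phi> s') s'"
    and "\<Phi> s * (cost c + 1) + 1 \<le> T"
  shows "tri W (While b c) s T (\<lambda>s'. I s' \<and> \<not> tval b s')"
proof -
  have "tri W (While b c) s T (\<lambda>s'. (\<exists>q. I s' \<and> \<Phi> s' = q) \<and> \<not> tval b s')"
  proof (rule tri_While[where T = "cost c" and q = "\<Phi> s"])
    show "tri W c s' (cost c) (\<lambda>s''. \<exists>q'<q. I s'' \<and> \<Phi> s'' = q')"
      if "I s' \<and> \<Phi> s' = q" "unchanged c s s'" "tval b s'" for q s'
      using tri_straight[OF body, of s' "cost c"] that
      by (auto elim!: tri_mono)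
  qed (use assms in auto)
  then show ?thesis
    by simp
qed

definition For :: "name \<Rightarrow> name \<Rightarrow> com \<Rightarrow> com" where
  "For i N c = (Copy i (Const 0) ;; While (Less (Var i) (Var N)) (c ;; Add i (Var i) (Const 1)))"

lemma written_For [simp]:
  "written_vars (For i N c) = insert i (written_vars c)"
  "written_arrays (For i N c) = written_arrays c"
  by (auto simp: For_def)

text \<open>The invariant \<open>I k\<close> is about the state at the head of iteration \<open>k\<close>, in which the loop variable
  already has the value \<open>k\<close>. The body must not write it; the rule performs the increment.\<close>

lemma tri_For:
  assumes init: "I 0 (set_var i 0 s)"
    and body: "\<And>k s'. k < N \<Longrightarrow> I k s' \<Longrightarrow> unchanged (For i M c) s s' \<Longrightarrow> fst s' i = k \<Longrightarrow>
       tri W c s' T (\<lambda>s''. I (Suc k) (set_var i (Suc k) s''))"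
    and N: "fst s M = N" "N < W"
    and fresh: "i \<notin> written_vars c" "M \<notin> written_vars c" "i \<noteq> M"
    and T: "N * (T + 2) + 2 \<le> T'"
  shows "tri W (For i M c) s T' (I N)"
  unfolding For_def
proof (rule tri_Seq[of _ _ _ 1 _ _ "N * (T + 2) + 1"])
  let ?R = "\<lambda>s'. unchanged (For i M c) s s' \<and> I 0 s' \<and> fst s' i = 0"
  show "tri W (Copy i (Const 0)) s 1 ?R"
    using N init by (intro tri_straight) (auto simp: unchanged_def)
  fix s1 assume s1: "?R s1"
  let ?I = "\<lambda>q s'. unchanged (For i M c) s s' \<and> I (fst s' i) s' \<and> fst s' i + q = N"
  have M: "fst s' M = N" if "unchanged (For i M c) s s'" for s'
    using unchanged_var[OF that] N fresh by simp
  have "tri W (While (Less (Var i) (Var M)) (c ;; Add i (Var i) (Const 1))) s1 (N * (T + 2) + 1)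
    (\<lambda>s'. (\<exists>q. ?I q s') \<and> \<not> tval (Less (Var i) (Var M)) s')"
  proof (rule tri_While[where T = "T + 1" and q = N])
    show "?I N s1"
      using s1 by simp
    fix q s' assume I: "?I q s'" and b: "tval (Less (Var i) (Var M)) s'"
    then have k: "fst s' i < N"
      using M by auto
    show "tri W (c ;; Add i (Var i) (Const 1)) s' (T + 1) (\<lambda>s''. \<exists>q'<q. ?I q' s'')"
    proof (rule tri_Seq[OF body[OF k]])
      fix s2 assume s2: "I (Suc (fst s' i)) (set_var i (Suc (fst s' i)) s2)" "unchanged c s' s2"
      have i: "fst s2 i = fst s' i"
        using s2(2) fresh unchanged_var by blast
      have "unchanged (For i M c) s (set_var i (Suc (fst s' i)) s2)"
        using I s2(2) by (simp add: unchanged_def)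
      then show "tri W (Add i (Var i) (Const 1)) s2 1 (\<lambda>s''. \<exists>q'<q. ?I q' s'')"
        using I i k N s2(1) by (intro tri_straight) (auto intro!: exI[of _ "q - 1"])
    qed (use I in auto)
  qed auto
  then show "tri W (While (Less (Var i) (Var M)) (c ;; Add i (Var i) (Const 1))) s1 (N * (T + 2) + 1) (I N)"
  proof (rule tri_mono)
    fix s' assume "(\<exists>q. ?I q s') \<and> \<not> tval (Less (Var i) (Var M)) s'"
    then obtain q where q: "?I q s'" "\<not> fst s' i < fst s' M"
      by auto
    then have "fst s' i = N"
      using M[of s'] by simp
    then show "I N s'"
      using q by simp
  qed simp
qed (use T in auto)

lemma tri_For_straight:
  assumes "I 0 (set_var i 0 s)"
    and body: "\<And>k s'. k < N \<Longrightarrow> I k s' \<Longrightarrow> unchanged (For i M c) s s' \<Longrightarrow> fst s' i = k \<Longrightarrow>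
       wp W c (\<lambda>s''. I (Suc k) (set_var i (Suc k) s'')) s'"
    and "fst s M = N" "N < W" "i \<notin> written_vars c" "M \<notin> written_vars c" "i \<noteq> M"
    and "N * (cost c + 2) + 2 \<le> T"
  shows "tri W (For i M c) s T (I N)"
  by (rule tri_For[where T = "cost c", OF assms(1) tri_straight[OF body order_refl] assms(3-)])

section \<open>Orientations with bounded indegrees\<close>

type_synonym table = "nat \<Rightarrow> nat"

text \<open>Every edge consists of two half-edges, numbered from 1 so that 0 can end a linked list: \<open>own h\<close>
  is the node of half-edge \<open>h\<close>, and \<open>opp h\<close> is the other half of its edge. The last assumption says
  that there are no parallel edges.\<close>

locale half_edges =
  fixes n m :: nat and own opp :: "nat \<Rightarrow> nat"
  assumes own_less: "\<lbrakk>0 < h; h \<le> 2 * m\<rbrakk> \<Longrightarrow> own h < n"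
    and opp_range: "\<lbrakk>0 < h; h \<le> 2 * m\<rbrakk> \<Longrightarrow> 0 < opp h \<and> opp h \<le> 2 * m"
    and opp_opp: "\<lbrakk>0 < h; h \<le> 2 * m\<rbrakk> \<Longrightarrow> opp (opp h) = h"
    and own_opp: "\<lbrakk>0 < h; h \<le> 2 * m\<rbrakk> \<Longrightarrow> own (opp h) \<noteq> own h"
    and half_edge_eqI: "\<lbrakk>0 < h; h \<le> 2 * m; 0 < h'; h' \<le> 2 * m; own h = own h';
       own (opp h) = own (opp h')\<rbrakk> \<Longrightarrow> h = h'"
begin

abbreviation is_half :: "nat \<Rightarrow> bool" where
  "is_half h \<equiv> 0 < h \<and> h \<le> 2 * m"

abbreviation other :: "nat \<Rightarrow> nat" where
  "other h \<equiv> own (opp h)"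

lemma opp_half: "is_half h \<Longrightarrow> is_half (opp h)"
  using opp_range by blast

lemma other_less: "is_half h \<Longrightarrow> other h < n"
  using opp_range own_less by blast

lemma opp_neq: "is_half h \<Longrightarrow> opp h \<noteq> h"
  using own_opp by metis

lemma finite_halves [simp]: "finite {h. is_half h \<and> P h}"
  by (rule finite_subset[of _ "{..2 * m}"]) auto

text \<open>\<open>inc h = 1\<close> means that the edge of \<open>h\<close> enters the node of \<open>h\<close>.\<close>

definition orient :: "(nat \<Rightarrow> nat) \<Rightarrow> bool" where
  "orient inc \<longleftrightarrow> (\<forall>h. is_half h \<longrightarrow> inc h \<le> 1 \<and> inc h + inc (opp h) = 1)"

definition indeg :: "(nat \<Rightarrow> nat) \<Rightarrow> nat \<Rightarrow> nat" where
  "indeg inc v = card {h. is_half h \<and> own h = v \<and> inc h = 1}"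

definition halves_upto :: "nat \<Rightarrow> nat \<Rightarrow> nat" where
  "halves_upto v b = card {h. 0 < h \<and> h \<le> b \<and> own h = v}"

abbreviation degr :: "nat \<Rightarrow> nat" where
  "degr v \<equiv> halves_upto v (2 * m)"

text \<open>The half-edges of a node form a linked list in decreasing order, in which \<open>below (own h) h\<close>
  follows \<open>h\<close> and 0 marks the end. A list pointer at \<open>c\<close> has passed exactly the half-edges above
  \<open>c\<close>, and \<open>halves_upto v c\<close> entries remain.\<close>

definition below :: "nat \<Rightarrow> nat \<Rightarrow> nat" where
  "below v b = Max (insert 0 {h. 0 < h \<and> h < b \<and> own h = v})"

definition feasible :: "(nat \<Rightarrow> nat) \<Rightarrow> bool" where
  "feasible cap \<longleftrightarrow> (\<exists>inc. orient inc \<and> (\<forall>v<n. indeg inc v \<le> cap v))"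

definition excess :: "(nat \<Rightarrow> nat) \<Rightarrow> (nat \<Rightarrow> nat) \<Rightarrow> nat" where
  "excess cap ind = (\<Sum>v<n. ind v - cap v)"

lemma orientD: "orient inc \<Longrightarrow> is_half h \<Longrightarrow> inc h \<le> 1 \<and> inc h + inc (opp h) = 1"
  by (simp add: orient_def)

lemma excess_eq_0: "excess cap ind = 0 \<longleftrightarrow> (\<forall>v<n. ind v \<le> cap v)"
  by (auto simp: excess_def)

subsection \<open>Incidence lists\<close>

lemma below_cases:
  "below v b = 0 \<or> 0 < below v b \<and> below v b < b \<and> own (below v b) = v"
proof -
  have "finite {h. 0 < h \<and> h < b \<and> own h = v}"
    by (rule finite_subset[of _ "{..b}"]) auto
  then have "below v b \<in> insert 0 {h. 0 < h \<and> h < b \<and> own h = v}"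
    unfolding below_def by (intro Max_in) auto
  then show ?thesis
    by auto
qed

lemma below_ge: "0 < h \<Longrightarrow> h < b \<Longrightarrow> own h = v \<Longrightarrow> h \<le> below v b"
  unfolding below_def by (rule Max_ge) (auto intro: finite_subset[of _ "{..b}"])

lemma below_Suc: "0 < h \<Longrightarrow> below v (Suc h) = (if own h = v then h else below v h)"
proof -
  assume h: "0 < h"
  have fin: "finite {k. 0 < k \<and> k < h \<and> own k = v}"
    by (rule finite_subset[of _ "{..h}"]) auto
  show ?thesis
  proof (cases "own h = v")
    case True
    have "h \<le> below v (Suc h)"
      using True h by (intro below_ge) auto
    then show ?thesis
      using below_cases[of v "Suc h"] True by auto
  next
    case False
    then have "{k. 0 < k \<and> k < Suc h \<and> own k = v} = {k. 0 < k \<and> k < h \<and> own k = v}"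
      by (auto simp: less_Suc_eq)
    then show ?thesis
      using False by (simp add: below_def)
  qed
qed

lemma below_1 [simp]: "below v (Suc 0) = 0"
  using below_cases[of v "Suc 0"] by auto

lemma halves_upto_0 [simp]: "halves_upto v 0 = 0"
  unfolding halves_upto_def by (rule card_eq_0_iff[THEN iffD2]) auto

lemma halves_upto_Suc: "halves_upto v (Suc b) = halves_upto v b + (if own (Suc b) = v then 1 else 0)"
proof -
  have fin: "finite {h. 0 < h \<and> h \<le> b \<and> own h = v}"
    by (rule finite_subset[of _ "{..b}"]) auto
  have "{h. 0 < h \<and> h \<le> Suc b \<and> own h = v} =
      (if own (Suc b) = v then insert (Suc b) else id) {h. 0 < h \<and> h \<le> b \<and> own h = v}"
    by (auto simp: le_Suc_eq)
  then show ?thesis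
    using fin by (simp add: halves_upto_def)
qed

lemma halves_upto_below:
  assumes "0 < b"
  shows "halves_upto v (below v b) = halves_upto v (b - 1)"
proof -
  have "h \<le> below v b \<longleftrightarrow> h \<le> b - 1" if "0 < h" "own h = v" for h
  proof
    show "h \<le> below v b \<Longrightarrow> h \<le> b - 1"
      using below_cases[of v b] that by linarith
    show "h \<le> b - 1 \<Longrightarrow> h \<le> below v b"
      using below_ge[of h b v] that assms by linarith
  qed
  then have "{h. 0 < h \<and> h \<le> below v b \<and> own h = v} = {h. 0 < h \<and> h \<le> b - 1 \<and> own h = v}"
    by blast
  then show ?thesis
    by (simp add: halves_upto_def)
qed

lemma halves_upto_below_own:
  "0 < h \<Longrightarrow> own h = v \<Longrightarrow> halves_upto v h = Suc (halves_upto v (below v h))"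
  using halves_upto_Suc[of v "h - 1"] by (simp add: halves_upto_below)

lemma halves_upto_first [simp]: "halves_upto v (below v (Suc (2 * m))) = degr v"
  by (simp add: halves_upto_below)

lemma sum_halves_upto: "b \<le> 2 * m \<Longrightarrow> (\<Sum>v<n. halves_upto v b) = b"
proof (induction b)
  case (Suc b)
  then have "own (Suc b) < n"
    by (intro own_less) auto
  then show ?case
    using Suc by (simp add: halves_upto_Suc sum.distrib)
qed simp

lemma degr_le: "degr v \<le> 2 * m"
proof -
  have "degr v \<le> card {0<..2 * m}"
    unfolding halves_upto_def by (rule card_mono) auto
  then show ?thesis
    by simp
qed

lemma other_inj: "inj_on other {h. is_half h \<and> own h = v \<and> P h}"
  by (auto simp: inj_on_def intro: half_edge_eqI)

lemma degr_less: "degr v \<le> n"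
proof -
  have "card (other ` {h. is_half h \<and> own h = v \<and> True}) \<le> card {..<n}"
    by (rule card_mono) (auto simp: other_less)
  then show ?thesis
    using card_image[OF other_inj[of v "\<lambda>_. True"]] by (simp add: halves_upto_def)
qed

lemma indeg_le_degr: "indeg inc v \<le> degr v"
  unfolding indeg_def halves_upto_def by (rule card_mono) (auto intro: finite_subset[of _ "{..2 * m}"])

subsection \<open>Cuts\<close>

lemma sum_indeg:
  "finite S \<Longrightarrow> (\<Sum>v\<in>S. indeg inc v) = card {h. is_half h \<and> own h \<in> S \<and> inc h = 1}"
proof (induction S rule: finite_induct)
  case (insert v S)
  have "{h. is_half h \<and> own h \<in> insert v S \<and> inc h = 1} =
      {h. is_half h \<and> own h = v \<and> inc h = 1} \<union> {h. is_half h \<and> own h \<in> S \<and> inc h = 1}"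
    by blast
  moreover have "card ({h. is_half h \<and> own h = v \<and> inc h = 1} \<union> {h. is_half h \<and> own h \<in> S \<and> inc h = 1}) =
      indeg inc v + card {h. is_half h \<and> own h \<in> S \<and> inc h = 1}"
    unfolding indeg_def by (rule card_Un_disjoint) (use insert.hyps in auto)
  ultimately show ?case
    using insert by simp
qed simp

lemma card_inner:
  assumes "orient inc"
  shows "2 * card {h. is_half h \<and> own h \<in> S \<and> other h \<in> S \<and> inc h = 1} =
    card {h. is_half h \<and> own h \<in> S \<and> other h \<in> S}"
proof -
  let ?A = "\<lambda>i. {h. is_half h \<and> own h \<in> S \<and> other h \<in> S \<and> inc h = (i :: nat)}"
  have opp: "opp (opp h) = h \<and> is_half (opp h) \<and> inc (opp h) = 1 - inc h" if "is_half h" for h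
    using opp_opp[OF that[THEN conjunct1] that[THEN conjunct2]] opp_half[OF that] orientD[OF assms that]
    by linarith
  have "bij_betw opp (?A 1) (?A 0)"
  proof (rule bij_betw_byWitness[where f' = opp])
    show "\<forall>h\<in>?A 1. opp (opp h) = h" "\<forall>h\<in>?A 0. opp (opp h) = h"
      using opp by blast+
    show "opp ` ?A 1 \<subseteq> ?A 0" "opp ` ?A 0 \<subseteq> ?A 1"
      using opp by (simp_all add: image_subset_iff)
  qed
  then have "card (?A 1) = card (?A 0)"
    by (rule bij_betw_same_card)
  moreover have "{h. is_half h \<and> own h \<in> S \<and> other h \<in> S} = ?A 1 \<union> ?A 0"
  proof -
    have "inc h = 1 \<or> inc h = 0" if "is_half h" for h
      using orientD[OF assms that] by linarith
    then show ?thesis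
      by blast
  qed
  moreover have "card (?A 1 \<union> ?A 0) = card (?A 1) + card (?A 0)"
    by (intro card_Un_disjoint) auto
  ultimately show ?thesis
    by simp
qed

lemma card_orient: "orient inc \<Longrightarrow> card {h. is_half h \<and> inc h = 1} = m"
  using card_inner[of inc UNIV] card_greaterThanAtMost[of 0 "2 * m"]
  by (simp add: greaterThanAtMost_def greaterThan_def atMost_def Int_def)

lemma sum_indeg_all: "orient inc \<Longrightarrow> (\<Sum>v<n. indeg inc v) = m"
proof -
  assume a: "orient inc"
  have "{h. is_half h \<and> own h \<in> {..<n} \<and> inc h = 1} = {h. is_half h \<and> inc h = 1}"
    by (auto simp: own_less)
  then show ?thesis
    using card_orient[OF a] sum_indeg[of "{..<n}" inc] by simp
qed

text \<open>The edges inside \<open>S\<close> contribute the same amount to the indegrees of \<open>S\<close> in every orientation,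
  so an orientation that respects the capacities shows that the total capacity of \<open>S\<close> is at least
  their number. What \<open>S\<close> receives beyond its capacity must therefore enter from outside.\<close>

lemma excess_cut:
  assumes inc: "orient inc" and S: "S \<subseteq> {..<n}" and full: "\<And>v. v \<in> S \<Longrightarrow> cap v \<le> indeg inc v"
    and feas: "feasible cap"
  shows "(\<Sum>v\<in>S. indeg inc v - cap v) \<le>
    card {h. is_half h \<and> inc h = 1 \<and> own h \<in> S \<and> other h \<notin> S}"
proof -
  obtain inc' where inc': "orient inc'" "\<And>v. v < n \<Longrightarrow> indeg inc' v \<le> cap v"
    using feas by (auto simp: feasible_def)
  have fin: "finite S"
    using S finite_subset by blast
  let ?I = "\<lambda>i. {h. is_half h \<and> own h \<in> S \<and> other h \<in> S \<and> i h = (1 :: nat)}"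
  let ?B = "{h. is_half h \<and> inc h = 1 \<and> own h \<in> S \<and> other h \<notin> S}"
  have "(\<Sum>v\<in>S. indeg inc v) = card (?I inc \<union> ?B)"
    unfolding sum_indeg[OF fin] by (rule arg_cong[of _ _ card]) blast
  moreover have "card (?I inc \<union> ?B) = card (?I inc) + card ?B"
    by (rule card_Un_disjoint) auto
  moreover have "card (?I inc) = card (?I inc')"
    using card_inner[OF inc, of S] card_inner[OF inc'(1), of S] by simp
  moreover have "card (?I inc') \<le> card {h. is_half h \<and> own h \<in> S \<and> inc' h = 1}"
    by (rule card_mono) auto
  moreover have "card {h. is_half h \<and> own h \<in> S \<and> inc' h = 1} = (\<Sum>v\<in>S. indeg inc' v)"
    by (rule sum_indeg[OF fin, symmetric])
  moreover have "(\<Sum>v\<in>S. indeg inc' v) \<le> (\<Sum>v\<in>S. cap v)"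
    using inc'(2) S by (intro sum_mono) auto
  ultimately have "(\<Sum>v\<in>S. indeg inc v) \<le>
      (\<Sum>v\<in>S. cap v) + card {h. is_half h \<and> inc h = 1 \<and> own h \<in> S \<and> other h \<notin> S}"
    by simp
  moreover have "(\<Sum>v\<in>S. indeg inc v) = (\<Sum>v\<in>S. indeg inc v - cap v) + (\<Sum>v\<in>S. cap v)"
    unfolding sum.distrib[symmetric] by (rule sum.cong) (use full in auto)
  ultimately show ?thesis
    by simp
qed

text \<open>The set \<open>S\<close> of nodes with label at least \<open>i\<close> contains all nodes with surplus and none with spare
  capacity, as labels of the latter are 0. Since labels drop by at most one along an arc, every arc
  that crosses the cut runs between layers \<open>i\<close> and \<open>i - 1\<close>.\<close>

lemma excess_le_layer:
  assumes inc: "orient inc"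
    and valid: "\<And>h. is_half h \<Longrightarrow> inc h = 1 \<Longrightarrow> d (own h) \<le> d (other h) + 1"
    and full: "\<And>v. v < n \<Longrightarrow> 0 < d v \<Longrightarrow> cap v \<le> indeg inc v"
    and far: "\<And>v. v < n \<Longrightarrow> cap v < indeg inc v \<Longrightarrow> L \<le> d v"
    and feas: "feasible cap" and i: "0 < i" "i \<le> (L :: nat)"
  shows "excess cap (indeg inc) \<le> card {h. is_half h \<and> inc h = 1 \<and> d (own h) = i \<and> Suc (d (other h)) = i}"
proof -
  let ?S = "{v. v < n \<and> i \<le> d v}"
  have "excess cap (indeg inc) = (\<Sum>v\<in>?S. indeg inc v - cap v)"
    unfolding excess_def
  proof (rule sum.mono_neutral_right)
    show "\<forall>v\<in>{..<n} - ?S. indeg inc v - cap v = 0"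
      using far i by (metis (mono_tags, lifting) Diff_iff diff_is_0_eq lessThan_iff mem_Collect_eq not_le order_trans)
  qed auto
  also have "\<dots> \<le> card {h. is_half h \<and> inc h = 1 \<and> own h \<in> ?S \<and> other h \<notin> ?S}"
    by (rule excess_cut[OF inc _ _ feas]) (use full i in auto)
  also have "\<dots> \<le> card {h. is_half h \<and> inc h = 1 \<and> d (own h) = i \<and> Suc (d (other h)) = i}"
  proof (rule card_mono)
    show "{h. is_half h \<and> inc h = 1 \<and> own h \<in> ?S \<and> other h \<notin> ?S} \<subseteq>
        {h. is_half h \<and> inc h = 1 \<and> d (own h) = i \<and> Suc (d (other h)) = i}"
      using valid other_less by fastforce
  qed simp
  finally show ?thesis .
qed

text \<open>The cuts of different \<open>i\<close> are disjoint, which bounds \<open>L\<close> times the surplus by \<open>m\<close>. Their layers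
  have at most \<open>2 * n\<close> nodes in total, counting each layer in both of its cuts, so for some cut the
  two layers have \<open>x + y \<le> 2 * n / L\<close> nodes and at most \<open>x * y \<le> (n / L)\<^sup>2\<close> arcs run between them.\<close>

lemma excess_le_labels:
  assumes inc: "orient inc"
    and valid: "\<And>h. is_half h \<Longrightarrow> inc h = 1 \<Longrightarrow> d (own h) \<le> d (other h) + 1"
    and full: "\<And>v. v < n \<Longrightarrow> 0 < d v \<Longrightarrow> cap v \<le> indeg inc v"
    and far: "\<And>v. v < n \<Longrightarrow> cap v < indeg inc v \<Longrightarrow> L \<le> d v"
    and feas: "feasible cap" and L: "m \<le> L * L \<or> n * n \<le> L * L * (L :: nat)"
  shows "excess cap (indeg inc) \<le> L"
proof (cases "L = 0")
  case True
  then have "m = 0 \<or> n = 0"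
    using L by simp
  moreover have "excess cap (indeg inc) \<le> (\<Sum>v<n. indeg inc v)"
    unfolding excess_def by (rule sum_mono) simp
  ultimately show ?thesis
    using sum_indeg_all[OF inc] by auto
next
  case False
  let ?B = "\<lambda>i. {h. is_half h \<and> inc h = 1 \<and> d (own h) = i \<and> Suc (d (other h)) = i}"
  let ?e = "excess cap (indeg inc)"
  have layer: "?e \<le> card (?B i)" if "i \<in> {1..L}" for i
    using excess_le_layer[OF inc valid full far feas] that by auto
  have "L * ?e = (\<Sum>i\<in>{1..L}. ?e)"
    by simp
  also have "\<dots> \<le> (\<Sum>i\<in>{1..L}. card (?B i))"
    by (rule sum_mono) (rule layer)
  also have "\<dots> = card (\<Union>i\<in>{1..L}. ?B i)"
    by (rule card_UN_disjoint[symmetric]) auto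
  also have "\<dots> \<le> card {h. is_half h \<and> inc h = 1}"
    by (rule card_mono) auto
  finally have edges: "L * ?e \<le> m"
    using card_orient[OF inc] by simp
  let ?x = "\<lambda>i. card {v. v < n \<and> d v = i}"
  have part: "(\<Sum>i\<in>I. ?x i) \<le> n" if "finite I" for I
  proof -
    have "(\<Sum>i\<in>I. ?x i) = card (\<Union>i\<in>I. {v. v < n \<and> d v = i})"
      by (rule card_UN_disjoint[symmetric]) (use that in auto)
    also have "\<dots> \<le> card {..<n}"
      by (rule card_mono) auto
    finally show ?thesis
      by simp
  qed
  have "(\<Sum>i\<in>{1..L}. ?x (i - 1)) = (\<Sum>i\<in>{0..<L}. ?x i)"
    by (rule sum.reindex_bij_witness[of _ Suc "\<lambda>i. i - 1"]) auto
  then have sum: "(\<Sum>i\<in>{1..L}. ?x i + ?x (i - 1)) \<le> 2 * n"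
    using part[of "{1..L}"] part[of "{0..<L}"] by (simp add: sum.distrib)
  have "\<exists>i\<in>{1..L}. L * (?x i + ?x (i - 1)) \<le> 2 * n"
  proof (rule ccontr)
    assume "\<not> ?thesis"
    then have "2 * n < L * (?x i + ?x (i - 1))" if "i \<in> {1..L}" for i
      using that not_le by blast
    then have "(\<Sum>i\<in>{1..L}. 2 * n) < (\<Sum>i\<in>{1..L}. L * (?x i + ?x (i - 1)))"
      using False by (intro sum_strict_mono) simp_all
    also have "\<dots> = L * (\<Sum>i\<in>{1..L}. ?x i + ?x (i - 1))"
      by (rule sum_distrib_left[symmetric])
    also have "\<dots> \<le> L * (2 * n)"
      using sum by (intro mult_left_mono) auto
    finally show False
      by simp
  qed
  then obtain i where i: "i \<in> {1..L}" "L * (?x i + ?x (i - 1)) \<le> 2 * n"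
    by blast
  have "card (?B i) \<le> card ({v. v < n \<and> d v = i} \<times> {v. v < n \<and> d v = i - 1})"
    by (rule card_inj_on_le[of "\<lambda>h. (own h, other h)"])
      (use own_less other_less in \<open>auto simp: inj_on_def intro: half_edge_eqI\<close>)
  then have e: "?e \<le> ?x i * ?x (i - 1)"
    using layer[OF i(1)] by (simp add: card_cartesian_product)
  define x y e where "x = ?x i" and "y = ?x (i - 1)" and "e = ?e"
  have "int (4 * (x * y)) \<le> int ((x + y) * (x + y))"
    using zero_le_power2[of "int x - int y"] by (simp add: power2_eq_square algebra_simps)
  then have amgm: "4 * (x * y) \<le> (x + y) * (x + y)"
    by (simp only: of_nat_le_iff)
  have "4 * (L * L * e) = (L * L) * (4 * e)"
    by simp
  also have "\<dots> \<le> (L * L) * (4 * (x * y))"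
    by (rule mult_le_mono2) (use e in \<open>simp add: x_def y_def e_def\<close>)
  also have "\<dots> \<le> (L * L) * ((x + y) * (x + y))"
    by (rule mult_le_mono2) (rule amgm)
  also have "\<dots> = (L * (x + y)) * (L * (x + y))"
    by (simp only: ac_simps)
  also have "\<dots> \<le> (2 * n) * (2 * n)"
    by (rule mult_le_mono) (use i(2) in \<open>simp_all add: x_def y_def\<close>)
  finally have "L * L * ?e \<le> n * n"
    by (simp add: e_def)
  from L show ?thesis
  proof
    assume "m \<le> L * L"
    then have "L * ?e \<le> L * L"
      using edges order_trans by blast
    then show ?thesis
      using False by simp
  next
    assume "n * n \<le> L * L * L"
    then have "L * L * ?e \<le> L * L * L"
      using \<open>L * L * ?e \<le> n * n\<close> order_trans by blast
    then show ?thesis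
      using False by simp
  qed
qed

text \<open>A set that no arc leaves is a cut without arcs, which is what a failed search finds.\<close>

lemma excess_closed:
  assumes inc: "orient inc"
    and closed: "\<And>h. is_half h \<Longrightarrow> inc h = 1 \<Longrightarrow> P (own h) \<Longrightarrow> P (other h)"
    and full: "\<And>v. v < n \<Longrightarrow> P v \<Longrightarrow> cap v \<le> indeg inc v"
    and tokens: "\<And>v. v < n \<Longrightarrow> cap v < indeg inc v \<Longrightarrow> P v"
    and feas: "feasible cap"
  shows "excess cap (indeg inc) = 0"
proof -
  let ?S = "{v. v < n \<and> P v}"
  have "excess cap (indeg inc) = (\<Sum>v\<in>?S. indeg inc v - cap v)"
    unfolding excess_def
  proof (rule sum.mono_neutral_right)
    show "\<forall>v\<in>{..<n} - ?S. indeg inc v - cap v = 0"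
      using tokens by (metis (mono_tags, lifting) Diff_iff diff_is_0_eq lessThan_iff mem_Collect_eq not_le)
  qed auto
  also have "\<dots> \<le> card {h. is_half h \<and> inc h = 1 \<and> own h \<in> ?S \<and> other h \<notin> ?S}"
    by (rule excess_cut[OF inc _ _ feas]) (use full in auto)
  also have "{h. is_half h \<and> inc h = 1 \<and> own h \<in> ?S \<and> other h \<notin> ?S} = {}"
    using closed other_less by auto
  finally show ?thesis
    by simp
qed

subsection \<open>Reversing an edge\<close>

lemma orient_flip:
  assumes "orient inc" "is_half h" "inc h = 1"
  shows "orient (inc(h := 0, opp h := 1))"
proof -
  let ?inc = "inc(h := 0, opp h := 1)"
  have h: "opp h \<noteq> h" "opp (opp h) = h"
    using assms(2) opp_neq opp_opp by auto
  have "?inc k \<le> 1 \<and> ?inc k + ?inc (opp k) = 1" if k: "is_half k" for k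
  proof (cases "k = h \<or> k = opp h")
    case True
    then show ?thesis
      using h by auto
  next
    case False
    then have "opp k \<noteq> h" "opp k \<noteq> opp h"
      using opp_opp[of k] h(2) k by auto
    then show ?thesis
      using False orientD[OF assms(1) k] by simp
  qed
  then show ?thesis
    by (simp add: orient_def)
qed

lemma indeg_flip:
  assumes "orient inc" "is_half h" "inc h = 1"
  shows "indeg (inc(h := 0, opp h := 1)) v + (if v = own h then 1 else 0) =
    indeg inc v + (if v = other h then 1 else 0)"
proof -
  have opp: "inc (opp h) = 0"
    using orientD[OF assms(1,2)] assms(3) by simp
  note opp = opp opp_half[OF assms(2)] opp_neq[OF assms(2)]
    own_opp[OF assms(2)[THEN conjunct1] assms(2)[THEN conjunct2]]
  let ?A = "\<lambda>i. {k. is_half k \<and> own k = v \<and> i k = (1 :: nat)}"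
  let ?inc = "inc(h := 0, opp h := 1)"
  consider "v = own h" | "v = other h" | "v \<noteq> own h" "v \<noteq> other h"
    by blast
  then show ?thesis
  proof cases
    case 1
    then have "?A inc = insert h (?A ?inc)" "h \<notin> ?A ?inc"
      using opp assms by auto
    then show ?thesis
      using 1 opp by (simp add: indeg_def)
  next
    case 2
    then have "?A ?inc = insert (opp h) (?A inc)" "opp h \<notin> ?A inc"
      using opp assms by auto
    then show ?thesis
      using 2 opp by (simp add: indeg_def)
  next
    case 3
    then have "?A ?inc = ?A inc"
      by auto
    then show ?thesis
      using 3 by (simp add: indeg_def)
  qed
qed

subsection \<open>A chain of indegree bounds\<close>

text \<open>For odd \<open>j = 2 * k - 1\<close> the threshold is \<open>k\<close> and the bound above it is \<open>k - 1\<close>, the condition for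
  at most \<open>k\<close> colors; for even \<open>j = 2 * k\<close> both are \<open>k\<close>, the condition for indegree at most \<open>k\<close>.\<close>

definition level_cap :: "nat \<Rightarrow> nat \<Rightarrow> nat" where
  "level_cap j v = (if degr v \<le> j - j div 2 then degr v else j div 2)"

lemma level_cap_mono: "i \<le> j \<Longrightarrow> level_cap i v \<le> level_cap j v"
proof -
  assume ij: "i \<le> j"
  then have "i div 2 \<le> j div 2" "i - i div 2 \<le> j - j div 2"
    using div_le_mono[OF ij, of 2] div_le_mono[of "i + 1" "j + 1" 2] by linarith+
  then show ?thesis
    by (auto simp: level_cap_def)
qed

lemma feasible_mono: "feasible (level_cap i) \<Longrightarrow> i \<le> j \<Longrightarrow> feasible (level_cap j)"
  unfolding feasible_def using level_cap_mono order_trans by blast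

lemma level_cap_even: "(\<forall>v<n. indeg inc v \<le> level_cap (2 * k) v) \<longleftrightarrow> (\<forall>v<n. indeg inc v \<le> k)"
proof -
  have "indeg inc v \<le> level_cap (2 * k) v \<longleftrightarrow> indeg inc v \<le> k" for v
    using indeg_le_degr[of inc v] by (simp add: level_cap_def)
  then show ?thesis
    by blast
qed

lemma indeg_0: "orient inc \<Longrightarrow> (\<forall>v<n. indeg inc v = 0) \<longleftrightarrow> m = 0"
  using sum_indeg_all[of inc] by auto

lemma infeasible_0: "0 < m \<Longrightarrow> \<not> feasible (level_cap 0)"
proof
  assume "0 < m" "feasible (level_cap 0)"
  then obtain inc where inc: "orient inc" "\<forall>v<n. indeg inc v \<le> level_cap 0 v"
    by (auto simp: feasible_def)
  then have "\<forall>v<n. indeg inc v = 0"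
    using level_cap_even[of inc 0] by simp
  then show False
    using indeg_0[OF inc(1)] \<open>0 < m\<close> by simp
qed

lemma level_cap_top: "degr v \<le> D \<Longrightarrow> level_cap (2 * D) v = degr v"
  by (simp add: level_cap_def)

subsection \<open>Push-relabel\<close>

text \<open>Surplus moves from \<open>v\<close> along an edge that enters \<open>v\<close> and is thereby reversed, so the residual
  arcs that leave \<open>v\<close> are the half-edges \<open>h\<close> of \<open>v\<close> with \<open>inc h = 1\<close>.\<close>

definition list_pos :: "(nat \<Rightarrow> nat) \<Rightarrow> bool" where
  "list_pos cur \<longleftrightarrow> (\<forall>v<n. cur v = 0 \<or> is_half (cur v) \<and> own (cur v) = v)"

lemma list_pos_below: "list_pos cur \<Longrightarrow> b \<le> Suc (2 * m) \<Longrightarrow> list_pos (cur(v := below v b))"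
  using below_cases[of v b] by (auto simp: list_pos_def)

text \<open>The label condition has two strengths. All arcs satisfy the weak one, with slack 1. The half-edges
  that the list pointer \<open>cur\<close> has passed satisfy the strong one, without slack: they admit no push.
  Hence a node whose list is exhausted can be relabeled. The stack may contain nodes repeatedly and
  nodes that are no longer active; it only has to contain all active ones.\<close>

definition push_inv ::
    "table \<Rightarrow> nat \<Rightarrow> table \<Rightarrow> table \<Rightarrow> table \<Rightarrow> table \<Rightarrow> table \<Rightarrow> nat \<Rightarrow> bool" where
  "push_inv cap L inc d cur ind stk sp \<longleftrightarrow>
     orient inc \<and> (\<forall>v<n. ind v = indeg inc v) \<and> list_pos cur \<and>
     (\<forall>h. is_half h \<longrightarrow> inc h = 1 \<longrightarrow>
        d (own h) \<le> d (other h) + (if cur (own h) < h then 0 else 1)) \<and>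
     (\<forall>v<n. d v \<le> L \<and> (0 < d v \<longrightarrow> cap v \<le> ind v)) \<and>
     (\<forall>v<n. cap v < ind v \<longrightarrow> d v < L \<longrightarrow> v \<in> stk ` {..<sp}) \<and>
     (\<forall>i<sp. stk i < n)"

lemma push_invD:
  assumes "push_inv cap L inc d cur ind stk sp"
  shows "orient inc"
    and "v < n \<Longrightarrow> ind v = indeg inc v"
    and "list_pos cur"
    and "is_half h \<Longrightarrow> inc h = 1 \<Longrightarrow> d (own h) \<le> d (other h) + (if cur (own h) < h then 0 else 1)"
    and "v < n \<Longrightarrow> d v \<le> L"
    and "v < n \<Longrightarrow> 0 < d v \<Longrightarrow> cap v \<le> ind v"
    and "v < n \<Longrightarrow> cap v < ind v \<Longrightarrow> d v < L \<Longrightarrow> v \<in> stk ` {..<sp}"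
    and "i < sp \<Longrightarrow> stk i < n"
  using assms unfolding push_inv_def by blast+

lemma push_invI:
  assumes "orient inc" "\<And>v. v < n \<Longrightarrow> ind v = indeg inc v" "list_pos cur"
    and "\<And>h. is_half h \<Longrightarrow> inc h = 1 \<Longrightarrow>
      d (own h) \<le> d (other h) + (if cur (own h) < h then 0 else 1)"
    and "\<And>v. v < n \<Longrightarrow> d v \<le> L"
    and "\<And>v. v < n \<Longrightarrow> 0 < d v \<Longrightarrow> cap v \<le> ind v"
    and "\<And>v. v < n \<Longrightarrow> cap v < ind v \<Longrightarrow> d v < L \<Longrightarrow> v \<in> stk ` {..<sp}"
    and "\<And>i. i < sp \<Longrightarrow> stk i < n"
  shows "push_inv cap L inc d cur ind stk sp"
  using assms unfolding push_inv_def by blast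

text \<open>A relabeling refills the list of its node, at a cost of \<open>degr v\<close> that the second summand pays.
  A push moves a list pointer, which decreases the first part by 2, and adds one stack entry.\<close>

definition push_pot :: "nat \<Rightarrow> table \<Rightarrow> table \<Rightarrow> nat \<Rightarrow> nat" where
  "push_pot L d cur sp =
     2 * (\<Sum>v<n. halves_upto v (cur v) + (L - d v) * Suc (degr v)) + sp"

lemma list_pos_first: "(\<And>v. v < n \<Longrightarrow> cur v = below v (Suc (2 * m))) \<Longrightarrow> list_pos cur"
proof -
  assume cur: "\<And>v. v < n \<Longrightarrow> cur v = below v (Suc (2 * m))"
  have "cur v = 0 \<or> is_half (cur v) \<and> own (cur v) = v" if "v < n" for v
    using cur[OF that] below_cases[of v "Suc (2 * m)"] by auto
  then show "list_pos cur"
    by (simp add: list_pos_def)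
qed

lemma le_first:
  "is_half h \<Longrightarrow> (\<And>v. v < n \<Longrightarrow> cur v = below v (Suc (2 * m))) \<Longrightarrow> h \<le> cur (own h)"
  using below_ge[of h "Suc (2 * m)"] own_less[of h] by simp

lemma push_inv_init:
  assumes "orient inc" "\<And>v. v < n \<Longrightarrow> ind v = indeg inc v"
    and d: "\<And>v. v < n \<Longrightarrow> d v = 0" and cur: "\<And>v. v < n \<Longrightarrow> cur v = below v (Suc (2 * m))"
    and stk: "\<And>v. v < n \<Longrightarrow> stk v = v"
  shows "push_inv cap L inc d cur ind stk n"
    and "push_pot L d cur n \<le> 2 * ((n + 2 * m + 1) * (L + 1))"
proof -
  show "push_inv cap L inc d cur ind stk n"
  proof (rule push_invI)
    show "d (own h) \<le> d (other h) + (if cur (own h) < h then 0 else 1)" if "is_half h" for h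
      using d[OF own_less] that by simp
    show "v \<in> stk ` {..<n}" if "v < n" for v
      using stk[OF that] that by (intro image_eqI[of _ _ v]) auto
  qed (use assms list_pos_first[OF cur] in simp_all)
  have "(\<Sum>v<n. halves_upto v (cur v) + (L - d v) * Suc (degr v)) =
      (\<Sum>v<n. degr v + L * (degr v + 1))"
    by (rule sum.cong) (use d cur in simp_all)
  also have "\<dots> = 2 * m + L * (2 * m + n)"
    using sum_halves_upto[of "2 * m"] by (simp add: sum.distrib algebra_simps flip: sum_distrib_left)
  finally show "push_pot L d cur n \<le> 2 * ((n + 2 * m + 1) * (L + 1))"
    by (simp add: push_pot_def algebra_simps)
qed

lemma push_inv_pop:
  assumes inv: "push_inv cap L inc d cur ind stk (Suc i)"
    and idle: "ind (stk i) \<le> cap (stk i) \<or> L \<le> d (stk i)"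
  shows "push_inv cap L inc d cur ind stk i"
proof (rule push_invI)
  show "v \<in> stk ` {..<i}" if "v < n" "cap v < ind v" "d v < L" for v
  proof -
    have "v \<in> stk ` {..<Suc i}"
      by (rule push_invD(7)[OF inv that])
    moreover have "v \<noteq> stk i"
    proof
      assume "v = stk i"
      then show False
        using idle that(2,3) by simp
    qed
    ultimately show ?thesis
      by (auto simp: less_Suc_eq)
  qed
  show "j < i \<Longrightarrow> stk j < n" for j
    using push_invD(8)[OF inv, of j] by simp
qed (fact push_invD[OF inv])+

text \<open>All arcs of \<open>v\<close> have been passed, so none of them leads to a lower label and raising the label of
  \<open>v\<close> by one keeps the weak condition.\<close>

lemma push_inv_relabel:
  assumes inv: "push_inv cap L inc d cur ind stk sp"
    and v: "v < n" "cap v < ind v" "d v < L" "cur v = 0"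
  shows "push_inv cap L inc (d(v := Suc (d v))) (cur(v := below v (Suc (2 * m)))) ind stk sp"
    and "push_pot L (d(v := Suc (d v))) (cur(v := below v (Suc (2 * m)))) sp < push_pot L d cur sp"
proof -
  let ?d = "d(v := Suc (d v))" and ?cur = "cur(v := below v (Suc (2 * m)))"
  have "?d (own h) \<le> ?d (other h) + (if ?cur (own h) < h then 0 else 1)"
    if h: "is_half h" "inc h = 1" for h
  proof -
    have le: "d (own h) \<le> d (other h) + (if cur (own h) < h then 0 else 1)"
      by (rule push_invD(4)[OF inv h])
    show ?thesis
    proof (cases "own h = v")
      case True
      then have "h \<le> below v (Suc (2 * m))"
        using h by (intro below_ge) auto
      then show ?thesis
        using True le v h own_opp[of h] by auto
    next
      case False
      then show ?thesis
        using le by auto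
    qed
  qed
  moreover have "cap w \<le> ind w" if "w < n" "0 < ?d w" for w
    using push_invD(6)[OF inv, of w] that v by (cases "w = v") auto
  moreover have "?d w \<le> L" if "w < n" for w
    using push_invD(5)[OF inv that] v by auto
  moreover have "w \<in> stk ` {..<sp}" if "w < n" "cap w < ind w" "?d w < L" for w
    using push_invD(7)[OF inv that(1,2)] that(3) by (auto split: if_splits)
  moreover have "list_pos ?cur"
    by (rule list_pos_below[OF push_invD(3)[OF inv]]) simp
  ultimately show "push_inv cap L inc ?d ?cur ind stk sp"
    using push_invD(1,2,8)[OF inv] by (intro push_invI)
  have "(\<Sum>w<n. halves_upto w (?cur w) + (L - ?d w) * Suc (degr w)) <
      (\<Sum>w<n. halves_upto w (cur w) + (L - d w) * Suc (degr w))"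
  proof (rule sum_strict_mono_ex1)
    (* the list of v was exhausted, so its refilled length is paid by one summand Suc (degr v) *)
    obtain k where "L - d v = Suc k" "L - Suc (d v) = k"
      using v(3) by (metis Suc_diff_Suc)
    then have "halves_upto v (?cur v) + (L - ?d v) * Suc (degr v) <
        halves_upto v (cur v) + (L - d v) * Suc (degr v)"
      using v by simp
    then show "\<exists>w\<in>{..<n}. halves_upto w (?cur w) + (L - ?d w) * Suc (degr w) <
        halves_upto w (cur w) + (L - d w) * Suc (degr w)"
      using v(1) by blast
    then show "\<forall>w\<in>{..<n}. halves_upto w (?cur w) + (L - ?d w) * Suc (degr w) \<le>
        halves_upto w (cur w) + (L - d w) * Suc (degr w)"
      using \<open>halves_upto v (?cur v) + _ < _\<close> by auto
  qed simp
  then show "push_pot L ?d ?cur sp < push_pot L d cur sp"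
    by (simp add: push_pot_def)
qed

lemma sum_halves_upto_advance:
  assumes "v < n" "cur v = h" "0 < h" "own h = v"
  shows "(\<Sum>w<n. halves_upto w ((cur(v := below v h)) w) + (f w :: nat)) + 1 =
    (\<Sum>w<n. halves_upto w (cur w) + f w)"
proof -
  have "(\<Sum>w<n. halves_upto w (cur w) + f w) =
      (halves_upto v h + f v) + (\<Sum>w\<in>{..<n} - {v}. halves_upto w (cur w) + f w)"
    using assms by (subst sum.remove[of _ v]) auto
  moreover have "(\<Sum>w<n. halves_upto w ((cur(v := below v h)) w) + f w) =
      (halves_upto v (below v h) + f v) + (\<Sum>w\<in>{..<n} - {v}. halves_upto w (cur w) + f w)"
    using assms by (subst sum.remove[of _ v]) auto
  ultimately show ?thesis
    using halves_upto_below_own[of h v] assms by simp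
qed

lemma push_pot_advance:
  assumes "v < n" "cur v = h" "0 < h" "own h = v"
  shows "push_pot L d (cur(v := below v h)) sp + 2 = push_pot L d cur sp"
  using sum_halves_upto_advance[of v cur h, OF assms, of "\<lambda>v. (L - d v) * Suc (degr v)"] by (simp add: push_pot_def)

lemma push_inv_skip:
  assumes inv: "push_inv cap L inc d cur ind stk sp"
    and v: "v < n" "cur v = h" "0 < h" "inc h \<noteq> 1 \<or> d v \<noteq> Suc (d (other h))"
  shows "push_inv cap L inc d (cur(v := below v h)) ind stk sp"
proof -
  have own: "is_half h" "own h = v"
    using push_invD(1,3)[OF inv] v by (auto simp: list_pos_def)
  have "d (own k) \<le> d (other k) + (if (cur(v := below v h)) (own k) < k then 0 else 1)"
    if k: "is_half k" "inc k = 1" for k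
  proof -
    have le: "d (own k) \<le> d (other k) + (if cur (own k) < k then 0 else 1)"
      by (rule push_invD(4)[OF inv k])
    show ?thesis
    proof (cases "own k = v \<and> k \<le> h")
      case True
      then show ?thesis
        using le v k below_ge[of k h v] by (cases "k = h") auto
    qed (use le v in auto)
  qed
  moreover have "list_pos (cur(v := below v h))"
    by (rule list_pos_below[OF push_invD(3)[OF inv]]) (use own in simp)
  ultimately show ?thesis
    using push_invD(1,2,5-8)[OF inv] by (intro push_invI)
qed

text \<open>The new arc is directed towards the higher label, so it satisfies the strong condition wherever
  the list pointer of its node is.\<close>

lemma push_inv_push:
  assumes inv: "push_inv cap L inc d cur ind stk sp"
    and v: "v < n" "cur v = h" "0 < h" "inc h = 1" "d v = Suc (d (other h))"
    and act: "cap v < ind v" "v \<in> stk ` {..<sp}"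
  shows "push_inv cap L (inc(h := 0, opp h := 1)) d (cur(v := below v h))
    (ind(v := ind v - 1, other h := Suc (ind (other h)))) (stk(sp := other h)) (Suc sp)"
proof -
  let ?inc = "inc(h := 0, opp h := 1)" and ?cur = "cur(v := below v h)"
  let ?ind = "ind(v := ind v - 1, other h := Suc (ind (other h)))" and ?stk = "stk(sp := other h)"
  have own: "is_half h" "own h = v" and inc: "orient inc"
    using push_invD(1,3)[OF inv] v by (auto simp: list_pos_def)
  have u: "other h < n" "other h \<noteq> v"
    using own other_less own_opp[of h] by auto
  have valid: "d (own k) \<le> d (other k) + (if ?cur (own k) < k then 0 else 1)"
    if k: "is_half k" "?inc k = 1" for k
  proof (cases "k = opp h")
    case True
    then show ?thesis
      using own v opp_opp[of h] by auto
  next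
    case False
    then have "k \<noteq> h" "inc k = 1"
      using k(2) by (auto split: if_splits)
    then have le: "d (own k) \<le> d (other k) + (if cur (own k) < k then 0 else 1)"
      using push_invD(4)[OF inv k(1)] by simp
    show ?thesis
    proof (cases "own k = v \<and> k \<le> h")
      case True
      then show ?thesis
        using le v k below_ge[of k h v] \<open>k \<noteq> h\<close> by auto
    qed (use le v in auto)
  qed
  have ind: "?ind w = indeg ?inc w" if "w < n" for w
  proof -
    have "ind w = indeg inc w"
      by (rule push_invD(2)[OF inv that])
    then show ?thesis
      using indeg_flip[OF inc own(1) v(4), of w] own u act(1) by (auto split: if_splits)
  qed
  have active: "w \<in> ?stk ` {..<Suc sp}" if w: "w < n" "cap w < ?ind w" "d w < L" for w
  proof (cases "w = other h")
    case True
    then show ?thesis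
      by auto
  next
    case False
    then have "w \<in> stk ` {..<sp}"
      using push_invD(7)[OF inv w(1)] w act by (cases "w = v") auto
    then obtain i where "i < sp" "w = stk i"
      by auto
    then have "w = ?stk i" "i < Suc sp"
      by auto
    then show ?thesis
      by blast
  qed
  have full: "cap w \<le> ?ind w" if "w < n" "0 < d w" for w
  proof -
    have "cap w \<le> ind w"
      by (rule push_invD(6)[OF inv that])
    then show ?thesis
      using act u by auto
  qed
  have "list_pos ?cur"
    by (rule list_pos_below[OF push_invD(3)[OF inv]]) (use own in simp)
  moreover have "?stk i < n" if "i < Suc sp" for i
    using push_invD(8)[OF inv, of i] u that by (auto simp: less_Suc_eq)
  ultimately show ?thesis
    using orient_flip[OF inc own(1) v(4)] ind valid push_invD(5)[OF inv] full active
    by (intro push_invI)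
qed

lemma push_inv_final:
  assumes inv: "push_inv cap L inc d cur ind stk 0" and feas: "feasible cap"
    and L: "m \<le> L * L \<or> n * n \<le> L * L * L"
  shows "excess cap (indeg inc) \<le> L"
proof (rule excess_le_labels[OF _ _ _ _ feas L])
  show "orient inc"
    by (rule push_invD(1)[OF inv])
  show "d (own h) \<le> d (other h) + 1" if "is_half h" "inc h = 1" for h
    using push_invD(4)[OF inv that] by (simp split: if_splits)
  show "L \<le> d v" if "v < n" "cap v < indeg inc v" for v
  proof (rule ccontr)
    assume "\<not> L \<le> d v"
    then have "v \<in> stk ` {..<0::nat}"
      using push_invD(7)[OF inv, of v] push_invD(2)[OF inv, of v] that by simp
    then show False
      by simp
  qed
  show "cap v \<le> indeg inc v" if "v < n" "0 < d v" for v
    using push_invD(2,6)[OF inv that(1)] that by simp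
qed

subsection \<open>Search for an augmenting path\<close>

text \<open>\<open>vis v\<close> is 0 for unvisited nodes and otherwise the depth of \<open>v\<close> in the search forest, whose
  roots, the nodes with surplus, have depth 1. \<open>par v\<close> is the half-edge at the parent of \<open>v\<close> through
  which \<open>v\<close> was found, and 0 at the roots.\<close>

definition parent_ok ::
    "table \<Rightarrow> table \<Rightarrow> table \<Rightarrow> table \<Rightarrow> table \<Rightarrow> nat \<Rightarrow> bool" where
  "parent_ok cap ind inc vis par v \<longleftrightarrow>
     par v = 0 \<and> cap v < ind v \<or>
     is_half (par v) \<and> inc (par v) = 1 \<and> other (par v) = v \<and>
     0 < vis (own (par v)) \<and> vis v = Suc (vis (own (par v)))"

text \<open>\<open>f\<close> is 0 as long as no node with spare capacity has been found, and the successor of such a node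
  afterwards. The depths are bounded by the number of visited nodes, which later bounds the length
  of the augmenting path. All closure properties are dropped once a node is found, since the search
  then stops with unfinished lists.\<close>

definition search_inv ::
    "table \<Rightarrow> table \<Rightarrow> table \<Rightarrow> table \<Rightarrow> table \<Rightarrow> table \<Rightarrow> table \<Rightarrow> nat \<Rightarrow> nat \<Rightarrow> bool" where
  "search_inv cap ind inc vis par cur stk sp f \<longleftrightarrow>
     orient inc \<and> (\<forall>v<n. ind v = indeg inc v) \<and> list_pos cur \<and>
     (\<forall>v<n. cap v < ind v \<longrightarrow> 0 < vis v) \<and>
     (\<forall>v<n. 0 < vis v \<longrightarrow> parent_ok cap ind inc vis par v) \<and>
     (\<forall>v<n. vis v \<le> card {w. w < n \<and> 0 < vis w}) \<and>
     (\<forall>i<sp. stk i < n \<and> 0 < vis (stk i)) \<and>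
     (f = 0 \<longrightarrow> (\<forall>v<n. 0 < vis v \<longrightarrow> cap v \<le> ind v \<and> (cur v = 0 \<or> v \<in> stk ` {..<sp})) \<and>
        (\<forall>h. is_half h \<longrightarrow> cur (own h) < h \<longrightarrow>
           0 < vis (own h) \<and> (inc h = 1 \<longrightarrow> 0 < vis (other h)))) \<and>
     (0 < f \<longrightarrow> f \<le> n \<and> 0 < vis (f - 1) \<and> ind (f - 1) < cap (f - 1))"

lemma search_invD:
  assumes "search_inv cap ind inc vis par cur stk sp f"
  shows "orient inc"
    and "v < n \<Longrightarrow> ind v = indeg inc v"
    and "list_pos cur"
    and "v < n \<Longrightarrow> cap v < ind v \<Longrightarrow> 0 < vis v"
    and "v < n \<Longrightarrow> 0 < vis v \<Longrightarrow> parent_ok cap ind inc vis par v"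
    and "v < n \<Longrightarrow> vis v \<le> card {w. w < n \<and> 0 < vis w}"
    and "i < sp \<Longrightarrow> stk i < n \<and> 0 < vis (stk i)"
    and "f = 0 \<Longrightarrow> v < n \<Longrightarrow> 0 < vis v \<Longrightarrow> cap v \<le> ind v \<and> (cur v = 0 \<or> v \<in> stk ` {..<sp})"
    and "f = 0 \<Longrightarrow> is_half h \<Longrightarrow> cur (own h) < h \<Longrightarrow>
      0 < vis (own h) \<and> (inc h = 1 \<longrightarrow> 0 < vis (other h))"
    and "0 < f \<Longrightarrow> f \<le> n \<and> 0 < vis (f - 1) \<and> ind (f - 1) < cap (f - 1)"
  using assms unfolding search_inv_def by blast+

lemma search_invI:
  assumes "orient inc" "\<And>v. v < n \<Longrightarrow> ind v = indeg inc v" "list_pos cur"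
    and "\<And>v. v < n \<Longrightarrow> cap v < ind v \<Longrightarrow> 0 < vis v"
    and "\<And>v. v < n \<Longrightarrow> 0 < vis v \<Longrightarrow> parent_ok cap ind inc vis par v"
    and "\<And>v. v < n \<Longrightarrow> vis v \<le> card {w. w < n \<and> 0 < vis w}"
    and "\<And>i. i < sp \<Longrightarrow> stk i < n \<and> 0 < vis (stk i)"
    and "\<And>v. f = 0 \<Longrightarrow> v < n \<Longrightarrow> 0 < vis v \<Longrightarrow> cap v \<le> ind v \<and> (cur v = 0 \<or> v \<in> stk ` {..<sp})"
    and "\<And>h. f = 0 \<Longrightarrow> is_half h \<Longrightarrow> cur (own h) < h \<Longrightarrow>
      0 < vis (own h) \<and> (inc h = 1 \<longrightarrow> 0 < vis (other h))"
    and "0 < f \<Longrightarrow> f \<le> n \<and> 0 < vis (f - 1) \<and> ind (f - 1) < cap (f - 1)"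
  shows "search_inv cap ind inc vis par cur stk sp f"
  using assms unfolding search_inv_def by blast

definition search_pot :: "table \<Rightarrow> table \<Rightarrow> nat \<Rightarrow> nat" where
  "search_pot vis cur sp =
     (\<Sum>v<n. halves_upto v (cur v)) + 2 * card {v. v < n \<and> vis v = 0} + sp"

lemma search_inv_init:
  assumes inc: "orient inc" and ind: "\<And>v. v < n \<Longrightarrow> ind v = indeg inc v"
    and cur: "\<And>v. v < n \<Longrightarrow> cur v = below v (Suc (2 * m))"
    and vis: "\<And>v. v < n \<Longrightarrow> vis v = (if cap v < ind v then 1 else 0)"
    and roots: "\<And>v. v < n \<Longrightarrow> cap v < ind v \<Longrightarrow> par v = 0 \<and> v \<in> stk ` {..<sp}"
    and stk: "\<And>i. i < sp \<Longrightarrow> stk i < n \<and> 0 < vis (stk i)" and sp: "sp \<le> n"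
  shows "search_inv cap ind inc vis par cur stk sp 0"
    and "search_pot vis cur sp \<le> 2 * m + 3 * n"
proof -
  show "search_inv cap ind inc vis par cur stk sp 0"
  proof (rule search_invI)
    fix v assume v: "v < n"
    show "vis v \<le> card {w. w < n \<and> 0 < vis w}"
    proof (cases "vis v = 0")
      case False
      then have "{w. w < n \<and> 0 < vis w} \<noteq> {}"
        using v by auto
      then have "0 < card {w. w < n \<and> 0 < vis w}"
        by (simp add: card_gt_0_iff)
      then show ?thesis
        using vis[OF v] by simp
    qed simp
    show "0 < vis v \<Longrightarrow> parent_ok cap ind inc vis par v"
      using vis[OF v] roots[OF v] by (auto simp: parent_ok_def split: if_splits)
    show "0 < vis v \<Longrightarrow> cap v \<le> ind v \<and> (cur v = 0 \<or> v \<in> stk ` {..<sp})"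
      using vis[OF v] roots[OF v] by (auto split: if_splits)
  next
    fix h assume "is_half h" "cur (own h) < h"
    then show "0 < vis (own h) \<and> (inc h = 1 \<longrightarrow> 0 < vis (other h))"
      using le_first[of h cur] cur by force
  next
    show "i < sp \<Longrightarrow> stk i < n \<and> 0 < vis (stk i)" for i
      by (rule stk)
  qed (use inc ind list_pos_first[OF cur] vis in simp_all)
  have "(\<Sum>v<n. halves_upto v (cur v)) = (\<Sum>v<n. degr v)"
    by (rule sum.cong) (use cur in simp_all)
  moreover have "card {v. v < n \<and> vis v = 0} \<le> card {..<n}"
    by (rule card_mono) auto
  ultimately show "search_pot vis cur sp \<le> 2 * m + 3 * n"
    using sum_halves_upto[of "2 * m"] sp by (simp add: search_pot_def)
qed

lemma search_inv_pop:
  assumes inv: "search_inv cap ind inc vis par cur stk (Suc i) f" and "cur (stk i) = 0"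
  shows "search_inv cap ind inc vis par cur stk i f"
proof (rule search_invI)
  show "cap v \<le> ind v \<and> (cur v = 0 \<or> v \<in> stk ` {..<i})" if "f = 0" "v < n" "0 < vis v" for v
    using search_invD(8)[OF inv that] assms(2) by (auto simp: less_Suc_eq)
  show "stk j < n \<and> 0 < vis (stk j)" if "j < i" for j
    using search_invD(7)[OF inv, of j] that by simp
qed (fact search_invD[OF inv])+

lemma search_pot_advance:
  assumes "v < n" "cur v = h" "0 < h" "own h = v"
  shows "Suc (search_pot vis (cur(v := below v h)) sp) = search_pot vis cur sp"
  using sum_halves_upto_advance[of v cur h, OF assms, of "\<lambda>_. 0"] by (simp add: search_pot_def)

lemma search_inv_skip:
  assumes inv: "search_inv cap ind inc vis par cur stk sp 0"
    and v: "v < n" "cur v = h" "0 < h" "inc h \<noteq> 1 \<or> 0 < vis (other h)"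
    and top: "v \<in> stk ` {..<sp}"
  shows "search_inv cap ind inc vis par (cur(v := below v h)) stk sp 0"
proof -
  have own: "is_half h" "own h = v"
    using search_invD(3)[OF inv] v by (auto simp: list_pos_def)
  have vis: "0 < vis v"
    using search_invD(7)[OF inv] top by auto
  have "0 < vis (own k) \<and> (inc k = 1 \<longrightarrow> 0 < vis (other k))"
    if k: "is_half k" "(cur(v := below v h)) (own k) < k" for k
  proof (cases "own k = v \<and> k \<le> h")
    case True
    then show ?thesis
      using v k below_ge[of k h v] vis by (cases "k = h") auto
  next
    case False
    then have "cur (own k) < k"
      using k v by (auto split: if_splits)
    then show ?thesis
      using search_invD(9)[OF inv refl k(1)] by blast
  qed
  moreover have "list_pos (cur(v := below v h))"
    by (rule list_pos_below[OF search_invD(3)[OF inv]]) (use own in simp)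
  moreover have "cap w \<le> ind w \<and> ((cur(v := below v h)) w = 0 \<or> w \<in> stk ` {..<sp})"
    if "w < n" "0 < vis w" for w
    using search_invD(8)[OF inv refl that] top by auto
  ultimately show ?thesis
    using search_invD(1,2,4-7)[OF inv] by (intro search_invI) auto
qed

lemma search_inv_visit:
  assumes inv: "search_inv cap ind inc vis par cur stk sp 0"
    and v: "v < n" "cur v = h" "0 < h" "inc h = 1" "vis (other h) = 0" "0 < vis v"
    and top: "v \<in> stk ` {..<sp}"
  shows "cap (other h) \<le> ind (other h) \<Longrightarrow>
      search_inv cap ind inc (vis(other h := Suc (vis v))) (par(other h := h)) (cur(v := below v h))
        (stk(sp := other h)) (Suc sp) 0"
    and "ind (other h) < cap (other h) \<Longrightarrow>
      search_inv cap ind inc (vis(other h := Suc (vis v))) (par(other h := h)) (cur(v := below v h))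
        stk 0 (Suc (other h))"
    and "card {w. w < n \<and> vis w = 0} = Suc (card {w. w < n \<and> (vis(other h := Suc (vis v))) w = 0})"
proof -
  let ?u = "other h"
  let ?vis = "vis(?u := Suc (vis v))" and ?par = "par(?u := h)" and ?cur = "cur(v := below v h)"
  have own: "is_half h" "own h = v"
    using search_invD(3)[OF inv] v by (auto simp: list_pos_def)
  have u: "?u < n" "?u \<noteq> v"
    using own other_less own_opp[of h] by auto
  have "{w. w < n \<and> vis w = 0} = insert ?u {w. w < n \<and> ?vis w = 0}" "?u \<notin> {w. w < n \<and> ?vis w = 0}"
    using u v by auto
  then show "card {w. w < n \<and> vis w = 0} = Suc (card {w. w < n \<and> ?vis w = 0})"
    by simp
  have "{w. w < n \<and> 0 < ?vis w} = insert ?u {w. w < n \<and> 0 < vis w}" "?u \<notin> {w. w < n \<and> 0 < vis w}"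
    using u v by auto
  then have "card {w. w < n \<and> 0 < ?vis w} = Suc (card {w. w < n \<and> 0 < vis w})"
    by simp
  then have count: "?vis w \<le> card {w. w < n \<and> 0 < ?vis w}" if "w < n" for w
    using search_invD(6)[OF inv that] search_invD(6)[OF inv v(1)] by (cases "w = ?u") auto
  have parent: "parent_ok cap ind inc ?vis ?par w" if "w < n" "0 < ?vis w" for w
  proof (cases "w = ?u")
    case True
    then show ?thesis
      using own u v by (simp add: parent_ok_def)
  next
    case False
    then have "parent_ok cap ind inc vis par w"
      using search_invD(5)[OF inv that(1)] that by simp
    then show ?thesis
      using False v(5) unfolding parent_ok_def by auto
  qed
  have cur: "list_pos ?cur"
    by (rule list_pos_below[OF search_invD(3)[OF inv]]) (use own in simp)
  have closed: "0 < ?vis (own k) \<and> (inc k = 1 \<longrightarrow> 0 < ?vis (other k))"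
    if k: "is_half k" "?cur (own k) < k" for k
  proof (cases "own k = v \<and> k \<le> h")
    case True
    then show ?thesis
      using v k below_ge[of k h v] by (cases "k = h") auto
  next
    case False
    then have "cur (own k) < k"
      using k v by (auto split: if_splits)
    then show ?thesis
      using search_invD(9)[OF inv refl k(1)] by auto
  qed
  have tokens: "0 < ?vis w" if "w < n" "cap w < ind w" for w
    using search_invD(4)[OF inv that] by simp
  note common = search_invD(1,2)[OF inv] cur tokens parent count
  show "search_inv cap ind inc ?vis ?par ?cur stk 0 (Suc ?u)" if "ind ?u < cap ?u"
    using common u that by (intro search_invI) auto
  show "search_inv cap ind inc ?vis ?par ?cur (stk(sp := ?u)) (Suc sp) 0" if u': "cap ?u \<le> ind ?u"
  proof -
    have "cap w \<le> ind w \<and> (?cur w = 0 \<or> w \<in> (stk(sp := ?u)) ` {..<Suc sp})" if w: "w < n" "0 < ?vis w" for w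
    proof (cases "w = ?u")
      case True
      then show ?thesis
        using u' by auto
    next
      case False
      then have "cap w \<le> ind w \<and> (cur w = 0 \<or> w \<in> stk ` {..<sp})"
        using search_invD(8)[OF inv refl w(1)] w by simp
      moreover have "stk ` {..<sp} \<subseteq> (stk(sp := ?u)) ` {..<Suc sp}"
        by (force simp: image_iff)
      ultimately show ?thesis
        using top by (cases "w = v") auto
    qed
    moreover have "(stk(sp := ?u)) i < n \<and> 0 < ?vis ((stk(sp := ?u)) i)" if "i < Suc sp" for i
      using search_invD(7)[OF inv, of i] u that by (auto simp: less_Suc_eq)
    ultimately show ?thesis
      using common closed by (intro search_invI) simp_all
  qed
qed

lemma search_inv_fail:
  assumes inv: "search_inv cap ind inc vis par cur stk 0 0" and feas: "feasible cap"
  shows "excess cap (indeg inc) = 0"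
proof (rule excess_closed[OF _ _ _ _ feas, of inc "\<lambda>v. 0 < vis v"])
  show "0 < vis (other h)" if h: "is_half h" "inc h = 1" "0 < vis (own h)" for h
  proof -
    have "cur (own h) = 0"
      using search_invD(8)[OF inv refl _ h(3)] own_less h(1) by simp
    then show ?thesis
      using search_invD(9)[OF inv refl h(1)] h by simp
  qed
  show "cap v \<le> indeg inc v" if "v < n" "0 < vis v" for v
    using search_invD(8)[OF inv refl that] search_invD(2)[OF inv that(1)] by simp
  show "0 < vis v" if "v < n" "cap v < indeg inc v" for v
    using search_invD(2,4)[OF inv that(1)] that by simp
qed (rule search_invD(1)[OF inv])

subsection \<open>Augmentation\<close>

text \<open>The path is reversed from its end to its root. While this is under way, \<open>ind\<close> already counts the
  unit that arrives at the end, and the orientation \<open>inc\<close> is one unit short of \<open>ind\<close> at the node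
  \<open>w\<close> reached so far. The forest stays intact up to the depth of \<open>w\<close>, because only edges to deeper
  nodes have been reversed.\<close>

definition augment_inv ::
    "table \<Rightarrow> table \<Rightarrow> table \<Rightarrow> table \<Rightarrow> table \<Rightarrow> table \<Rightarrow> nat \<Rightarrow> bool" where
  "augment_inv cap ind0 inc ind vis par w \<longleftrightarrow>
     orient inc \<and> (\<forall>x<n. indeg inc x + (if x = w then 1 else 0) = ind x) \<and> w < n \<and> 0 < vis w \<and>
     (\<forall>x<n. 0 < vis x \<longrightarrow> vis x \<le> vis w \<longrightarrow> parent_ok cap ind0 inc vis par x)"

lemma augment_inv_init:
  assumes inv: "search_inv cap ind inc vis par cur stk sp (Suc t)"
  shows "augment_inv cap ind inc (ind(t := Suc (ind t))) vis par t"
  using search_invD(1,2,5,10)[OF inv] unfolding augment_inv_def by auto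

lemma augment_inv_step:
  assumes inv: "augment_inv cap ind0 inc ind vis par w" and h: "par w = h" "0 < h"
  shows "augment_inv cap ind0 (inc(h := 0, opp h := 1)) ind vis par (own h)"
    and "is_half h" "inc h = 1" "vis (own h) < vis w"
proof -
  have "parent_ok cap ind0 inc vis par w"
    using inv by (auto simp: augment_inv_def)
  then have w: "is_half h" "inc h = 1" "other h = w" "0 < vis (own h)" "vis w = Suc (vis (own h))"
    using h by (auto simp: parent_ok_def)
  then show "is_half h" "inc h = 1" "vis (own h) < vis w"
    by auto
  let ?inc = "inc(h := 0, opp h := 1)"
  have inc: "orient inc"
    using inv by (auto simp: augment_inv_def)
  have "parent_ok cap ind0 ?inc vis par x" if x: "x < n" "0 < vis x" "vis x \<le> vis (own h)" for x
  proof -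
    have ok: "parent_ok cap ind0 inc vis par x"
      using inv x w(5) by (auto simp: augment_inv_def)
    show ?thesis
    proof (cases "par x = 0")
      case True
      then show ?thesis
        using ok by (auto simp: parent_ok_def)
    next
      case False
      then have p: "other (par x) = x" "vis (own (par x)) < vis x"
        using ok by (auto simp: parent_ok_def)
      then have "par x \<noteq> h" "par x \<noteq> opp h"
        using w x by auto
      then show ?thesis
        using ok by (auto simp: parent_ok_def)
    qed
  qed
  moreover have "indeg ?inc x + (if x = own h then 1 else 0) = ind x" if "x < n" for x
    using indeg_flip[OF inc w(1,2), of x] inv w(3) that by (auto simp: augment_inv_def)
  ultimately show "augment_inv cap ind0 ?inc ind vis par (own h)"
    unfolding augment_inv_def using orient_flip[OF inc w(1,2)] own_less w by auto
qed

lemma augment_inv_final: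
  assumes inv: "augment_inv cap ind inc (ind(t := Suc (ind t))) vis par w" and w: "par w = 0"
    and t: "ind t < cap t" "t < n"
  shows "\<forall>x<n. (ind(t := Suc (ind t), w := ind w - 1)) x = indeg inc x"
    and "excess cap (indeg inc) < excess cap ind"
proof -
  have root: "w < n" "cap w < ind w"
    using inv w by (auto simp: augment_inv_def parent_ok_def)
  then have "w \<noteq> t"
    using t by auto
  have deg: "indeg inc x + (if x = w then 1 else 0) = (ind(t := Suc (ind t))) x" if "x < n" for x
    using inv that by (simp add: augment_inv_def)
  show "\<forall>x<n. (ind(t := Suc (ind t), w := ind w - 1)) x = indeg inc x"
    using deg \<open>w \<noteq> t\<close> by (fastforce split: if_splits)
  have le: "indeg inc x - cap x \<le> ind x - cap x" if "x < n" for x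
    using deg[OF that] t by (auto split: if_splits)
  have "indeg inc w - cap w < ind w - cap w"
    using deg[OF root(1)] root \<open>w \<noteq> t\<close> by auto
  then show "excess cap (indeg inc) < excess cap ind"
    unfolding excess_def using le root by (intro sum_strict_mono_ex1) auto
qed

end

section \<open>Encoded graphs\<close>

text \<open>Half-edge \<open>k + 1\<close> is the first listed end of edge \<open>k\<close>, half-edge \<open>k + 1 + m\<close> the second.\<close>

definition own_of :: "(nat \<times> nat) list \<Rightarrow> nat \<Rightarrow> nat" where
  "own_of es h = (if h \<le> length es then fst (es ! (h - 1)) else snd (es ! (h - length es - 1)))"

definition opp_of :: "nat \<Rightarrow> nat \<Rightarrow> nat" where
  "opp_of m h = (if h \<le> m then h + m else h - m)"

locale encoded_graph =
  fixes V :: "'a set" and E :: "'a set set" and vs :: "'a list" and es :: "(nat \<times> nat) list"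
  assumes simple: "simple_graph V E" and encodes: "encodes_graph vs es V E"
begin

abbreviation node :: "nat \<Rightarrow> 'a" where
  "node v \<equiv> vs ! v"

definition edge :: "nat \<Rightarrow> 'a set" where
  "edge k = {node (fst (es ! k)), node (snd (es ! k))}"

definition half_edge :: "nat \<Rightarrow> 'a set" where
  "half_edge h = edge (if h \<le> length es then h - 1 else h - length es - 1)"

lemma distinct_vs: "distinct vs" and set_vs: "set vs = V"
  using encodes by (auto simp: encodes_graph_def)

lemma length_vs: "length vs = card V"
  using distinct_card[OF distinct_vs] set_vs by simp

lemma edge_map: "map (\<lambda>(i, j). {vs ! i, vs ! j}) es = map edge [0..<length es]"
  by (rule nth_equalityI) (auto simp: edge_def case_prod_beta)

lemma edge_inj: "k < length es \<Longrightarrow> k' < length es \<Longrightarrow> edge k = edge k' \<Longrightarrow> k = k'"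
proof -
  have "inj_on edge {0..<length es}"
    using encodes by (simp only: encodes_graph_def edge_map distinct_map set_upt)
  then show "k < length es \<Longrightarrow> k' < length es \<Longrightarrow> edge k = edge k' \<Longrightarrow> k = k'"
    by (auto simp: inj_on_def)
qed

lemma edges: "E = edge ` {0..<length es}"
  using encodes by (simp only: encodes_graph_def edge_map set_map set_upt)

lemma length_es: "length es = card E"
proof -
  have "inj_on edge {0..<length es}"
    using edge_inj by (auto simp: inj_on_def)
  then show ?thesis
    by (simp add: edges card_image)
qed

lemma endpoints:
  assumes "k < length es"
  shows "fst (es ! k) < length vs" "snd (es ! k) < length vs" "fst (es ! k) \<noteq> snd (es ! k)"
proof -
  have "es ! k \<in> set es"
    using assms by simp
  then show "fst (es ! k) < length vs" "snd (es ! k) < length vs"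
    using encodes unfolding encodes_graph_def by (metis (mono_tags, lifting) case_prod_beta)+
  have "card (edge k) = 2"
    using simple edges assms by (auto simp: simple_graph_def)
  then show "fst (es ! k) \<noteq> snd (es ! k)"
    by (auto simp: edge_def)
qed

lemma half_edge_eq:
  assumes "0 < h" "h \<le> 2 * length es"
  shows "half_edge h = {node (own_of es h), node (own_of es (opp_of (length es) h))}"
  using assms by (auto simp: half_edge_def edge_def own_of_def opp_of_def)

sublocale half_edges "length vs" "length es" "own_of es" "opp_of (length es)"
proof
  fix h assume h: "0 < h" "h \<le> 2 * length es"
  show "own_of es h < length vs"
    using h endpoints[of "h - 1"] endpoints[of "h - length es - 1"] by (auto simp: own_of_def)
  show "0 < opp_of (length es) h \<and> opp_of (length es) h \<le> 2 * length es"
    "opp_of (length es) (opp_of (length es) h) = h"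
    using h by (auto simp: opp_of_def)
  show own_opp: "own_of es (opp_of (length es) h) \<noteq> own_of es h"
  proof (cases "h \<le> length es")
    case True
    then have "h - 1 < length es"
      using h by linarith
    from endpoints(3)[OF this] show ?thesis
      using True h by (auto simp: own_of_def opp_of_def)
  next
    case False
    then have "h - length es - 1 < length es"
      using h by linarith
    from endpoints(3)[OF this] show ?thesis
      using False h by (auto simp: own_of_def opp_of_def)
  qed
  fix h' assume h': "0 < h'" "h' \<le> 2 * length es" and eq: "own_of es h = own_of es h'"
    "own_of es (opp_of (length es) h) = own_of es (opp_of (length es) h')"
  have "half_edge h = half_edge h'"
    using half_edge_eq[OF h] half_edge_eq[OF h'] eq by simp
  then have "(if h \<le> length es then h - 1 else h - length es - 1) =
      (if h' \<le> length es then h' - 1 else h' - length es - 1)"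
    unfolding half_edge_def by (rule edge_inj[rotated 2]) (use h h' in auto)
  then have "h' = h \<or> h' = opp_of (length es) h"
    using h h' by (auto simp: opp_of_def split: if_splits)
  then show "h = h'"
    using own_opp eq by auto
qed

lemma node_inj: "v < length vs \<Longrightarrow> w < length vs \<Longrightarrow> node v = node w \<longleftrightarrow> v = w"
  using distinct_vs by (simp add: nth_eq_iff_index_eq)

lemma V_nodes: "V = node ` {..<length vs}"
  using set_vs by (auto simp: set_conv_nth)

lemma half_edge_in: "is_half h \<Longrightarrow> half_edge h \<in> E"
  unfolding edges half_edge_def by (rule imageI) auto

lemma ex_half:
  assumes "{u, w} \<in> E"
  obtains h where "is_half h" "node (other h) = u" "node (own_of es h) = w"
proof -
  obtain k where k: "k < length es" "{u, w} = edge k"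
    using assms by (auto simp: edges)
  have "is_half (k + 1)" "is_half (k + 1 + length es)"
    using k by auto
  moreover have "node (own_of es (k + 1)) = w \<and> node (other (k + 1)) = u \<or>
      node (own_of es (k + 1 + length es)) = w \<and> node (other (k + 1 + length es)) = u"
    using k by (auto simp: own_of_def opp_of_def edge_def doubleton_eq_iff)
  ultimately show ?thesis
    using that[of "k + 1"] that[of "k + 1 + length es"] by argo
qed

lemma half_of_edge:
  assumes "e \<in> E" "node v \<in> e" "v < length vs"
  obtains h where "is_half h" "own_of es h = v" "half_edge h = e"
proof -
  obtain k where k: "k < length es" "e = edge k"
    using assms(1) by (auto simp: edges)
  have "v = fst (es ! k) \<or> v = snd (es ! k)"
    using assms k endpoints[OF k(1)] node_inj by (auto simp: edge_def)
  moreover have "is_half (k + 1)" "is_half (k + 1 + length es)"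
    using k by auto
  ultimately show ?thesis
    using that[of "k + 1"] that[of "k + 1 + length es"] k by (auto simp: own_of_def half_edge_def)
qed

lemma halves_at: "v < length vs \<Longrightarrow> {e \<in> E. node v \<in> e} = half_edge ` {h. is_half h \<and> own_of es h = v}"
proof -
  assume v: "v < length vs"
  show ?thesis
  proof (rule set_eqI, rule iffI)
    fix e assume "e \<in> {e \<in> E. node v \<in> e}"
    then obtain h where "is_half h" "own_of es h = v" "half_edge h = e"
      using half_of_edge[of e v] v by auto
    then show "e \<in> half_edge ` {h. is_half h \<and> own_of es h = v}"
      by (intro image_eqI[of _ _ h]) auto
  next
    fix e assume "e \<in> half_edge ` {h. is_half h \<and> own_of es h = v}"
    then obtain h where "is_half h" "own_of es h = v" "e = half_edge h"
      by auto
    then show "e \<in> {e \<in> E. node v \<in> e}"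
      using half_edge_in[of h] half_edge_eq[of h] by simp
  qed
qed

lemma half_edge_inj: "inj_on half_edge {h. is_half h \<and> own_of es h = v}"
proof (rule inj_onI)
  fix h h' assume h: "h \<in> {h. is_half h \<and> own_of es h = v}" "h' \<in> {h. is_half h \<and> own_of es h = v}"
    "half_edge h = half_edge h'"
  then have "node (other h) = node (other h')"
    using half_edge_eq[of h] half_edge_eq[of h'] by (auto simp: doubleton_eq_iff)
  then have "other h = other h'"
    using h node_inj other_less by auto
  then show "h = h'"
    using h by (auto intro: half_edge_eqI)
qed

lemma degree: "v < length vs \<Longrightarrow> card {e \<in> E. node v \<in> e} = degr v"
  unfolding halves_upto_def by (simp only: halves_at card_image[OF half_edge_inj]) (simp only: conj_assoc)

lemma max_degree: "max_degree V E = Max (degr ` {..<length vs})"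
  unfolding max_degree_def V_nodes by (rule arg_cong[of _ _ Max]) (force simp: degree)

lemma nodes_nonempty: "0 < length vs"
  using simple set_vs by (auto simp: simple_graph_def)

lemma degr_le_max: "v < length vs \<Longrightarrow> degr v \<le> max_degree V E"
  unfolding max_degree by (rule Max_ge) auto

subsection \<open>Orientations\<close>

definition arcs :: "(nat \<Rightarrow> nat) \<Rightarrow> ('a \<times> 'a) set" where
  "arcs inc = {(node (other h), node (own_of es h)) |h. is_half h \<and> inc h = 1}"

lemma half_eqI:
  assumes "is_half h" "is_half k" "node (other h) = node (other k)" "node (own_of es h) = node (own_of es k)"
  shows "h = k"
  using assms half_edge_eqI[of h k] own_less[of h] own_less[of k] other_less[of h] other_less[of k]
  by (simp add: node_inj)

lemma arcs_half: "is_half h \<Longrightarrow> (node (other h), node (own_of es h)) \<in> arcs inc \<longleftrightarrow> inc h = 1"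
  unfolding arcs_def using half_eqI by blast

lemma orientation_arcs:
  assumes "orient inc"
  shows "orientation E (arcs inc)"
  unfolding orientation_def
proof (intro conjI allI impI)
  show "\<forall>(v, w)\<in>arcs inc. {v, w} \<in> E"
    using half_edge_in half_edge_eq by (auto simp: arcs_def insert_commute)
  fix u w assume "{u, w} \<in> E"
  then obtain h where h: "is_half h" "node (other h) = u" "node (own_of es h) = w"
    by (rule ex_half)
  then have "(u, w) \<in> arcs inc \<longleftrightarrow> inc h = 1"
    using arcs_half by auto
  moreover have "(w, u) \<in> arcs inc \<longleftrightarrow> inc (opp_of (length es) h) = 1"
    using arcs_half[OF opp_half[OF h(1)]] opp_opp[of h] h by auto
  moreover have "inc h \<le> 1 \<and> inc h + inc (opp_of (length es) h) = 1"
    by (rule orientD[OF assms h(1)])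
  ultimately show "((u, w) \<in> arcs inc) = ((w, u) \<notin> arcs inc)"
    by linarith
qed

lemma ex_orient:
  assumes "orientation E D"
  obtains inc where "orient inc" "arcs inc = D"
proof
  let ?inc = "\<lambda>h. if (node (other h), node (own_of es h)) \<in> D then 1 else 0 :: nat"
  show "orient ?inc"
    unfolding orient_def
  proof (intro allI impI)
    fix h assume h: "is_half h"
    then have "{node (other h), node (own_of es h)} \<in> E"
      using half_edge_in half_edge_eq by (auto simp: insert_commute)
    then show "?inc h \<le> 1 \<and> ?inc h + ?inc (opp_of (length es) h) = 1"
      using assms opp_opp[of h] h by (auto simp: orientation_def)
  qed
  have "(u, w) \<in> arcs ?inc" if "(u, w) \<in> D" for u w
  proof -
    have "{u, w} \<in> E"
      using assms that by (auto simp: orientation_def)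
    then obtain h where "is_half h" "node (other h) = u" "node (own_of es h) = w"
      by (rule ex_half)
    then show ?thesis
      using that arcs_half by auto
  qed
  then show "arcs ?inc = D"
    by (auto simp: arcs_def split: if_splits)
qed

lemma indegree_arcs:
  assumes "v < length vs"
  shows "indegree (arcs inc) (node v) = indeg inc v"
proof -
  have "{u. (u, node v) \<in> arcs inc} = (\<lambda>h. node (other h)) ` {h. is_half h \<and> own_of es h = v \<and> inc h = 1}"
    using assms own_less by (auto simp: arcs_def node_inj)
  moreover have "inj_on (\<lambda>h. node (other h)) {h. is_half h \<and> own_of es h = v \<and> inc h = 1}"
    by (rule inj_onI) (auto intro: half_eqI)
  ultimately show ?thesis
    by (simp add: indegree_def indeg_def card_image)
qed

lemma max_indegree_le:
  "max_indegree V (arcs inc) \<le> k \<longleftrightarrow> (\<forall>v<length vs. indeg inc v \<le> k)"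
proof -
  have "max_indegree V (arcs inc) = Max (indeg inc ` {..<length vs})"
    unfolding max_indegree_def V_nodes by (rule arg_cong[of _ _ Max]) (force simp: indegree_arcs)
  moreover have "{..<length vs} \<noteq> {}"
    using nodes_nonempty by auto
  ultimately show ?thesis
    by auto
qed

subsection \<open>Star colorings\<close>

definition star_value :: "(nat \<Rightarrow> nat) \<Rightarrow> nat \<Rightarrow> nat" where
  "star_value inc v = indeg inc v + (if indeg inc v < degr v then 1 else 0)"

text \<open>The coloring \<open>K\<close> gives each edge the color of its tail under \<open>inc\<close>.\<close>

definition colored_by :: "('a \<Rightarrow> 'c) \<Rightarrow> (nat \<Rightarrow> nat) \<Rightarrow> ('a set \<Rightarrow> 'c) \<Rightarrow> bool" where
  "colored_by C inc K \<longleftrightarrow>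
     (\<forall>h. is_half h \<longrightarrow> K (half_edge h) = C (node (if inc h = 1 then other h else own_of es h)))"

text \<open>The edges that enter \<open>v\<close> have the colors of different neighbors, the graph being simple, and the
  edges that leave \<open>v\<close> all have the color of \<open>v\<close>.\<close>

lemma node_colors:
  assumes C: "inj_on C V" and inc: "orient inc" and K: "colored_by C inc K" and v: "v < length vs"
  shows "node_colors E K (node v) = star_value inc v"
proof -
  let ?A = "\<lambda>i. {h. is_half h \<and> own_of es h = v \<and> inc h = (i::nat)}"
  have all: "{h. is_half h \<and> own_of es h = v} = ?A 1 \<union> ?A 0"
  proof -
    have "inc h = 1 \<or> inc h = 0" if "is_half h" for h
      using orientD[OF inc that] by linarith
    then show ?thesis
      by blast
  qed
  have col1: "K (half_edge h) = C (node (other h))" if "h \<in> ?A 1" for h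
    using K that by (simp add: colored_by_def)
  have col0: "K (half_edge h) = C (node v)" if "h \<in> ?A 0" for h
    using K that by (simp add: colored_by_def)
  have in_V: "node w \<in> V" if "w < length vs" for w
    using that by (auto simp: V_nodes)
  have C_eq: "C (node u) = C (node w) \<longleftrightarrow> u = w" if "u < length vs" "w < length vs" for u w
    using inj_on_eq_iff[OF C in_V[OF that(1)] in_V[OF that(2)]] node_inj[OF that] by simp
  have "{K e |e. e \<in> E \<and> node v \<in> e} = K ` {e \<in> E. node v \<in> e}"
    by blast
  also have "\<dots> = (\<lambda>h. K (half_edge h)) ` ?A 1 \<union> (\<lambda>h. K (half_edge h)) ` ?A 0"
    by (simp only: halves_at[OF v] all image_image image_Un)
  also have "(\<lambda>h. K (half_edge h)) ` ?A 1 = (\<lambda>h. C (node (other h))) ` ?A 1"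
    by (rule image_cong[OF refl col1])
  also have "(\<lambda>h. K (half_edge h)) ` ?A 0 = (\<lambda>h. C (node v)) ` ?A 0"
    by (rule image_cong[OF refl col0])
  finally have colors: "{K e |e. e \<in> E \<and> node v \<in> e} =
      (\<lambda>h. C (node (other h))) ` ?A 1 \<union> (\<lambda>h. C (node v)) ` ?A 0" .
  have "inj_on (\<lambda>h. C (node (other h))) (?A 1)"
  proof (rule inj_onI)
    fix h k assume "h \<in> ?A 1" "k \<in> ?A 1" "C (node (other h)) = C (node (other k))"
    then show "h = k"
      using C_eq[of "other h" "other k"] other_less by (auto intro: half_edge_eqI)
  qed
  then have card1: "card ((\<lambda>h. C (node (other h))) ` ?A 1) = indeg inc v"
    by (simp add: card_image indeg_def)
  have "card (?A 1 \<union> ?A 0) = card (?A 1) + card (?A 0)"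
    by (rule card_Un_disjoint) auto
  then have deg: "degr v = indeg inc v + card (?A 0)"
    using all by (simp add: halves_upto_def indeg_def conj_assoc)
  have notin: "C (node v) \<notin> (\<lambda>h. C (node (other h))) ` ?A 1"
  proof
    assume "C (node v) \<in> (\<lambda>h. C (node (other h))) ` ?A 1"
    then obtain h where h: "is_half h" "own_of es h = v" "C (node v) = C (node (other h))"
      by auto
    then show False
      using C_eq[OF v other_less[OF h(1)]] own_opp[of h] by auto
  qed
  show ?thesis
  proof (cases "?A 0 = {}")
    case True
    then have "card (?A 0) = 0"
      by simp
    then show ?thesis
      using deg by (simp only: node_colors_def colors True card1 star_value_def image_empty Un_empty_right) simp
  next
    case False
    then have "0 < card (?A 0)"
      by (simp add: card_gt_0_iff)
    moreover have "(\<lambda>h. C (node v)) ` ?A 0 = {C (node v)}"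
      using False by blast
    ultimately show ?thesis
      using deg notin card1 by (simp add: node_colors_def colors star_value_def)
  qed
qed

lemma max_node_colors_le:
  assumes "inj_on C V" "orient inc" "colored_by C inc K"
  shows "max_node_colors V E K \<le> k \<longleftrightarrow> (\<forall>v<length vs. star_value inc v \<le> k)"
proof -
  have "max_node_colors V E K = Max (star_value inc ` {..<length vs})"
    unfolding max_node_colors_def V_nodes
    by (rule arg_cong[of _ _ Max]) (force simp: node_colors[OF assms, unfolded V_nodes])
  moreover have "{..<length vs} \<noteq> {}"
    using nodes_nonempty by auto
  ultimately show ?thesis
    by auto
qed

lemma ex_colored_by:
  assumes C: "inj_on C V" and K: "star_coloring E C K"
  obtains inc where "orient inc" "colored_by C inc K"
proof
  let ?inc = "\<lambda>h. if K (half_edge h) = C (node (other h)) then 1 else 0 :: nat"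
  have *: "(K (half_edge h) = C (node (other h))) \<noteq> (K (half_edge h) = C (node (own_of es h)))"
    if h: "is_half h" for h
  proof -
    have "node (other h) \<in> V" "node (own_of es h) \<in> V" "node (other h) \<noteq> node (own_of es h)"
      using other_less[OF h] own_less[of h] own_opp[of h] h node_inj by (auto simp: V_nodes)
    then have "C (node (other h)) \<noteq> C (node (own_of es h))"
      using C by (auto simp: inj_on_def)
    moreover have "\<exists>v\<in>half_edge h. K (half_edge h) = C v"
      using K half_edge_in[OF h] by (auto simp: star_coloring_def)
    ultimately show ?thesis
      using half_edge_eq[of h] h by auto
  qed
  have opp: "half_edge (opp_of (length es) h) = half_edge h" if h: "is_half h" for h
    using half_edge_eq[of h] half_edge_eq[of "opp_of (length es) h"] opp_half[OF h] opp_opp[of h] h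
    by auto
  show "orient ?inc"
    unfolding orient_def
  proof (intro allI impI)
    fix h assume h: "is_half h"
    show "?inc h \<le> 1 \<and> ?inc h + ?inc (opp_of (length es) h) = 1"
      using *[OF h] opp[OF h] opp_opp[of h] h by auto
  qed
  show "colored_by C ?inc K"
    unfolding colored_by_def using * by auto
qed

lemma colored_by_coloring:
  assumes inc: "orient inc"
  shows "colored_by C inc (coloring_of_orientation C (arcs inc))"
  unfolding colored_by_def
proof (intro allI impI)
  fix h assume h: "is_half h"
  let ?t = "if inc h = 1 then other h else own_of es h"
  let ?s = "if inc h = 1 then own_of es h else other h"
  have "(THE v. \<exists>w. (v, w) \<in> arcs inc \<and> half_edge h = {v, w}) = node ?t"
  proof (rule the_equality)
    have "(node ?t, node ?s) \<in> arcs inc"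
      using arcs_half[OF h, of inc] arcs_half[OF opp_half[OF h], of inc] opp_opp[of h] orientD[OF inc h] h
      by auto
    then show "\<exists>w. (node ?t, w) \<in> arcs inc \<and> half_edge h = {node ?t, w}"
      using half_edge_eq[of h] h by (intro exI[of _ "node ?s"]) auto
    fix u assume "\<exists>w. (u, w) \<in> arcs inc \<and> half_edge h = {u, w}"
    then obtain k where k: "is_half k" "inc k = 1" "u = node (other k)"
        "half_edge h = {node (other k), node (own_of es k)}"
      by (auto simp: arcs_def)
    have "node (other h) = node (other k) \<and> node (own_of es h) = node (own_of es k) \<or>
        node (own_of es h) = node (other k) \<and> node (other h) = node (own_of es k)"
      using k(4) half_edge_eq[of h] h by (auto simp: doubleton_eq_iff)
    then have "h = k \<or> opp_of (length es) h = k"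
      using half_eqI[OF h k(1)] half_eqI[OF opp_half[OF h] k(1)] opp_opp[of h] h by auto
    then show "u = node ?t"
      using k orientD[OF inc h] opp_opp[of h] h by auto
  qed
  then show "coloring_of_orientation C (arcs inc) (half_edge h) = C (node ?t)"
    by (simp add: coloring_of_orientation_def)
qed

lemma star_coloring_arcs:
  assumes inc: "orient inc"
  shows "star_coloring E C (coloring_of_orientation C (arcs inc))"
  unfolding star_coloring_def
proof
  fix e assume "e \<in> E"
  then obtain k where k: "k < length es" "e = edge k"
    by (auto simp: edges)
  then have h: "is_half (k + 1)" "half_edge (k + 1) = e"
    by (auto simp: half_edge_def)
  then have "coloring_of_orientation C (arcs inc) e =
      C (node (if inc (k + 1) = 1 then other (k + 1) else own_of es (k + 1)))"
    using colored_by_coloring[OF inc, of C] unfolding colored_by_def by metis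
  then show "\<exists>v\<in>e. coloring_of_orientation C (arcs inc) e = C v"
    using half_edge_eq[of "k + 1"] h by auto
qed

subsection \<open>Optimality\<close>

lemma level_cap_odd: "(\<forall>v<length vs. indeg inc v \<le> level_cap (Suc (2 * k)) v) \<longleftrightarrow>
    (\<forall>v<length vs. star_value inc v \<le> Suc k)"
proof -
  have "indeg inc v \<le> level_cap (Suc (2 * k)) v \<longleftrightarrow> star_value inc v \<le> Suc k" for v
    using indeg_le_degr[of inc v] by (auto simp: level_cap_def star_value_def)
  then show ?thesis
    by blast
qed

text \<open>A competitor with maximum indegree \<open>k\<close> meets level \<open>2 * k\<close> and one with \<open>k > 0\<close> colors meets
  level \<open>2 * k - 1\<close>; without colors there are no edges. In both cases that level is at least \<open>j\<close> by minimality, so the capacities of level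
  \<open>j\<close> are below those of the competitor's level, which \<open>inc\<close> therefore meets, too.\<close>

theorem least_level_optimal:
  assumes C: "inj_on C V" and inc: "orient inc" "\<forall>v<length vs. indeg inc v \<le> level_cap j v"
    and least: "0 < j \<Longrightarrow> \<not> feasible (level_cap (j - 1))"
  shows "MinMaxStar_optimal V E C (arcs inc)" "MinMaxInd_optimal V E (arcs inc)"
proof -
  have infeasible: False if "orient inc'" "\<forall>v<length vs. indeg inc' v \<le> level_cap i v" "i < j" for inc' i
  proof -
    have "feasible (level_cap i)"
      using that by (auto simp: feasible_def)
    then have "feasible (level_cap (j - 1))"
      by (rule feasible_mono) (use that in simp)
    then show False
      using least that by simp
  qed
  show "MinMaxInd_optimal V E (arcs inc)"
    unfolding MinMaxInd_optimal_def
  proof (intro conjI allI impI)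
    show "orientation E (arcs inc)"
      by (rule orientation_arcs[OF inc(1)])
    fix D' assume "orientation E D'"
    then obtain inc' where inc': "orient inc'" "arcs inc' = D'"
      by (rule ex_orient)
    let ?k = "max_indegree V D'"
    have "j \<le> 2 * ?k"
    proof (rule ccontr)
      assume "\<not> ?thesis"
      then show False
        using infeasible[OF inc'(1), of "2 * ?k"] max_indegree_le[of inc' ?k] inc'(2) level_cap_even
        by auto
    qed
    then have "\<forall>v<length vs. indeg inc v \<le> level_cap (2 * ?k) v"
      using inc(2) level_cap_mono order_trans by blast
    then show "max_indegree V (arcs inc) \<le> max_indegree V D'"
      using max_indegree_le level_cap_even by blast
  qed
  show "MinMaxStar_optimal V E C (arcs inc)"
    unfolding MinMaxStar_optimal_def optimal_star_coloring_def
  proof (intro conjI allI impI)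
    show "orientation E (arcs inc)"
      by (rule orientation_arcs[OF inc(1)])
    show "star_coloring E C (coloring_of_orientation C (arcs inc))"
      by (rule star_coloring_arcs[OF inc(1)])
    fix K' assume "star_coloring E C K'"
    then obtain inc' where inc': "orient inc'" "colored_by C inc' K'"
      using ex_colored_by[OF C] by blast
    let ?k = "max_node_colors V E K'"
    have star': "\<forall>v<length vs. star_value inc' v \<le> ?k"
      using max_node_colors_le[OF C inc', of ?k] by simp
    have "\<forall>v<length vs. star_value inc v \<le> ?k"
    proof (cases ?k)
      case 0
      then have "\<forall>v<length vs. indeg inc' v = 0"
        using star' by (auto simp: star_value_def)
      then have "es = []"
        using indeg_0[OF inc'(1)] by simp
      then show ?thesis
        using degr_le indeg_le_degr[of inc] unfolding star_value_def by simp
    next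
      case (Suc k)
      have "j \<le> Suc (2 * k)"
      proof (rule ccontr)
        assume "\<not> ?thesis"
        then show False
          using infeasible[OF inc'(1), of "Suc (2 * k)"] star' Suc level_cap_odd by auto
      qed
      then have "\<forall>v<length vs. indeg inc v \<le> level_cap (Suc (2 * k)) v"
        using inc(2) level_cap_mono order_trans by blast
      then show ?thesis
        using Suc level_cap_odd by simp
    qed
    then show "max_node_colors V E (coloring_of_orientation C (arcs inc)) \<le> max_node_colors V E K'"
      using max_node_colors_le[OF C inc(1) colored_by_coloring[OF inc(1)]] by simp
  qed
qed

text \<open>Entry \<open>k\<close> of the output is nonzero iff edge \<open>k\<close> is reversed, that is, iff it enters its first listed
  end, whose half-edge is \<open>k + 1\<close>.\<close>

lemma output_arcs:
  assumes "orient inc" "\<And>k. k < length es \<Longrightarrow> snd s ''out'' k = inc (Suc k)"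
  shows "output_orientation vs es s = arcs inc"
proof -
  have arc: "(if snd s ''out'' k = 0 then (node (fst (es ! k)), node (snd (es ! k)))
      else (node (snd (es ! k)), node (fst (es ! k)))) \<in> arcs inc" if k: "k < length es" for k
  proof -
    have h: "is_half (Suc k)" "is_half (opp_of (length es) (Suc k))"
      using k opp_half[of "Suc k"] by auto
    have "own_of es (Suc k) = fst (es ! k)" "other (Suc k) = snd (es ! k)"
      using k by (auto simp: own_of_def opp_of_def)
    then show ?thesis
      using arcs_half[OF h(1), of inc] arcs_half[OF h(2), of inc] opp_opp[of "Suc k"]
        orientD[OF assms(1) h(1)] assms(2)[OF k] h(1) by auto
  qed
  have "a \<in> output_orientation vs es s" if a: "a \<in> arcs inc" for a
  proof -
    obtain h where h: "is_half h" "inc h = 1" "a = (node (other h), node (own_of es h))"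
      using a by (auto simp: arcs_def)
    define k where "k = (if h \<le> length es then h - 1 else h - length es - 1)"
    have k: "k < length es" "h = Suc k \<or> h = Suc k + length es"
      using h by (auto simp: k_def)
    have "inc (Suc k) + inc (Suc k + length es) = 1"
      using orientD[OF assms(1), of "Suc k"] k by (simp add: opp_of_def)
    then have "a = (if snd s ''out'' k = 0 then (node (fst (es ! k)), node (snd (es ! k)))
      else (node (snd (es ! k)), node (fst (es ! k))))"
      using h k assms(2)[OF k(1)] by (auto simp: own_of_def opp_of_def)
    then show ?thesis
      unfolding output_orientation_def using k by blast
  qed
  moreover have "output_orientation vs es s \<subseteq> arcs inc"
    unfolding output_orientation_def using arc by blast
  ultimately show ?thesis
    by blast
qed

subsection \<open>Connected graphs\<close>

lemma connected_degr_pos: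
  assumes "connected_graph V E" "1 < length vs" "v < length vs"
  shows "0 < degr v"
proof -
  define w :: nat where "w = (if v = 0 then 1 else 0)"
  have w: "w < length vs" "w \<noteq> v"
    using assms by (auto simp: w_def)
  then have "(node v, node w) \<in> {(a, b). {a, b} \<in> E}\<^sup>*" "node v \<noteq> node w"
    using assms node_inj by (auto simp: connected_graph_def V_nodes)
  then obtain b where "{node v, b} \<in> E"
    by (auto elim: converse_rtranclE)
  then have "{e \<in> E. node v \<in> e} \<noteq> {}"
    by blast
  moreover have "finite E"
    by (simp add: edges)
  ultimately have "0 < card {e \<in> E. node v \<in> e}"
    by (simp add: card_gt_0_iff)
  then show ?thesis
    using degree assms by simp
qed

lemma connected_nodes_le: "connected_graph V E \<Longrightarrow> length vs \<le> 2 * length es + 1"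
proof (cases "1 < length vs")
  case True
  assume "connected_graph V E"
  then have "(\<Sum>v<length vs. 1) \<le> (\<Sum>v<length vs. degr v)"
    using connected_degr_pos True by (intro sum_mono) (simp add: Suc_le_eq)
  then show ?thesis
    using sum_halves_upto[of "2 * length es"] by simp
qed simp

text \<open>For maximum degree 1 the factor \<open>log 2 \<Delta>\<close> of the time bound vanishes, so that the running time has to
  be constant. An edge whose ends have degree 1 is a component, so there are no further nodes.\<close>

lemma connected_degree_1:
  assumes con: "connected_graph V E" and deg: "max_degree V E \<le> 1"
  shows "length vs \<le> 2"
proof (cases "\<exists>v w. {v, w} \<in> E")
  case True
  then obtain v w where e: "{v, w} \<in> E"
    by blast
  have same: "e' = {v, w}" if "e' \<in> E" "a \<in> e'" "a \<in> {v, w}" for e' a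
  proof -
    have "a \<in> V"
      using that simple by (auto simp: simple_graph_def)
    then obtain u where "u < length vs" "a = node u"
      using V_nodes by auto
    then have "card {e \<in> E. a \<in> e} \<le> 1"
      using degree[of u] degr_le_max[of u] deg by simp
    moreover have "finite {e \<in> E. a \<in> e}"
      by (simp add: edges)
    ultimately show ?thesis
      using that e by (auto simp: card_le_Suc0_iff_eq)
  qed
  have "b \<in> {v, w}" if "(v, b) \<in> {(a, b). {a, b} \<in> E}\<^sup>*" for b
    using that
  proof (induction rule: rtrancl_induct)
    case (step b c)
    then have "{b, c} = {v, w}"
      using same by auto
    then show ?case
      by blast
  qed simp
  moreover have "v \<in> V"
    using e simple by (auto simp: simple_graph_def)
  ultimately have "V \<subseteq> {v, w}"
    using con by (auto simp: connected_graph_def)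
  then have "card V \<le> card {v, w}"
    by (rule card_mono[rotated]) simp
  also have "\<dots> \<le> 2"
    by (simp add: card_insert_if)
  finally show ?thesis
    by (simp add: length_vs)
next
  case False
  then have "\<not> 1 < length vs"
  proof -
    have "(node 0, node 1) \<in> {(a, b). {a, b} \<in> E}\<^sup>*" if "1 < length vs"
      using con that nodes_nonempty by (auto simp: connected_graph_def V_nodes)
    then have "node 0 = node 1" if "1 < length vs"
      using False that by (auto elim: converse_rtranclE)
    then show ?thesis
      using node_inj[of 0 1] by force
  qed
  then show ?thesis
    by simp
qed

end

section \<open>The program\<close>

text \<open>Arrays: \<open>own\<close>, \<open>opp\<close> and \<open>inc\<close> describe the half-edges, \<open>head\<close> and \<open>next\<close> the linked lists of
  half-edges of the nodes, \<open>deg\<close>, \<open>ind\<close> and \<open>cap\<close> are degree, indegree and capacity, \<open>d\<close> is the label,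
  \<open>cur\<close> the list pointer, \<open>stk\<close> a stack of height \<open>sp\<close>, \<open>vis\<close> and \<open>par\<close> the search forest.
  \<open>half\<close> tabulates division by 2.\<close>

text \<open>One step of push-relabel at the node \<open>v\<close> on top of the stack: drop it if it has no surplus or label
  \<open>L\<close>, relabel it if its list is exhausted, and otherwise advance in its list, with a push if the
  half-edge that was passed admits one.\<close>

definition push_step :: com where
  "push_step =
    (Sub ''i'' (Var ''sp'') (Const 1) ;;
     Load ''v'' ''stk'' (Var ''i'') ;;
     Load ''x'' ''ind'' (Var ''v'') ;;
     Load ''y'' ''cap'' (Var ''v'') ;;
     Load ''z'' ''d'' (Var ''v'') ;;
     Cond (LessEq (Var ''x'') (Var ''y''))
       (Copy ''sp'' (Var ''i''))
       (Cond (LessEq (Var ''L'') (Var ''z''))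
          (Copy ''sp'' (Var ''i''))
          (Load ''h'' ''cur'' (Var ''v'') ;;
           Cond (Equal (Var ''h'') (Const 0))
             (Add ''z'' (Var ''z'') (Const 1) ;;
              Store ''d'' (Var ''v'') (Var ''z'') ;;
              Load ''h'' ''head'' (Var ''v'') ;;
              Store ''cur'' (Var ''v'') (Var ''h''))
             (Load ''g'' ''next'' (Var ''h'') ;;
              Store ''cur'' (Var ''v'') (Var ''g'') ;;
              Load ''g'' ''inc'' (Var ''h'') ;;
              Cond (Equal (Var ''g'') (Const 1))
                (Load ''g'' ''opp'' (Var ''h'') ;;
                 Load ''u'' ''own'' (Var ''g'') ;;
                 Load ''y'' ''d'' (Var ''u'') ;;
                 Add ''y'' (Var ''y'') (Const 1) ;;
                 Cond (Equal (Var ''z'') (Var ''y''))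
                   (Store ''inc'' (Var ''h'') (Const 0) ;;
                    Store ''inc'' (Var ''g'') (Const 1) ;;
                    Sub ''x'' (Var ''x'') (Const 1) ;;
                    Store ''ind'' (Var ''v'') (Var ''x'') ;;
                    Load ''x'' ''ind'' (Var ''u'') ;;
                    Add ''x'' (Var ''x'') (Const 1) ;;
                    Store ''ind'' (Var ''u'') (Var ''x'') ;;
                    Store ''stk'' (Var ''sp'') (Var ''u'') ;;
                    Add ''sp'' (Var ''sp'') (Const 1))
                   (Skip))
                (Skip)))))"

definition root_step :: com where
  "root_step =
    (Load ''x'' ''ind'' (Var ''i'') ;;
     Load ''y'' ''cap'' (Var ''i'') ;;
     Load ''h'' ''head'' (Var ''i'') ;;
     Store ''cur'' (Var ''i'') (Var ''h'') ;;
     Cond (Less (Var ''y'') (Var ''x''))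
       (Store ''vis'' (Var ''i'') (Const 1) ;;
        Store ''par'' (Var ''i'') (Const 0) ;;
        Store ''stk'' (Var ''sp'') (Var ''i'') ;;
        Add ''sp'' (Var ''sp'') (Const 1))
       (Store ''vis'' (Var ''i'') (Const 0)))"

definition search_init :: com where
  "search_init =
    (Copy ''sp'' (Const 0) ;;
     For ''i'' ''n'' (root_step))"

text \<open>Depth-first search. Reaching a node with spare capacity empties the stack, which ends the search.\<close>

definition search_step :: com where
  "search_step =
    (Sub ''i'' (Var ''sp'') (Const 1) ;;
     Load ''v'' ''stk'' (Var ''i'') ;;
     Load ''h'' ''cur'' (Var ''v'') ;;
     Cond (Equal (Var ''h'') (Const 0))
       (Copy ''sp'' (Var ''i''))
       (Load ''g'' ''next'' (Var ''h'') ;;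
        Store ''cur'' (Var ''v'') (Var ''g'') ;;
        Load ''g'' ''inc'' (Var ''h'') ;;
        Cond (Equal (Var ''g'') (Const 1))
          (Load ''g'' ''opp'' (Var ''h'') ;;
           Load ''u'' ''own'' (Var ''g'') ;;
           Load ''x'' ''vis'' (Var ''u'') ;;
           Cond (Equal (Var ''x'') (Const 0))
             (Load ''x'' ''vis'' (Var ''v'') ;;
              Add ''x'' (Var ''x'') (Const 1) ;;
              Store ''vis'' (Var ''u'') (Var ''x'') ;;
              Store ''par'' (Var ''u'') (Var ''h'') ;;
              Load ''x'' ''ind'' (Var ''u'') ;;
              Load ''y'' ''cap'' (Var ''u'') ;;
              Cond (Less (Var ''x'') (Var ''y''))
                (Add ''f'' (Var ''u'') (Const 1) ;;
                 Copy ''sp'' (Const 0))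
                (Store ''stk'' (Var ''sp'') (Var ''u'') ;;
                 Add ''sp'' (Var ''sp'') (Const 1)))
             (Skip))
          (Skip)))"

definition flip_step :: com where
  "flip_step =
    (Store ''inc'' (Var ''h'') (Const 0) ;;
     Load ''g'' ''opp'' (Var ''h'') ;;
     Store ''inc'' (Var ''g'') (Const 1) ;;
     Load ''w'' ''own'' (Var ''h'') ;;
     Load ''h'' ''par'' (Var ''w''))"

definition augment_start :: com where
  "augment_start =
    (Sub ''w'' (Var ''f'') (Const 1) ;;
     Load ''x'' ''ind'' (Var ''w'') ;;
     Add ''x'' (Var ''x'') (Const 1) ;;
     Store ''ind'' (Var ''w'') (Var ''x'') ;;
     Load ''h'' ''par'' (Var ''w''))"

definition augment_end :: com where
  "augment_end =
    (Load ''x'' ''ind'' (Var ''w'') ;;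
     Sub ''x'' (Var ''x'') (Const 1) ;;
     Store ''ind'' (Var ''w'') (Var ''x''))"

definition augment :: com where
  "augment =
    (augment_start ;;
     While (NotEqual (Var ''h'') (Const 0)) (flip_step) ;;
     augment_end)"

definition augment_once :: com where
  "augment_once =
    (search_init ;;
     Copy ''f'' (Const 0) ;;
     While (Less (Const 0) (Var ''sp'')) (search_step) ;;
     Cond (Less (Const 0) (Var ''f''))
       (augment)
       (Skip))"

text \<open>A test takes place at the capacities with threshold \<open>a\<close> and bound \<open>b\<close>, see \<open>level_cap\<close>. It
  keeps the orientation of the previous test and resets everything else.\<close>

definition node_step :: com where
  "node_step =
    (Load ''x'' ''deg'' (Var ''i'') ;;
     Cond (LessEq (Var ''x'') (Var ''a''))
       (Store ''cap'' (Var ''i'') (Var ''x''))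
       (Store ''cap'' (Var ''i'') (Var ''b'')) ;;
     Store ''d'' (Var ''i'') (Const 0) ;;
     Load ''h'' ''head'' (Var ''i'') ;;
     Store ''cur'' (Var ''i'') (Var ''h'') ;;
     Store ''stk'' (Var ''i'') (Var ''i'') ;;
     Store ''ind'' (Var ''i'') (Const 0))"

definition count_step :: com where
  "count_step =
    (Add ''h'' (Var ''i'') (Const 1) ;;
     Load ''g'' ''inc'' (Var ''h'') ;;
     Load ''v'' ''own'' (Var ''h'') ;;
     Load ''x'' ''ind'' (Var ''v'') ;;
     Add ''x'' (Var ''x'') (Var ''g'') ;;
     Store ''ind'' (Var ''v'') (Var ''x''))"

definition check_step :: com where
  "check_step =
    (Load ''x'' ''ind'' (Var ''i'') ;;
     Load ''y'' ''cap'' (Var ''i'') ;;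
     Cond (Less (Var ''y'') (Var ''x''))
       (Copy ''ok'' (Const 0))
       (Skip))"

text \<open>After the \<open>L\<close> rounds the indegrees respect the capacities whenever any orientation does. A round in
  which no node has surplus does nothing.\<close>

definition probe :: com where
  "probe =
    (For ''i'' ''n'' (node_step) ;;
     Copy ''sp'' (Var ''n'') ;;
     For ''i'' ''mm'' (count_step) ;;
     While (Less (Const 0) (Var ''sp'')) (push_step) ;;
     For ''k'' ''L'' (augment_once) ;;
     Copy ''ok'' (Const 1) ;;
     For ''i'' ''n'' (check_step))"

definition copy_step :: com where
  "copy_step =
    (Add ''h'' (Var ''i'') (Const 1) ;;
     Load ''g'' ''inc'' (Var ''h'') ;;
     Store ''out'' (Var ''i'') (Var ''g''))"

definition choose_level :: com where
  "choose_level =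
    (Add ''x'' (Var ''lo'') (Var ''hi'') ;;
     Load ''j'' ''half'' (Var ''x'') ;;
     Load ''b'' ''half'' (Var ''j'') ;;
     Sub ''a'' (Var ''j'') (Var ''b''))"

definition record_result :: com where
  "record_result =
    (Cond (Equal (Var ''ok'') (Const 1))
       (Copy ''hi'' (Var ''j'') ;;
        For ''i'' ''m'' (copy_step))
       (Copy ''lo'' (Var ''j'')))"

definition bisect_step :: com where
  "bisect_step =
    (choose_level ;;
     probe ;;
     record_result ;;
     Sub ''t'' (Var ''hi'') (Var ''lo''))"

text \<open>Level \<open>2 * D\<close>, where \<open>D\<close> is the maximum degree, imposes no condition and needs no test: the output
  array, initially zero, already describes the orientation in which the edges
  are listed.\<close>

definition bisect :: com where
  "bisect =
    (Copy ''lo'' (Const 0) ;;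
     Add ''hi'' (Var ''D'') (Var ''D'') ;;
     Sub ''t'' (Var ''hi'') (Var ''lo'') ;;
     While (Less (Const 1) (Var ''t'')) (bisect_step))"

definition edge_step :: com where
  "edge_step =
    (Load ''x'' ''src'' (Var ''i'') ;;
     Load ''y'' ''dst'' (Var ''i'') ;;
     Add ''h'' (Var ''i'') (Const 1) ;;
     Add ''g'' (Var ''h'') (Var ''m'') ;;
     Store ''own'' (Var ''h'') (Var ''x'') ;;
     Store ''own'' (Var ''g'') (Var ''y'') ;;
     Store ''opp'' (Var ''h'') (Var ''g'') ;;
     Store ''opp'' (Var ''g'') (Var ''h'') ;;
     Store ''inc'' (Var ''g'') (Const 1))"

definition list_step :: com where
  "list_step =
    (Add ''h'' (Var ''i'') (Const 1) ;;
     Load ''v'' ''own'' (Var ''h'') ;;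
     Load ''x'' ''head'' (Var ''v'') ;;
     Store ''next'' (Var ''h'') (Var ''x'') ;;
     Store ''head'' (Var ''v'') (Var ''h'') ;;
     Load ''x'' ''deg'' (Var ''v'') ;;
     Add ''x'' (Var ''x'') (Const 1) ;;
     Store ''deg'' (Var ''v'') (Var ''x''))"

definition max_step :: com where
  "max_step =
    (Load ''x'' ''deg'' (Var ''i'') ;;
     Cond (Less (Var ''D'') (Var ''x''))
       (Copy ''D'' (Var ''x''))
       (Skip))"

definition halve_step :: com where
  "halve_step =
    (Add ''x'' (Var ''i'') (Var ''i'') ;;
     Store ''half'' (Var ''x'') (Var ''i'') ;;
     Add ''x'' (Var ''x'') (Const 1) ;;
     Store ''half'' (Var ''x'') (Var ''i''))"

definition square_step :: com where
  "square_step =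
    (Add ''q'' (Var ''q'') (Var ''n''))"

text \<open>\<open>y\<close> and \<open>z\<close> are the square and the cube of \<open>L\<close>, updated by additions; \<open>q\<close> is \<open>n\<^sup>2\<close>. The tests of
  the machine are single comparisons, so the disjunction sets the flag \<open>t\<close>.\<close>

definition limit_step :: com where
  "limit_step =
    (Cond (LessEq (Var ''m'') (Var ''y''))
       (Copy ''t'' (Const 0))
       (Cond (LessEq (Var ''q'') (Var ''z''))
          (Copy ''t'' (Const 0))
          (Add ''z'' (Var ''z'') (Var ''y'') ;;
           Add ''z'' (Var ''z'') (Var ''y'') ;;
           Add ''z'' (Var ''z'') (Var ''y'') ;;
           Add ''z'' (Var ''z'') (Var ''L'') ;;
           Add ''z'' (Var ''z'') (Var ''L'') ;;
           Add ''z'' (Var ''z'') (Var ''L'') ;;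
           Add ''z'' (Var ''z'') (Const 1) ;;
           Add ''y'' (Var ''y'') (Var ''L'') ;;
           Add ''y'' (Var ''y'') (Var ''L'') ;;
           Add ''y'' (Var ''y'') (Const 1) ;;
           Add ''L'' (Var ''L'') (Const 1))))"

definition prepare :: com where
  "prepare =
    (Add ''mm'' (Var ''m'') (Var ''m'') ;;
     For ''i'' ''m'' (edge_step) ;;
     For ''i'' ''mm'' (list_step) ;;
     Copy ''D'' (Const 0) ;;
     For ''i'' ''n'' (max_step) ;;
     Add ''q'' (Var ''D'') (Var ''D'') ;;
     Add ''q'' (Var ''q'') (Const 1) ;;
     For ''i'' ''q'' (halve_step) ;;
     Copy ''q'' (Const 0) ;;
     For ''i'' ''n'' (square_step) ;;
     Copy ''L'' (Const 0) ;;
     Copy ''y'' (Const 0) ;;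
     Copy ''z'' (Const 0) ;;
     Copy ''t'' (Const 1) ;;
     While (Equal (Var ''t'') (Const 1)) (limit_step))"

definition star_ind :: com where
  "star_ind =
    (prepare ;;
     bisect)"

section \<open>Correctness and running time\<close>

text \<open>The numerical factors in the time bounds below are generous roundings.\<close>

locale half_edges_ram = half_edges +
  fixes W L :: nat
  assumes W: "8 * ((n + m + 2) * (n + m + 2) * (n + m + 2)) \<le> W"
    and L_le: "L \<le> m" and L_root: "m \<le> L * L \<or> n * n \<le> L * L * L"
begin

text \<open>Stack heights and \<open>n\<^sup>2\<close> are quadratic in the input size; all other values below are linear. The
  cubic bound on \<open>W\<close> is needed for the cube of \<open>L\<close>.\<close>

lemma less_W: "x \<le> 8 * ((n + m + 2) * (n + m + 2)) \<Longrightarrow> x < W"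
proof -
  assume x: "x \<le> 8 * ((n + m + 2) * (n + m + 2))"
  have "8 * ((n + m + 2) * (n + m + 2)) * 1 < 8 * ((n + m + 2) * (n + m + 2)) * (n + m + 2)"
    by (rule mult_strict_left_mono) auto
  then show "x < W"
    using x W by (simp add: mult.assoc)
qed

lemma small_W: "x \<le> 8 * (n + m + 2) \<Longrightarrow> x < W"
proof -
  assume x: "x \<le> 8 * (n + m + 2)"
  have "(n + m + 2) * 1 \<le> (n + m + 2) * (n + m + 2)"
    by (rule mult_left_mono) auto
  then show "x < W"
    using x by (intro less_W) linarith
qed

definition graph_data :: "state \<Rightarrow> bool" where
  "graph_data s \<longleftrightarrow> fst s ''n'' = n \<and> fst s ''m'' = m \<and> fst s ''mm'' = 2 * m \<and> fst s ''L'' = L \<and>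
     (\<forall>h. is_half h \<longrightarrow> snd s ''own'' h = own h \<and> snd s ''opp'' h = opp h \<and>
        snd s ''next'' h = below (own h) h) \<and>
     (\<forall>v<n. snd s ''head'' v = below v (Suc (2 * m)) \<and> snd s ''deg'' v = degr v)"

lemma graph_dataD:
  assumes "graph_data s"
  shows "fst s ''n'' = n" "fst s ''m'' = m" "fst s ''mm'' = 2 * m" "fst s ''L'' = L"
    and "is_half h \<Longrightarrow> snd s ''own'' h = own h"
    and "is_half h \<Longrightarrow> snd s ''opp'' h = opp h"
    and "is_half h \<Longrightarrow> snd s ''next'' h = below (own h) h"
    and "v < n \<Longrightarrow> snd s ''head'' v = below v (Suc (2 * m))"
    and "v < n \<Longrightarrow> snd s ''deg'' v = degr v"
  using assms unfolding graph_data_def by blast+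

lemma graph_data_unchanged:
  assumes "graph_data s" "unchanged c s s'"
    and "written_vars c \<inter> {''n'', ''m'', ''mm'', ''L''} = {}"
    and "written_arrays c \<inter> {''own'', ''opp'', ''next'', ''head'', ''deg''} = {}"
  shows "graph_data s'"
proof -
  have "\<forall>x\<in>{''n'', ''m'', ''mm'', ''L''}. fst s' x = fst s x"
    by (intro ballI unchanged_var[OF assms(2)]) (use assms(3) in \<open>simp only: disjoint_iff, blast\<close>)
  moreover have "\<forall>x\<in>{''own'', ''opp'', ''next'', ''head'', ''deg''}. snd s' x = snd s x"
    by (intro ballI unchanged_array[OF assms(2)]) (use assms(4) in \<open>simp only: disjoint_iff, blast\<close>)
  ultimately show ?thesis
    using assms(1) by (simp add: graph_data_def)
qed

lemma below_le: "below v (Suc (2 * m)) \<le> 2 * m"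
  using below_cases[of v "Suc (2 * m)"] by auto

lemma below_le_half: "h \<le> 2 * m \<Longrightarrow> below v h \<le> 2 * m"
  using below_cases[of v h] by auto

lemma square_bound: "a \<le> k * (n + m + 2) \<Longrightarrow> b \<le> n + m + 2 \<Longrightarrow> a * b \<le> k * ((n + m + 2) * (n + m + 2))"
  using mult_le_mono[of a "k * (n + m + 2)" b "n + m + 2"] by (simp only: mult.assoc)

lemma indeg_less_W: "indeg inc v + 1 < W"
  using indeg_le_degr[of inc v] degr_le[of v] by (intro small_W) simp

subsection \<open>Execution of push-relabel\<close>

definition push_state :: "state \<Rightarrow> bool" where
  "push_state s \<longleftrightarrow> push_inv (snd s ''cap'') L (snd s ''inc'') (snd s ''d'') (snd s ''cur'')
     (snd s ''ind'') (snd s ''stk'') (fst s ''sp'')"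

definition push_state_pot :: "state \<Rightarrow> nat" where
  "push_state_pot s = push_pot L (snd s ''d'') (snd s ''cur'') (fst s ''sp'')"

lemma push_step:
  assumes data: "graph_data s" and inv: "push_state s" and sp: "0 < fst s ''sp''"
    and small: "push_state_pot s + 1 < W" and cap: "\<And>v. v < n \<Longrightarrow> snd s ''cap'' v < W"
  shows "wp W push_step (\<lambda>s'. push_state s' \<and> push_state_pot s' < push_state_pot s) s"
proof -
  obtain f g where s: "s = (f, g)"
    by (cases s)
  define v where "v = g ''stk'' (f ''sp'' - 1)"
  obtain i where i: "f ''sp'' = Suc i"
    using sp s by (cases "f ''sp''") auto
  note pinv = inv[unfolded push_state_def s fst_conv snd_conv]
  have v: "v < n" and v_top: "g ''stk'' i = v"
    using push_invD(8)[OF pinv, of i] i by (auto simp: v_def)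
  have vW: "v < W" "n < W" "Suc 0 < W" "L < W" "0 < W" "Suc (Suc i) < W" "Suc i < W" "i < W"
    using v L_le small i by (auto intro!: small_W simp: s push_state_pot_def push_pot_def)
  have ind: "g ''ind'' w < W" "Suc (g ''ind'' w) < W" if "w < n" for w
    using push_invD(2)[OF pinv that] indeg_less_W[of "g ''inc''" w] by simp_all
  have d: "g ''d'' w \<le> L" "g ''d'' w < W" "Suc (g ''d'' w) < W" if "w < n" for w
    using push_invD(5)[OF pinv that] L_le by (auto intro!: small_W)
  have capW: "g ''cap'' w < W" if "w < n" for w
    using cap[OF that] s by simp
  note data' = graph_dataD[OF data, unfolded s fst_conv snd_conv]
  note simps = push_step_def push_state_def push_state_pot_def s i v_top data' ind[OF v] d[OF v] capW[OF v] vW v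
  show ?thesis
  proof (cases "g ''ind'' v \<le> g ''cap'' v \<or> L \<le> g ''d'' v")
    case True
    then have "push_inv (g ''cap'') L (g ''inc'') (g ''d'') (g ''cur'') (g ''ind'') (g ''stk'') i"
      using push_inv_pop[of _ _ _ _ _ _ _ i] pinv i v_top by simp
    then show ?thesis
      using True
      by (cases "g ''ind'' v \<le> g ''cap'' v") (simp_all add: simps push_pot_def split del: if_split)
  next
    case False
    then have active: "g ''cap'' v < g ''ind'' v" "g ''d'' v < L" "\<not> g ''ind'' v \<le> g ''cap'' v"
      "\<not> L \<le> g ''d'' v"
      by auto
    define h where "h = g ''cur'' v"
    show ?thesis
    proof (cases "h = 0")
      case True
      then have "below v (Suc (2 * m)) < W"
        using below_le[of v] by (intro small_W) simp
      then show ?thesis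
        using push_inv_relabel[OF pinv v active(1,2)] True active
        by (simp add: simps h_def split del: if_split)
    next
      case False
      then have h: "is_half h" "own h = v"
        using push_invD(3)[OF pinv] v by (auto simp: list_pos_def h_def)
      have u: "other h < n" "other h \<noteq> v"
        using h other_less own_opp[of h] by auto
      have hW: "h < W" "below v h < W" "opp h < W" "other h < W"
        using h below_le_half[of h v] opp_half[OF h(1)] u by (auto intro!: small_W)
      have inc: "g ''inc'' h \<le> 1" "g ''inc'' h < W"
        using orientD[OF push_invD(1)[OF pinv] h(1)] vW by auto
      have pot: "push_pot L (g ''d'') ((g ''cur'')(v := below v h)) (f ''sp'') + 2 =
          push_pot L (g ''d'') (g ''cur'') (f ''sp'')"
        using push_pot_advance[OF v _ _ h(2)] h h_def by simp
      have pot': "push_pot L (g ''d'') c (Suc k) = Suc (push_pot L (g ''d'') c k)" for c k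
        by (simp add: push_pot_def)
      note simps' = simps h \<open>h \<noteq> 0\<close> hW inc u data'(5-7)[OF h(1)] data'(5)[OF opp_half[OF h(1)]] ind[OF u(1)] d[OF u(1)]
      show ?thesis
      proof (cases "g ''inc'' h = 1 \<and> g ''d'' v = Suc (g ''d'' (other h))")
        case True
        have "v \<in> g ''stk'' ` {..<f ''sp''}"
          using i v_top by (intro image_eqI[of _ _ i]) auto
        then have "push_inv (g ''cap'') L ((g ''inc'')(h := 0, opp h := 1)) (g ''d'')
            ((g ''cur'')(v := below v h))
            ((g ''ind'')(v := g ''ind'' v - 1, other h := Suc (g ''ind'' (other h))))
            ((g ''stk'')(Suc i := other h)) (Suc (Suc i))"
          using push_inv_push[OF pinv v h_def[symmetric]] True active h i by simp
        then show ?thesis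
          using True active pot i
          by (simp add: simps' pot' less_imp_diff_less flip: h_def split del: if_split)
      next
        case False
        then have "push_inv (g ''cap'') L (g ''inc'') (g ''d'') ((g ''cur'')(v := below v h))
            (g ''ind'') (g ''stk'') (Suc i)"
          using push_inv_skip[OF pinv v h_def[symmetric]] h i by auto
        then show ?thesis
          using False active pot i
          by (cases "g ''inc'' h = 1") (simp_all add: simps' flip: h_def split del: if_split)
      qed
    qed
  qed
qed


lemma stack_loop:
  assumes step: "\<And>s. graph_data s \<Longrightarrow> J s \<Longrightarrow> 0 < fst s ''sp'' \<Longrightarrow> pot s + 1 < W \<Longrightarrow>
      (\<And>v. v < n \<Longrightarrow> snd s ''cap'' v < W) \<Longrightarrow> wp W c (\<lambda>s'. J s' \<and> pot s' < pot s) s"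
    and fresh: "written_vars c \<inter> {''n'', ''m'', ''mm'', ''L''} = {}"
      "written_arrays c \<inter> {''own'', ''opp'', ''next'', ''head'', ''deg''} = {}" "''cap'' \<notin> written_arrays c"
    and cost: "cost c < 40"
    and data: "graph_data s" and start: "J s" and small: "pot s + 1 < W"
    and cap: "\<And>v. v < n \<Longrightarrow> snd s ''cap'' v < W" and T: "pot s * 40 + 1 \<le> T"
  shows "tri W (While (Less (Const 0) (Var ''sp'')) c) s T (\<lambda>s'. J s' \<and> fst s' ''sp'' = 0)"
proof -
  have "tri W (While (Less (Const 0) (Var ''sp'')) c) s T
    (\<lambda>s'. (J s' \<and> pot s' \<le> pot s) \<and> \<not> tval (Less (Const 0) (Var ''sp'')) s')"
  proof (rule tri_While_potential[where \<Phi> = pot])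
    fix s' assume I: "J s' \<and> pot s' \<le> pot s"
      and u: "unchanged c s s'" and b: "tval (Less (Const 0) (Var ''sp'')) s'"
    have cap': "snd s' ''cap'' v < W" if "v < n" for v
      using unchanged_array[OF u fresh(3)] cap[OF that] by simp
    have "wp W c (\<lambda>s''. J s'' \<and> pot s'' < pot s') s'"
      by (rule step[OF graph_data_unchanged[OF data u fresh(1,2)] _ _ _ cap']) (use I b small in simp_all)
    then show "wp W c (\<lambda>s''. (J s'' \<and> pot s'' \<le> pot s) \<and> pot s'' < pot s') s'"
      by (rule wp_mono) (use I in linarith)
  next
    have "pot s * (cost c + 1) \<le> pot s * 40"
      using cost by (intro mult_le_mono2) simp
    then show "pot s * (cost c + 1) + 1 \<le> T"
      using T by linarith
  qed (use start in simp)
  then show ?thesis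
    by (rule tri_mono) simp_all
qed

lemma push_loop:
  assumes "graph_data s" "push_state s" "push_state_pot s + 1 < W" "\<And>v. v < n \<Longrightarrow> snd s ''cap'' v < W"
    and "push_state_pot s * 40 + 1 \<le> T"
  shows "tri W (While (Less (Const 0) (Var ''sp'')) push_step) s T
    (\<lambda>s'. push_state s' \<and> fst s' ''sp'' = 0)"
  by (rule stack_loop[OF push_step _ _ _ _ assms]) (simp_all add: push_step_def)

subsection \<open>Execution of augmentations\<close>

definition flow_state :: "state \<Rightarrow> bool" where
  "flow_state s \<longleftrightarrow> orient (snd s ''inc'') \<and> (\<forall>v<n. snd s ''ind'' v = indeg (snd s ''inc'') v)"

definition state_excess :: "state \<Rightarrow> nat" where
  "state_excess s = excess (snd s ''cap'') (indeg (snd s ''inc''))"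

definition search_state :: "state \<Rightarrow> bool" where
  "search_state s \<longleftrightarrow> search_inv (snd s ''cap'') (snd s ''ind'') (snd s ''inc'') (snd s ''vis'')
     (snd s ''par'') (snd s ''cur'') (snd s ''stk'') (fst s ''sp'') (fst s ''f'') \<and>
     (0 < fst s ''sp'' \<longrightarrow> fst s ''f'' = 0)"

definition search_state_pot :: "state \<Rightarrow> nat" where
  "search_state_pot s = search_pot (snd s ''vis'') (snd s ''cur'') (fst s ''sp'')"

lemma search_step:
  assumes data: "graph_data s" and inv: "search_state s" and sp: "0 < fst s ''sp''"
    and small: "search_state_pot s + 1 < W" and cap: "\<And>v. v < n \<Longrightarrow> snd s ''cap'' v < W"
  shows "wp W search_step (\<lambda>s'. search_state s' \<and> search_state_pot s' < search_state_pot s) s"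
proof -
  obtain f g where s: "s = (f, g)"
    by (cases s)
  obtain i where i: "f ''sp'' = Suc i"
    using sp s by (cases "f ''sp''") auto
  have f0: "f ''f'' = 0"
    using inv sp s by (simp add: search_state_def)
  have sinv: "search_inv (g ''cap'') (g ''ind'') (g ''inc'') (g ''vis'') (g ''par'') (g ''cur'') (g ''stk'')
      (Suc i) 0"
    using inv i f0 by (simp add: search_state_def s)
  define v where "v = g ''stk'' i"
  have v: "v < n" "0 < g ''vis'' v"
    using search_invD(7)[OF sinv, of i] by (auto simp: v_def)
  have vW: "v < W" "n < W" "Suc 0 < W" "0 < W" "Suc (Suc i) < W" "Suc i < W" "i < W"
    using v small i by (auto intro!: small_W simp: s search_state_pot_def search_pot_def)
  have ind: "g ''ind'' w < W" "Suc (g ''ind'' w) < W" if "w < n" for w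
    using search_invD(2)[OF sinv that] indeg_less_W[of "g ''inc''" w] by simp_all
  have vis: "g ''vis'' w < W" "Suc (g ''vis'' w) < W" if "w < n" for w
  proof -
    have "card {w. w < n \<and> 0 < g ''vis'' w} \<le> card {..<n}"
      by (rule card_mono) auto
    then have "g ''vis'' w \<le> n"
      using search_invD(6)[OF sinv that] by simp
    then show "g ''vis'' w < W" "Suc (g ''vis'' w) < W"
      by (auto intro!: small_W)
  qed
  have capW: "g ''cap'' w < W" if "w < n" for w
    using cap[OF that] s by simp
  note data' = graph_dataD[OF data, unfolded s fst_conv snd_conv]
  note simps = search_step_def search_state_def search_state_pot_def s i v_def[symmetric] f0 data'
    ind[OF v(1)] vis[OF v(1)] capW[OF v(1)] vW v
  define h where "h = g ''cur'' v"
  have top: "v \<in> g ''stk'' ` {..<Suc i}"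
    by (auto simp: v_def)
  show ?thesis
  proof (cases "h = 0")
    case True
    then have "search_inv (g ''cap'') (g ''ind'') (g ''inc'') (g ''vis'') (g ''par'') (g ''cur'') (g ''stk'') i 0"
      using search_inv_pop[OF sinv] by (simp add: h_def v_def)
    then show ?thesis
      using True by (simp add: simps h_def search_pot_def split del: if_split)
  next
    case False
    then have h: "is_half h" "own h = v"
      using search_invD(3)[OF sinv] v by (auto simp: list_pos_def h_def)
    have u: "other h < n" "other h \<noteq> v"
      using h other_less own_opp[of h] by auto
    have hW: "h < W" "below v h < W" "opp h < W" "other h < W" "Suc (other h) < W"
      using h below_le_half[of h v] opp_half[OF h(1)] u by (auto intro!: small_W)
    have inc: "g ''inc'' h \<le> 1" "g ''inc'' h < W"
      using orientD[OF search_invD(1)[OF sinv] h(1)] vW by auto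
    have pot: "Suc (search_pot w ((g ''cur'')(v := below v h)) k) = search_pot w (g ''cur'') k" for w k
      using search_pot_advance[OF v(1) _ _ h(2)] h h_def by simp
    note simps' = simps h \<open>h \<noteq> 0\<close> hW inc u data'(5-7)[OF h(1)] data'(5)[OF opp_half[OF h(1)]] ind[OF u(1)]
      vis[OF u(1)] capW[OF u(1)]
    show ?thesis
    proof (cases "g ''inc'' h = 1 \<and> g ''vis'' (other h) = 0")
      case True
      note visit = search_inv_visit[OF sinv v(1) h_def[symmetric] h(1)[THEN conjunct1]
          True[THEN conjunct1] True[THEN conjunct2] v(2) top]
      show ?thesis
      proof (cases "g ''cap'' (other h) \<le> g ''ind'' (other h)")
        case le: True
        have "search_pot ((g ''vis'')(other h := Suc (g ''vis'' v))) ((g ''cur'')(v := below v h)) (Suc (Suc i)) <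
            search_pot (g ''vis'') (g ''cur'') (Suc i)"
          using visit(3) pot[of "g ''vis''" "Suc i"] by (simp add: search_pot_def)
        then show ?thesis
          using True visit(1)[OF le] le
          by (simp add: simps' flip: h_def split del: if_split)
      next
        case less: False
        then have less': "g ''ind'' (other h) < g ''cap'' (other h)"
          by simp
        have "search_pot ((g ''vis'')(other h := Suc (g ''vis'' v))) ((g ''cur'')(v := below v h)) 0 <
            search_pot (g ''vis'') (g ''cur'') (Suc i)"
          using visit(3) pot[of "g ''vis''" "Suc i"] by (simp add: search_pot_def)
        then show ?thesis
          using True visit(2)[OF less'] less'
          by (simp add: simps' flip: h_def split del: if_split)
      qed
    next
      case False
      then have "search_inv (g ''cap'') (g ''ind'') (g ''inc'') (g ''vis'') (g ''par'')
          ((g ''cur'')(v := below v h)) (g ''stk'') (Suc i) 0"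
        by (intro search_inv_skip[OF sinv v(1) h_def[symmetric] _ _ top]) (use h in auto)
      then show ?thesis
        using False pot[of "g ''vis''" "Suc i"]
        by (cases "g ''inc'' h = 1") (simp_all add: simps' flip: h_def split del: if_split)
    qed
  qed
qed

lemma search_loop:
  assumes "graph_data s" "search_state s" "search_state_pot s + 1 < W" "\<And>v. v < n \<Longrightarrow> snd s ''cap'' v < W"
    and "search_state_pot s * 40 + 1 \<le> T"
  shows "tri W (While (Less (Const 0) (Var ''sp'')) search_step) s T
    (\<lambda>s'. search_state s' \<and> fst s' ''sp'' = 0)"
  by (rule stack_loop[OF search_step _ _ _ _ assms]) (simp_all add: search_step_def)

definition init_inv :: "nat \<Rightarrow> state \<Rightarrow> bool" where
  "init_inv k s \<longleftrightarrow> fst s ''sp'' \<le> k \<and>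
     (\<forall>v<k. snd s ''cur'' v = below v (Suc (2 * m)) \<and>
        snd s ''vis'' v = (if snd s ''cap'' v < snd s ''ind'' v then 1 else 0) \<and>
        (snd s ''cap'' v < snd s ''ind'' v \<longrightarrow>
           snd s ''par'' v = 0 \<and> v \<in> snd s ''stk'' ` {..<fst s ''sp''})) \<and>
     (\<forall>i<fst s ''sp''. snd s ''stk'' i < k \<and>
        snd s ''cap'' (snd s ''stk'' i) < snd s ''ind'' (snd s ''stk'' i))"

lemma search_init:
  assumes data: "graph_data s" and flow: "flow_state s"
    and cap: "\<And>v. v < n \<Longrightarrow> snd s ''cap'' v < W"
  shows "tri W search_init s (15 * n + 5) (init_inv n)"
  unfolding search_init_def
proof (rule tri_Seq[of _ _ _ 1 _ _ "15 * n + 4"])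
  show "tri W (Copy ''sp'' (Const 0)) s 1 (\<lambda>s'. fst s' ''sp'' = 0)"
    using small_W[of 0] by (intro tri_straight) simp_all
  fix s1 assume sp: "fst s1 ''sp'' = 0" and u1: "unchanged (Copy ''sp'' (Const 0)) s s1"
  have data1: "graph_data s1"
    by (rule graph_data_unchanged[OF data u1]) simp_all
  show "tri W (For ''i'' ''n'' root_step) s1 (15 * n + 4) (init_inv n)"
  proof (rule tri_For_straight[where I = init_inv])
    show "init_inv 0 (set_var ''i'' 0 s1)"
      using sp by (simp add: init_inv_def)
    show "fst s1 ''n'' = n"
      using data1 by (simp add: graph_data_def)
    fix k s' assume k: "k < n" and I: "init_inv k s'" and u: "unchanged (For ''i'' ''n'' root_step) s1 s'"
      and ki: "fst s' ''i'' = k"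
    have data': "graph_data s'"
      by (rule graph_data_unchanged[OF data1 u]) (simp_all add: root_step_def)
    obtain f g where s': "s' = (f, g)"
      by (cases s')
    have arr: "g ''ind'' = snd s ''ind''" "g ''cap'' = snd s ''cap''"
      using unchanged_array[OF u, of "''ind''"] unchanged_array[OF u1, of "''ind''"]
        unchanged_array[OF u, of "''cap''"] unchanged_array[OF u1, of "''cap''"] by (simp_all add: s' root_step_def)
    have bounds: "g ''ind'' k < W" "g ''cap'' k < W" "k < W" "below k (Suc (2 * m)) < W" "Suc 0 < W" "0 < W"
      "f ''sp'' < W" "Suc (f ''sp'') < W"
    proof -
      show "g ''ind'' k < W"
        using arr flow k indeg_less_W[of "snd s ''inc''" k] by (simp add: flow_state_def)
      show "g ''cap'' k < W"
        using arr cap[OF k] by simp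
      show "below k (Suc (2 * m)) < W"
        using below_le[of k] by (intro small_W) simp
      show "f ''sp'' < W" "Suc (f ''sp'') < W"
        using I k by (auto intro!: small_W simp: s' init_inv_def)
    qed (use k in \<open>auto intro!: small_W\<close>)
    note head = graph_dataD(8)[OF data' k, unfolded s' snd_conv]
    have i: "f ''i'' = k"
      using ki s' by simp
    have I': "init_inv k (f, g)"
      using I s' by simp
    have stk: "x \<in> g ''stk'' ` {..<f ''sp''} \<Longrightarrow> x \<in> (g ''stk'')(f ''sp'' := k) ` {..<Suc (f ''sp'')}" for x
      by (auto simp: image_iff less_Suc_eq)
    show "wp W root_step (\<lambda>s''. init_inv (Suc k) (set_var ''i'' (Suc k) s'')) s'"
    proof (cases "g ''cap'' k < g ''ind'' k")
      case True
      have "init_inv (Suc k) ((f(''x'' := g ''ind'' k, ''y'' := g ''cap'' k, ''h'' := below k (Suc (2 * m)), ''sp'' := Suc (f ''sp''), ''i'' := Suc k)),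
        g(''cur'' := (g ''cur'')(k := below k (Suc (2 * m))), ''vis'' := (g ''vis'')(k := Suc 0), ''par'' := (g ''par'')(k := 0),
          ''stk'' := (g ''stk'')(f ''sp'' := k)))"
        using I' True stk unfolding init_inv_def by (auto simp: less_Suc_eq)
      then show ?thesis
        using True by (simp add: root_step_def s' bounds head i set_var_def set_cell_def split del: if_split)
    next
      case False
      have "init_inv (Suc k) ((f(''x'' := g ''ind'' k, ''y'' := g ''cap'' k, ''h'' := below k (Suc (2 * m)), ''i'' := Suc k)),
        g(''cur'' := (g ''cur'')(k := below k (Suc (2 * m))), ''vis'' := (g ''vis'')(k := 0)))"
        using I' False unfolding init_inv_def by (auto simp: less_Suc_eq)
      then show ?thesis
        using False by (simp add: root_step_def s' bounds head i set_var_def set_cell_def split del: if_split)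
    qed
  qed (use small_W[of n] in \<open>auto simp: root_step_def\<close>)
qed simp


lemma augment:
  assumes data: "graph_data s" and inv: "search_state s" and f: "0 < fst s ''f''"
    and cap: "\<And>v. v < n \<Longrightarrow> snd s ''cap'' v < W"
  shows "tri W augment s (6 * n + 20) (\<lambda>s'. flow_state s' \<and> state_excess s' < state_excess s)"
proof -
  obtain t where t: "fst s ''f'' = Suc t"
    using f by (cases "fst s ''f''") auto
  let ?cap = "snd s ''cap''" and ?ind = "snd s ''ind''" and ?vis = "snd s ''vis''" and ?par = "snd s ''par''"
  let ?ind' = "?ind(t := Suc (?ind t))"
  have sinv: "search_inv ?cap ?ind (snd s ''inc'') ?vis ?par (snd s ''cur'') (snd s ''stk'')
      (fst s ''sp'') (Suc t)"
    using inv unfolding search_state_def t by blast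
  have tn: "t < n" "0 < ?vis t" "?ind t < ?cap t"
    using search_invD(10)[OF sinv] by auto
  have par_le: "?par v < W" if "v < n" "0 < ?vis v" for v
    using search_invD(5)[OF sinv that] by (auto simp: parent_ok_def intro!: small_W)
  have vis_le: "?vis v \<le> n" if "v < n" for v
  proof -
    have "card {w. w < n \<and> 0 < ?vis w} \<le> card {..<n}"
      by (rule card_mono) auto
    then show ?thesis
      using search_invD(6)[OF sinv that] by simp
  qed
  have ind_W: "?ind v < W" "Suc (?ind v) < W" if "v < n" for v
    using search_invD(2)[OF sinv that] indeg_less_W[of "snd s ''inc''" v] by simp_all
  have tW: "Suc t < W" "t < W" "Suc 0 < W" "0 < W"
    using tn by (auto intro!: small_W)
  let ?J = "\<lambda>s'. augment_inv ?cap ?ind (snd s' ''inc'') ?ind' ?vis ?par (fst s' ''w'') \<and>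
      fst s' ''h'' = ?par (fst s' ''w'') \<and> graph_data s' \<and> snd s' ''ind'' = ?ind' \<and>
      snd s' ''vis'' = ?vis \<and> snd s' ''par'' = ?par \<and> snd s' ''cap'' = ?cap"
  define loop where "loop = While (NotEqual (Var ''h'') (Const 0)) flip_step"
  let ?Q = "\<lambda>s'. flow_state s' \<and> state_excess s' < state_excess s"
  have first: "tri W augment_start s 5 ?J"
  proof (rule tri_straight)
    have "graph_data (set_var ''h'' (?par t) (set_cell ''ind'' t (Suc (?ind t)) (set_var ''x'' (Suc (?ind t))
        (set_var ''x'' (?ind t) (set_var ''w'' t s)))))"
      using data by (simp add: graph_data_def)
    then show "wp W augment_start ?J s"
      using augment_inv_init[OF sinv] t tn tW ind_W[OF tn(1)] par_le[OF tn(1,2)]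
      by (simp add: augment_start_def)
  qed (simp add: augment_start_def)
  have loop: "tri W loop s1 (6 * n + 1) (\<lambda>s'. ?J s' \<and> fst s' ''h'' = 0)" if J: "?J s1" for s1
  proof -
    have "tri W (While (NotEqual (Var ''h'') (Const 0)) flip_step) s1 (6 * n + 1)
        (\<lambda>s'. ?J s' \<and> \<not> tval (NotEqual (Var ''h'') (Const 0)) s')"
    proof (rule tri_While_potential[where \<Phi> = "\<lambda>s'. ?vis (fst s' ''w'')"])
      show "?J s1"
        by (rule J)
      have "?vis (fst s1 ''w'') \<le> n"
        using J vis_le by (simp add: augment_inv_def)
      then show "?vis (fst s1 ''w'') * (cost flip_step + 1) + 1 \<le> 6 * n + 1"
        by (simp add: flip_step_def)
      fix s' assume J': "?J s'" and b: "tval (NotEqual (Var ''h'') (Const 0)) s'"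
      obtain fs gs where s': "s' = (fs, gs)"
        by (cases s')
      define h where "h = fs ''h''"
      have h: "?par (fs ''w'') = h" "0 < h"
        using J' b by (simp_all add: h_def s')
      have ainv: "augment_inv ?cap ?ind (gs ''inc'') ?ind' ?vis ?par (fs ''w'')"
        using J' by (simp add: s')
      note step = augment_inv_step[OF ainv h]
      have hW: "h < W" "opp h < W" "own h < W" "own h < n"
        using step(2) opp_half[of h] own_less[of h] by (auto intro!: small_W)
      have pW: "?par (own h) < W"
        by (rule par_le) (use step(1) in \<open>simp_all add: augment_inv_def\<close>)
      have data': "graph_data (fs, gs)"
        using J' s' by simp
      note graph = graph_dataD(5,6)[OF data' step(2), unfolded snd_conv]
      have arr: "gs ''ind'' = ?ind'" "gs ''vis'' = ?vis" "gs ''par'' = ?par" "gs ''cap'' = ?cap"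
        using J' by (simp_all add: s')
      have "graph_data (set_var ''h'' (?par (own h)) (set_var ''w'' (own h) (set_cell ''inc'' (opp h) (Suc 0)
          (set_var ''g'' (opp h) (set_cell ''inc'' h 0 (fs, gs))))))"
        using data' by (simp add: graph_data_def)
      then show "wp W flip_step (\<lambda>s''. ?J s'' \<and> ?vis (fst s'' ''w'') < ?vis (fst s' ''w'')) s'"
        using step hW pW tW graph arr by (simp add: flip_step_def s' flip: h_def)
    qed
    then show ?thesis
      unfolding loop_def by (rule tri_mono) simp_all
  qed
  have final: "tri W augment_end s2 3 ?Q" if J: "?J s2 \<and> fst s2 ''h'' = 0" for s2
  proof (rule tri_straight)
    let ?w = "fst s2 ''w''"
    have ainv: "augment_inv ?cap ?ind (snd s2 ''inc'') ?ind' ?vis ?par ?w" and w: "?par ?w = 0" "?w < n"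
      using J by (simp_all add: augment_inv_def)
    note fin = augment_inv_final[OF ainv w(1) tn(3,1)]
    have "?w \<noteq> t"
      using ainv w tn by (auto simp: augment_inv_def parent_ok_def)
    moreover have "?w < W" "?ind ?w < W" "?ind ?w - 1 < W"
      using w ind_W[OF w(2)] by (auto intro!: small_W)
    moreover have "orient (snd s2 ''inc'')"
      using ainv by (simp add: augment_inv_def)
    moreover have "excess ?cap ?ind = state_excess s"
      using search_invD(2)[OF sinv] by (simp add: state_excess_def excess_def)
    ultimately show "wp W augment_end ?Q s2"
      using fin J by (simp add: augment_end_def flow_state_def state_excess_def)
  qed (simp add: augment_end_def)
  show ?thesis
    unfolding augment_def loop_def[symmetric]
  proof (rule tri_Seq[OF first])
    show "tri W (loop ;; augment_end) s1 (6 * n + 5) ?Q" if "?J s1" for s1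
      by (rule tri_Seq[OF loop[OF that]], rule final) simp_all
  qed simp
qed

definition flow_data :: "(nat \<Rightarrow> nat) \<Rightarrow> state \<Rightarrow> bool" where
  "flow_data cap s \<longleftrightarrow> graph_data s \<and> flow_state s \<and> snd s ''cap'' = cap \<and> (\<forall>v<n. cap v < W)"

text \<open>A search that fails proves the capacities infeasible unless there is no surplus. So, for feasible
  capacities, each round decreases a positive surplus; truncated subtraction covers surplus 0.\<close>

lemma augment_once:
  assumes flow: "flow_data cap s"
  shows "tri W augment_once s (200 * (n + 2 * m + 1)) (\<lambda>s'. flow_data cap s' \<and>
    (feasible cap \<longrightarrow> state_excess s' \<le> state_excess s - 1))"
proof -
  let ?S = "n + 2 * m + 1"
  have data: "graph_data s" and capW: "\<And>v. v < n \<Longrightarrow> snd s ''cap'' v < W" and fs: "flow_state s"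
    using flow by (simp_all add: flow_data_def)
  let ?Q = "\<lambda>s'. flow_data cap s' \<and> (feasible cap \<longrightarrow> state_excess s' \<le> state_excess s - 1)"
  have Q: "?Q s'" if "unchanged augment_once s s'" "flow_state s'"
    "feasible cap \<longrightarrow> state_excess s' \<le> state_excess s - 1" for s'
  proof -
    have "written_vars augment_once \<inter> {''n'', ''m'', ''mm'', ''L''} = {}"
      "written_arrays augment_once \<inter> {''own'', ''opp'', ''next'', ''head'', ''deg'', ''cap''} = {}"
      by (simp_all add: augment_once_def search_init_def root_step_def search_step_def augment_def
        augment_start_def augment_end_def flip_step_def)
    then show ?thesis
      using that flow graph_data_unchanged[OF data that(1)] unchanged_array[OF that(1), of "''cap''"]
      by (auto simp: flow_data_def)
  qed
  let ?R = "\<lambda>s'. flow_state s' \<and> (feasible cap \<longrightarrow> state_excess s' \<le> state_excess s - 1)"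
  let ?loop = "While (Less (Const 0) (Var ''sp'')) search_step"
  let ?branch = "Cond (Less (Const 0) (Var ''f'')) augment Skip"
  let ?I1 = "\<lambda>s'. init_inv n s' \<and> unchanged search_init s s'"
  have init: "tri W search_init s (15 * n + 5) ?I1"
    using search_init[OF data fs capW] by (rule tri_mono) simp_all
  have "tri W augment_once s (200 * ?S) ?R"
    unfolding augment_once_def
  proof (rule tri_Seq[OF init])
    fix s1 assume s1: "?I1 s1"
    let ?c1 = "set_var ''f'' 0 s1"
    have arr: "snd s1 ''cap'' = cap" "snd s1 ''ind'' = snd s ''ind''" "snd s1 ''inc'' = snd s ''inc''"
      using s1 unchanged_array[of search_init s s1] flow
      by (simp_all add: search_init_def root_step_def flow_data_def)
    have data1: "graph_data s1"
      by (rule graph_data_unchanged[OF data, of search_init])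
        (use s1 in \<open>simp_all add: search_init_def root_step_def\<close>)
    have ind: "snd s ''ind'' v = indeg (snd s ''inc'') v" if "v < n" for v
      using fs that by (simp add: flow_state_def)
    have roots: "snd s1 ''stk'' i < n \<and> cap (snd s1 ''stk'' i) < snd s ''ind'' (snd s1 ''stk'' i)"
      if "i < fst s1 ''sp''" for i
      using s1 arr that by (simp add: init_inv_def)
    note I1 = s1[THEN conjunct1, unfolded init_inv_def arr]
    have sinit: "search_inv cap (snd s ''ind'') (snd s ''inc'') (snd s1 ''vis'') (snd s1 ''par'')
        (snd s1 ''cur'') (snd s1 ''stk'') (fst s1 ''sp'') 0"
      "search_pot (snd s1 ''vis'') (snd s1 ''cur'') (fst s1 ''sp'') \<le> 2 * m + 3 * n"
    proof -
      have o: "orient (snd s ''inc'')"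
        using fs by (simp add: flow_state_def)
      have *: "\<And>v. v < n \<Longrightarrow> snd s1 ''cur'' v = below v (Suc (2 * m))"
        "\<And>v. v < n \<Longrightarrow> snd s1 ''vis'' v = (if cap v < snd s ''ind'' v then 1 else 0)"
        "\<And>v. v < n \<Longrightarrow> cap v < snd s ''ind'' v \<Longrightarrow>
          snd s1 ''par'' v = 0 \<and> v \<in> snd s1 ''stk'' ` {..<fst s1 ''sp''}"
        "fst s1 ''sp'' \<le> n"
        using I1 by blast+
      have **: "snd s1 ''stk'' i < n \<and> 0 < snd s1 ''vis'' (snd s1 ''stk'' i)" if "i < fst s1 ''sp''" for i
        using roots[OF that] *(2) by simp
      show "search_inv cap (snd s ''ind'') (snd s ''inc'') (snd s1 ''vis'') (snd s1 ''par'')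
        (snd s1 ''cur'') (snd s1 ''stk'') (fst s1 ''sp'') 0"
        by (rule search_inv_init(1)[OF o ind *(1-3) ** *(4)])
      show "search_pot (snd s1 ''vis'') (snd s1 ''cur'') (fst s1 ''sp'') \<le> 2 * m + 3 * n"
        by (rule search_inv_init(2)[OF o ind *(1-3) ** *(4)])
    qed
    have data2: "graph_data ?c1"
      using data1 by (simp add: graph_data_def)
    have sinv: "search_state ?c1"
      using sinit arr by (simp add: search_state_def)
    have pot: "search_state_pot ?c1 \<le> 2 * m + 3 * n"
      using sinit by (simp add: search_state_pot_def)
    then have small: "search_state_pot ?c1 + 1 < W"
      by (intro small_W) simp
    have loop: "tri W ?loop ?c1 (120 * ?S + 1) (\<lambda>s'. search_state s' \<and> fst s' ''sp'' = 0)"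
      by (rule search_loop[OF data2 sinv small]) (use pot arr flow in \<open>simp_all add: flow_data_def\<close>)
    have "tri W (?loop ;; ?branch) ?c1 (185 * ?S - 6) ?R"
    proof (rule tri_Seq[OF loop])
      fix s3 assume s3: "search_state s3 \<and> fst s3 ''sp'' = 0" and u: "unchanged ?loop ?c1 s3"
      have data3: "graph_data s3"
        by (rule graph_data_unchanged[OF data2 u]) (simp_all add: search_step_def)
      have arr3: "snd s3 ''cap'' = cap" "snd s3 ''ind'' = snd s ''ind''" "snd s3 ''inc'' = snd s ''inc''"
        using unchanged_array[OF u] arr by (simp_all add: search_step_def)
      have cap3: "snd s3 ''cap'' v < W" if "v < n" for v
        using arr3 flow that by (simp add: flow_data_def)
      have ex: "state_excess s3 = state_excess s"
        using arr3 flow by (simp add: state_excess_def flow_data_def)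
      show "tri W ?branch s3 (6 * n + 21) ?R"
      proof (rule tri_Cond)
        assume "tval (Less (Const 0) (Var ''f'')) s3"
        then have f: "0 < fst s3 ''f''"
          by simp
        show "tri W augment s3 (6 * n + 20) ?R"
          by (rule tri_mono[OF augment[OF data3 conjunct1[OF s3] f cap3]]) (use ex in auto)
      next
        assume "\<not> tval (Less (Const 0) (Var ''f'')) s3"
        then have "search_inv cap (snd s ''ind'') (snd s ''inc'') (snd s3 ''vis'') (snd s3 ''par'')
            (snd s3 ''cur'') (snd s3 ''stk'') 0 0"
          using s3 arr3 unfolding search_state_def by auto
        then have "feasible cap \<Longrightarrow> state_excess s = 0"
          using search_inv_fail flow by (simp add: state_excess_def flow_data_def)
        moreover have "flow_state s3"
          using arr3 fs by (simp add: flow_state_def)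
        ultimately show "tri W Skip s3 (6 * n + 20) ?R"
          using ex by (intro tri_straight) simp_all
      qed simp
    qed simp
    then show "tri W (Copy ''f'' (Const 0) ;; ?loop ;; ?branch) s1 (185 * ?S - 5) ?R"
      by (intro tri_Copy_Seq[where T = "185 * ?S - 6"]) (use small_W[of 0] in simp_all)
  qed simp
  then show ?thesis
    by (rule tri_mono) (use Q in simp_all)
qed


subsection \<open>Testing one capacity function\<close>

definition node_inv :: "(nat \<Rightarrow> nat) \<Rightarrow> nat \<Rightarrow> state \<Rightarrow> bool" where
  "node_inv cap k s \<longleftrightarrow> (\<forall>v<k. snd s ''cap'' v = cap v \<and> snd s ''d'' v = 0 \<and>
     snd s ''cur'' v = below v (Suc (2 * m)) \<and> snd s ''stk'' v = v \<and> snd s ''ind'' v = 0)"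

lemma node_loop:
  assumes data: "graph_data s" and a: "fst s ''a'' = a" and b: "fst s ''b'' = b" "b < W"
  shows "tri W (For ''i'' ''n'' node_step) s (12 * n + 2)
    (node_inv (\<lambda>v. if degr v \<le> a then degr v else b) n)"
proof (rule tri_For_straight)
  let ?cap = "\<lambda>v. if degr v \<le> a then degr v else b"
  fix k s' assume k: "k < n" and I: "node_inv ?cap k s'" and u: "unchanged (For ''i'' ''n'' node_step) s s'"
    and ki: "fst s' ''i'' = k"
  have data': "graph_data s'"
    by (rule graph_data_unchanged[OF data u]) (simp_all add: node_step_def)
  have ab: "fst s' ''a'' = a" "fst s' ''b'' = b"
    using unchanged_var[OF u] a b by (simp_all add: node_step_def)
  have bounds: "degr k < W" "k < W" "below k (Suc (2 * m)) < W" "0 < W"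
    using k degr_less[of k] below_le[of k] by (auto intro!: small_W)
  show "wp W node_step (\<lambda>s''. node_inv ?cap (Suc k) (set_var ''i'' (Suc k) s'')) s'"
    using I b(2) bounds
    by (simp add: node_step_def ab ki graph_dataD(8,9)[OF data' k] node_inv_def less_Suc_eq)
qed (use small_W[of n] data in \<open>auto simp: node_inv_def node_step_def graph_data_def\<close>)

definition count_inv :: "nat \<Rightarrow> state \<Rightarrow> bool" where
  "count_inv k s \<longleftrightarrow>
     (\<forall>v<n. snd s ''ind'' v = card {h. 0 < h \<and> h \<le> k \<and> own h = v \<and> snd s ''inc'' h = 1})"

lemma count_Suc:
  "card {h. 0 < h \<and> h \<le> Suc k \<and> own h = v \<and> inc h = (1::nat)} =
    card {h. 0 < h \<and> h \<le> k \<and> own h = v \<and> inc h = 1} + (if own (Suc k) = v \<and> inc (Suc k) = 1 then 1 else 0)"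
proof (cases "own (Suc k) = v \<and> inc (Suc k) = 1")
  case True
  have "finite {h. 0 < h \<and> h \<le> k \<and> own h = v \<and> inc h = 1}"
    by (rule finite_subset[of _ "{..k}"]) auto
  moreover have "{h. 0 < h \<and> h \<le> Suc k \<and> own h = v \<and> inc h = 1} =
      insert (Suc k) {h. 0 < h \<and> h \<le> k \<and> own h = v \<and> inc h = 1}"
    using True by (auto simp: le_Suc_eq)
  ultimately show ?thesis
    using True by simp
next
  case False
  then have "{h. 0 < h \<and> h \<le> Suc k \<and> own h = v \<and> inc h = 1} =
      {h. 0 < h \<and> h \<le> k \<and> own h = v \<and> inc h = 1}"
    by (auto simp: le_Suc_eq)
  then show ?thesis
    using False by auto
qed

lemma count_loop:
  assumes data: "graph_data s" and inc: "orient (snd s ''inc'')" and zero: "\<And>v. v < n \<Longrightarrow> snd s ''ind'' v = 0"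
  shows "tri W (For ''i'' ''mm'' count_step) s (24 * m + 2) (\<lambda>s'. flow_state s')"
proof -
  let ?I = "\<lambda>k s'. count_inv k s' \<and> snd s' ''inc'' = snd s ''inc''"
  have "tri W (For ''i'' ''mm'' count_step) s (24 * m + 2) (?I (2 * m))"
  proof (rule tri_For_straight[where I = ?I])
    fix k s' assume k: "k < 2 * m" and I: "?I k s'" and u: "unchanged (For ''i'' ''mm'' count_step) s s'"
      and ki: "fst s' ''i'' = k"
    have data': "graph_data s'"
      by (rule graph_data_unchanged[OF data u]) (simp_all add: count_step_def)
    have h: "is_half (Suc k)"
      using k by simp
    let ?v = "own (Suc k)" and ?inc = "snd s ''inc''"
    have inc': "?inc (Suc k) \<le> 1"
      using orientD[OF inc h] by simp
    have v: "?v < n"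
      using own_less[of "Suc k"] h by simp
    have cnt: "snd s' ''ind'' v = card {h. 0 < h \<and> h \<le> k \<and> own h = v \<and> ?inc h = 1}" if "v < n" for v
      using I that by (simp add: count_inv_def)
    have "card {h. 0 < h \<and> h \<le> k \<and> own h = ?v \<and> ?inc h = 1} \<le> card {..k}"
      by (rule card_mono) auto
    then have bounds: "Suc k < W" "?v < W" "snd s' ''ind'' ?v < W" "snd s' ''ind'' ?v + ?inc (Suc k) < W"
      "?inc (Suc k) < W"
      using k v inc' cnt[OF v] by (auto intro!: small_W)
    have step: "snd s' ''ind'' w + (if w = ?v then ?inc (Suc k) else 0) =
        card {h. 0 < h \<and> h \<le> Suc k \<and> own h = w \<and> ?inc h = 1}" if "w < n" for w
      using cnt[OF that] inc' unfolding count_Suc by (auto simp: le_Suc_eq)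
    have step': "((snd s' ''ind'')(?v := snd s' ''ind'' ?v + ?inc (Suc k))) w =
        card {h. 0 < h \<and> h \<le> Suc k \<and> own h = w \<and> ?inc h = 1}" if "w < n" for w
      using step[OF that] by (cases "w = ?v") simp_all
    show "wp W count_step (\<lambda>s''. ?I (Suc k) (set_var ''i'' (Suc k) s'')) s'"
      using I bounds step'
      by (simp add: count_step_def ki graph_dataD(5)[OF data' h] count_inv_def del: fun_upd_apply
          add: fun_upd_same fun_upd_other)
  qed (use small_W[of "2 * m"] data zero in \<open>auto simp: count_inv_def count_step_def graph_data_def\<close>)
  then show ?thesis
    by (rule tri_mono) (use inc in \<open>simp_all add: flow_state_def count_inv_def indeg_def conj_assoc\<close>)
qed

lemma check_loop:
  assumes flow: "flow_data cap s" and ok: "fst s ''ok'' = 1"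
  shows "tri W (For ''i'' ''n'' check_step) s (10 * n + 2) (\<lambda>s'. flow_data cap s' \<and>
    fst s' ''ok'' = (if \<forall>v<n. indeg (snd s' ''inc'') v \<le> cap v then 1 else 0))"
proof -
  have data: "graph_data s" and fs: "flow_state s"
    using flow by (simp_all add: flow_data_def)
  let ?I = "\<lambda>k s'. snd s' = snd s \<and> fst s' ''ok'' = (if \<forall>v<k. snd s ''ind'' v \<le> cap v then 1 else 0)"
  have "tri W (For ''i'' ''n'' check_step) s (10 * n + 2) (?I n)"
  proof (rule tri_For_straight[where I = ?I])
    fix k s' assume k: "k < n" and I: "?I k s'" and u: "unchanged (For ''i'' ''n'' check_step) s s'"
      and ki: "fst s' ''i'' = k"
    have bounds: "snd s ''ind'' k < W" "cap k < W" "k < W" "0 < W"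
      using k flow indeg_less_W[of "snd s ''inc''" k]
      by (auto simp: flow_data_def flow_state_def intro!: small_W)
    show "wp W check_step (\<lambda>s''. ?I (Suc k) (set_var ''i'' (Suc k) s'')) s'"
      using I bounds flow ki by (auto simp: check_step_def flow_data_def less_Suc_eq)
  qed (use small_W[of n] data ok in \<open>auto simp: check_step_def graph_data_def\<close>)
  then show ?thesis
  proof (rule tri_mono)
    fix s' assume u: "unchanged (For ''i'' ''n'' check_step) s s'" and I: "?I n s'"
    have "graph_data s'"
      by (rule graph_data_unchanged[OF data u]) (simp_all add: check_step_def)
    then show "flow_data cap s' \<and>
        fst s' ''ok'' = (if \<forall>v<n. indeg (snd s' ''inc'') v \<le> cap v then 1 else 0)"
      using I flow by (simp add: flow_data_def flow_state_def)
  qed simp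
qed

lemma feasible_cong: "(\<And>v. v < n \<Longrightarrow> cap v = cap' v) \<Longrightarrow> feasible cap \<longleftrightarrow> feasible cap'"
  by (simp add: feasible_def)

text \<open>If the capacities are feasible, the surplus is at most \<open>L\<close> after push-relabel and at most \<open>L - k\<close>
  after \<open>k\<close> rounds of augmentation. The two loops take times \<open>O((L + 1) * (n + m))\<close> each.\<close>

lemma probe:
  assumes data: "graph_data s" and inc: "orient (snd s ''inc'')"
    and ab: "fst s ''a'' = a" "fst s ''b'' = b" "b < W"
    and cap: "cap = (\<lambda>v. if degr v \<le> a then degr v else b)"
  shows "tri W probe s (400 * ((n + 2 * m + 1) * (L + 1))) (\<lambda>s'. graph_data s' \<and> orient (snd s' ''inc'') \<and>
    (if fst s' ''ok'' = 1 then \<forall>v<n. indeg (snd s' ''inc'') v \<le> cap v else \<not> feasible cap))"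
proof -
  define X where "X = (n + 2 * m + 1) * (L + 1)"
  have X: "n + 2 * m + 1 + L * (n + 2 * m + 1) = X" "L \<le> L * (n + 2 * m + 1)"
    by (simp_all add: X_def algebra_simps)
  let ?c5 = "Copy ''ok'' (Const 1) ;; For ''i'' ''n'' check_step"
  let ?c4 = "For ''k'' ''L'' augment_once ;; ?c5"
  let ?c3 = "While (Less (Const 0) (Var ''sp'')) push_step ;; ?c4"
  let ?c2 = "For ''i'' ''mm'' count_step ;; ?c3"
  let ?Q = "\<lambda>s'. graph_data s' \<and> orient (snd s' ''inc'') \<and>
    (if fst s' ''ok'' = 1 then \<forall>v<n. indeg (snd s' ''inc'') v \<le> cap v else \<not> feasible cap)"
  have W0: "0 < W" "Suc 0 < W" "n < W" "L < W"
    using L_le by (auto intro!: small_W)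
  have capW: "cap v < W" for v
    using degr_le[of v] ab(3) cap by (auto intro!: small_W)
  have "tri W probe s (400 * X) ?Q"
    unfolding probe_def
  proof (rule tri_Seq[OF node_loop[OF data ab]])
    fix s1 assume I1: "node_inv (\<lambda>v. if degr v \<le> a then degr v else b) n s1"
      and u1: "unchanged (For ''i'' ''n'' node_step) s s1"
    have data1: "graph_data s1"
      by (rule graph_data_unchanged[OF data u1]) (simp_all add: node_step_def)
    have inc1: "snd s1 ''inc'' = snd s ''inc''"
      using unchanged_array[OF u1] by (simp add: node_step_def)
    let ?s2 = "set_var ''sp'' n s1"
    have data2: "graph_data ?s2"
      using data1 by (simp add: graph_data_def)
    have I2: "node_inv cap n ?s2"
      using I1 cap by (simp add: node_inv_def)
    have count: "tri W (For ''i'' ''mm'' count_step) ?s2 (24 * m + 2) flow_state"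
      by (rule count_loop[OF data2]) (use inc inc1 I2 in \<open>simp_all add: node_inv_def\<close>)
    have "tri W ?c2 ?s2 (384 * X) ?Q"
    proof (rule tri_Seq[OF count])
      fix s3 assume flow3: "flow_state s3" and u3: "unchanged (For ''i'' ''mm'' count_step) ?s2 s3"
      have data3: "graph_data s3"
        by (rule graph_data_unchanged[OF data2 u3]) (simp_all add: count_step_def)
      have arr3: "snd s3 ''cap'' = snd ?s2 ''cap''" "snd s3 ''d'' = snd ?s2 ''d''" "snd s3 ''cur'' = snd ?s2 ''cur''"
        "snd s3 ''stk'' = snd ?s2 ''stk''" "fst s3 ''sp'' = n"
        using unchanged_array[OF u3] unchanged_var[OF u3, of "''sp''"] by (simp_all add: count_step_def)
      define C where "C = snd s3 ''cap''"
      have C: "C v = cap v" if "v < n" for v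
        using that I2 arr3 by (simp add: C_def node_inv_def)
      have init: "push_inv C L (snd s3 ''inc'') (snd s3 ''d'') (snd s3 ''cur'') (snd s3 ''ind'') (snd s3 ''stk'') n"
        "push_pot L (snd s3 ''d'') (snd s3 ''cur'') n \<le> 2 * ((n + 2 * m + 1) * (L + 1))"
        by (rule push_inv_init[where ind = "snd s3 ''ind''" and inc = "snd s3 ''inc''" and stk = "snd s3 ''stk''"];
            use flow3 I2 arr3 in \<open>simp add: flow_state_def node_inv_def\<close>)+
      have pot: "push_state_pot s3 \<le> 2 * X" and pinv: "push_state s3"
        using init arr3 by (simp_all add: push_state_pot_def push_state_def X_def C_def)
      have "X \<le> 2 * ((n + m + 2) * (n + m + 2))"
        unfolding X_def by (rule square_bound) (use L_le in simp_all)
      then have small: "push_state_pot s3 + 1 < W"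
        using pot by (intro less_W) simp
      have push: "tri W (While (Less (Const 0) (Var ''sp'')) push_step) s3 (80 * X + 1)
          (\<lambda>s'. push_state s' \<and> fst s' ''sp'' = 0)"
        by (rule push_loop[OF data3 pinv small]) (use pot C C_def capW in simp_all)
      show "tri W ?c3 s3 (350 * X) ?Q"
      proof (rule tri_Seq[OF push])
        fix s4 assume I4: "push_state s4 \<and> fst s4 ''sp'' = 0"
          and u4: "unchanged (While (Less (Const 0) (Var ''sp'')) push_step) s3 s4"
        have data4: "graph_data s4"
          by (rule graph_data_unchanged[OF data3 u4]) (simp_all add: push_step_def)
        have C4: "snd s4 ''cap'' = C"
          using unchanged_array[OF u4, of "''cap''"] by (simp add: push_step_def C_def)
        have pinv4: "push_inv C L (snd s4 ''inc'') (snd s4 ''d'') (snd s4 ''cur'') (snd s4 ''ind'') (snd s4 ''stk'') 0"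
          using I4 C4 unfolding push_state_def by auto
        have flow4: "flow_data C s4"
          using data4 C4 C capW push_invD(1,2)[OF pinv4] by (simp add: flow_data_def flow_state_def)
        let ?J = "\<lambda>k s'. flow_data C s' \<and> (feasible C \<longrightarrow> state_excess s' \<le> L - k)"
        have reps: "tri W (For ''k'' ''L'' augment_once) s4 (L * (200 * (n + 2 * m + 1) + 2) + 2) (?J L)"
        proof (rule tri_For[where I = ?J])
          show "?J 0 (set_var ''k'' 0 s4)"
            using flow4 push_inv_final[OF pinv4 _ L_root] C4
            by (simp add: flow_data_def flow_state_def graph_data_def state_excess_def)
          show "fst s4 ''L'' = L"
            using data4 by (simp add: graph_data_def)
          fix k s' assume J: "?J k s'"
          have "tri W augment_once s' (200 * (n + 2 * m + 1)) (\<lambda>s'. ?J (Suc k) s')"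
          proof (rule tri_mono[OF augment_once])
            show "flow_data C s'"
              using J by simp
            show "?J (Suc k) s''" if "flow_data C s'' \<and>
                (feasible C \<longrightarrow> state_excess s'' \<le> state_excess s' - 1)" for s''
              using that J by fastforce
          qed simp
          then show "tri W augment_once s' (200 * (n + 2 * m + 1)) (\<lambda>s'. ?J (Suc k) (set_var ''k'' (Suc k) s'))"
            by (rule tri_mono)
              (auto simp: flow_data_def flow_state_def graph_data_def state_excess_def)
        qed (use W0 in \<open>simp_all add: augment_once_def search_init_def root_step_def search_step_def
            augment_def augment_start_def augment_end_def flip_step_def\<close>)
        show "tri W ?c4 s4 (260 * X) ?Q"
        proof (rule tri_Seq[OF reps])
          fix s5 assume J5: "?J L s5"
          let ?s6 = "set_var ''ok'' 1 s5"
          have flow6: "flow_data C ?s6"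
            using J5 by (simp add: flow_data_def flow_state_def graph_data_def)
          have "tri W (For ''i'' ''n'' check_step) ?s6 (10 * X + 2) ?Q"
          proof (rule tri_mono[OF check_loop[OF flow6]])
            fix s7 assume u7: "unchanged (For ''i'' ''n'' check_step) ?s6 s7"
              and R: "flow_data C s7 \<and>
                fst s7 ''ok'' = (if \<forall>v<n. indeg (snd s7 ''inc'') v \<le> C v then 1 else 0)"
            have inc7: "snd s7 ''inc'' = snd s5 ''inc''"
              using unchanged_array[OF u7, of "''inc''"] by (simp add: check_step_def)
            have "\<forall>v<n. indeg (snd s7 ''inc'') v \<le> C v" if "feasible C"
            proof -
              have "state_excess s5 = 0"
                using J5 that by simp
              then have "excess C (indeg (snd s5 ''inc'')) = 0"
                using J5 by (simp add: state_excess_def flow_data_def)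
              then show ?thesis
                using inc7 by (simp add: excess_eq_0)
            qed
            moreover have "feasible C \<longleftrightarrow> feasible cap"
              by (rule feasible_cong[OF C])
            ultimately show "?Q s7"
              using R C by (auto simp: flow_data_def flow_state_def)
          qed (use X in simp_all)
          then show "tri W ?c5 s5 (10 * X + 3) ?Q"
            by (intro tri_Copy_Seq[where T = "10 * X + 2"]) (use W0 in simp_all)
        qed (use X in \<open>simp add: algebra_simps\<close>)
      qed (use X in linarith)
    qed (use X in linarith)
    then show "tri W (Copy ''sp'' (Var ''n'') ;; ?c2) s1 (385 * X) ?Q"
      by (intro tri_Copy_Seq[where T = "384 * X"])
        (use X W0 graph_dataD(1)[OF data1] in simp_all)
  qed (use X in linarith)
  then show ?thesis
    by (simp add: X_def)
qed

end

lemmas step_defs = node_step_def count_step_def check_step_def copy_step_def push_step_def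
  search_step_def root_step_def flip_step_def
lemmas probe_defs = step_defs probe_def augment_once_def search_init_def augment_def
  augment_start_def augment_end_def
lemmas bisect_defs = probe_defs choose_level_def record_result_def bisect_step_def

context half_edges_ram
begin

subsection \<open>Binary search\<close>

text \<open>The upper end of the interval is a level that the orientation in the output array meets, and the
  lower end is infeasible. The interval consists of level 0 alone if the graph has no edges. Every
  step halves the interval, so \<open>q\<close> steps suffice for length \<open>2 ^ q\<close>.\<close>

definition bisect_core :: "nat \<Rightarrow> nat \<Rightarrow> state \<Rightarrow> bool" where
  "bisect_core D q s \<longleftrightarrow> graph_data s \<and> orient (snd s ''inc'') \<and>
     fst s ''lo'' \<le> fst s ''hi'' \<and> fst s ''hi'' \<le> 2 * D \<and> fst s ''hi'' - fst s ''lo'' \<le> 2 ^ q \<and>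
     (0 < fst s ''hi'' \<longrightarrow> fst s ''lo'' < fst s ''hi'' \<and> \<not> feasible (level_cap (fst s ''lo''))) \<and>
     (\<exists>inc. orient inc \<and> (\<forall>k<m. snd s ''out'' k = inc (Suc k)) \<and>
        (\<forall>v<n. indeg inc v \<le> level_cap (fst s ''hi'') v))"

definition least_level_output :: "state \<Rightarrow> bool" where
  "least_level_output s \<longleftrightarrow> (\<exists>inc j. orient inc \<and> (\<forall>k<m. snd s ''out'' k = inc (Suc k)) \<and>
    (\<forall>v<n. indeg inc v \<le> level_cap j v) \<and> (0 < j \<longrightarrow> \<not> feasible (level_cap (j - 1))))"

lemma copy_loop:
  assumes data: "graph_data s" and inc: "orient (snd s ''inc'')"
  shows "tri W (For ''i'' ''m'' copy_step) s (10 * m + 2) (\<lambda>s'. \<forall>k<m. snd s' ''out'' k = snd s' ''inc'' (Suc k))"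
proof -
  let ?I = "\<lambda>k s'. \<forall>i<k. snd s' ''out'' i = snd s' ''inc'' (Suc i)"
  show ?thesis
  proof (rule tri_For_straight[where I = ?I])
    fix k s' assume k: "k < m" and I: "?I k s'" and u: "unchanged (For ''i'' ''m'' copy_step) s s'"
      and ki: "fst s' ''i'' = k"
    have "snd s' ''inc'' = snd s ''inc''"
      using unchanged_array[OF u] by (simp add: copy_step_def)
    then have "snd s' ''inc'' (Suc k) \<le> 1"
      using orientD[OF inc, of "Suc k"] k by simp
    then have bounds: "snd s' ''inc'' (Suc k) < W" "Suc k < W" "k < W"
      using k by (auto intro!: small_W)
    show "wp W copy_step (\<lambda>s''. ?I (Suc k) (set_var ''i'' (Suc k) s'')) s'"
      using I bounds ki by (simp add: copy_step_def less_Suc_eq)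
  qed (use small_W[of m] data in \<open>auto simp: copy_step_def graph_data_def\<close>)
qed

lemma bisect_step:
  assumes core: "bisect_core D (Suc q) s" and gap: "Suc (fst s ''lo'') < fst s ''hi''"
    and half: "\<And>i. i \<le> 4 * D \<Longrightarrow> snd s ''half'' i = i div 2" and D: "D \<le> n"
  shows "tri W bisect_step s (450 * ((n + 2 * m + 1) * (L + 1)))
    (\<lambda>s'. bisect_core D q s' \<and> fst s' ''t'' = fst s' ''hi'' - fst s' ''lo'')"
proof -
  let ?P = "\<lambda>s'. bisect_core D q s' \<and> fst s' ''t'' = fst s' ''hi'' - fst s' ''lo''"
  let ?X = "(n + 2 * m + 1) * (L + 1)"
  have X: "n + 2 * m + 1 \<le> ?X"
    by simp
  let ?lo = "fst s ''lo''" and ?hi = "fst s ''hi''"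
  define j where "j = (?lo + ?hi) div 2"
  have hi: "?hi \<le> 2 * D" "?hi - ?lo \<le> 2 * 2 ^ q" "\<not> feasible (level_cap ?lo)"
    using core gap by (auto simp: bisect_core_def)
  have j: "?lo < j" "j < ?hi" "?hi - j \<le> 2 ^ q" "j - ?lo \<le> 2 ^ q"
    using gap hi(2) by (auto simp: j_def)
  have data: "graph_data s" and inc: "orient (snd s ''inc'')"
    using core by (simp_all add: bisect_core_def)
  let ?Q1 = "\<lambda>s'. fst s' ''j'' = j \<and> fst s' ''a'' = j - j div 2 \<and> fst s' ''b'' = j div 2"
  have jW: "j < W" "j div 2 < W" "?lo + ?hi < W" "j - j div 2 < W" "?hi < W"
    using j hi gap D by (auto intro!: small_W)
  have choose: "tri W choose_level s 4 ?Q1"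
    using jW half[of "?lo + ?hi"] half[of j] hi gap j
    by (intro tri_straight) (simp_all add: choose_level_def flip: j_def)
  have cap: "level_cap j = (\<lambda>v. if degr v \<le> j - j div 2 then degr v else j div 2)"
    by (rule ext) (simp add: level_cap_def)
  show ?thesis
    unfolding bisect_step_def
  proof (rule tri_Seq[OF choose])
    fix s1 assume Q1: "?Q1 s1" and u1: "unchanged choose_level s s1"
    have data1: "graph_data s1"
      by (rule graph_data_unchanged[OF data u1]) (simp_all add: choose_level_def)
    have same1: "fst s1 ''lo'' = ?lo" "fst s1 ''hi'' = ?hi" "snd s1 = snd s"
      using unchanged_var[OF u1] unchanged_array[OF u1] by (auto simp: choose_level_def)
    have inc1: "orient (snd s1 ''inc'')"
      using inc same1 by simp
    let ?Q2 = "\<lambda>s'. graph_data s' \<and> orient (snd s' ''inc'') \<and>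
      (if fst s' ''ok'' = 1 then \<forall>v<n. indeg (snd s' ''inc'') v \<le> level_cap j v
       else \<not> feasible (level_cap j))"
    have probe: "tri W probe s1 (400 * ?X) ?Q2"
      by (rule probe[OF data1 inc1 _ _ _ cap]) (use Q1 jW in auto)
    show "tri W (probe ;; record_result ;; Sub ''t'' (Var ''hi'') (Var ''lo'')) s1 (446 * ?X)
        ?P"
    proof (rule tri_Seq[OF probe])
      fix s2 assume Q2: "?Q2 s2" and u2: "unchanged probe s1 s2"
      have same2: "fst s2 ''lo'' = ?lo" "fst s2 ''hi'' = ?hi" "fst s2 ''j'' = j"
        "snd s2 ''out'' = snd s ''out''"
        using unchanged_var[OF u2] unchanged_array[OF u2] same1 Q1 by (simp_all add: probe_defs)
      have "tri W record_result s2 (30 * ?X) (bisect_core D q)"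
        unfolding record_result_def
      proof (rule tri_Cond)
        assume "tval (Equal (Var ''ok'') (Const 1)) s2"
        then have ok: "\<forall>v<n. indeg (snd s2 ''inc'') v \<le> level_cap j v"
          using Q2 by simp
        let ?s3 = "set_var ''hi'' j s2"
        have data3: "graph_data ?s3"
          using Q2 by (simp add: graph_data_def)
        have "orient (snd ?s3 ''inc'')"
          using Q2 by simp
        from copy_loop[OF data3 this]
        have "tri W (For ''i'' ''m'' copy_step) ?s3 (28 * ?X) (bisect_core D q)"
        proof (rule tri_mono)
          fix s4 assume u4: "unchanged (For ''i'' ''m'' copy_step) ?s3 s4"
            and out: "\<forall>k<m. snd s4 ''out'' k = snd s4 ''inc'' (Suc k)"
          have data4: "graph_data s4"
            by (rule graph_data_unchanged[OF data3 u4]) (simp_all add: copy_step_def)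
          have same4: "fst s4 ''lo'' = ?lo" "fst s4 ''hi'' = j" "snd s4 ''inc'' = snd s2 ''inc''"
            using unchanged_var[OF u4] unchanged_array[OF u4] same2 by (simp_all add: copy_step_def)
          have "\<exists>inc. orient inc \<and> (\<forall>k<m. snd s4 ''out'' k = inc (Suc k)) \<and>
              (\<forall>v<n. indeg inc v \<le> level_cap j v)"
            using Q2 ok out same4 by (intro exI[of _ "snd s4 ''inc''"]) simp
          then show "bisect_core D q s4"
            using data4 same4 j hi Q2 by (simp add: bisect_core_def)
        qed (use X in linarith)
        then show "tri W (Copy ''hi'' (Var ''j'') ;; For ''i'' ''m'' copy_step) s2 (29 * ?X) (bisect_core D q)"
          by (intro tri_Copy_Seq[where T = "28 * ?X"]) (use jW same2 in simp_all)
      next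
        assume "\<not> tval (Equal (Var ''ok'') (Const 1)) s2"
        then have ok: "\<not> feasible (level_cap j)"
          using Q2 by simp
        have "graph_data (set_var ''lo'' j s2)"
          using Q2 by (simp add: graph_data_def)
        moreover have "\<exists>inc. orient inc \<and> (\<forall>k<m. snd s ''out'' k = inc (Suc k)) \<and>
            (\<forall>v<n. indeg inc v \<le> level_cap ?hi v)"
          using core by (simp add: bisect_core_def)
        ultimately have "bisect_core D q (set_var ''lo'' j s2)"
          using same2 j hi Q2 ok by (simp add: bisect_core_def)
        then show "tri W (Copy ''lo'' (Var ''j'')) s2 (29 * ?X) (bisect_core D q)"
          using jW same2 by (intro tri_straight) simp_all
      qed simp
      then show "tri W (record_result ;; Sub ''t'' (Var ''hi'') (Var ''lo'')) s2 (31 * ?X)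
          ?P"
      proof (rule tri_Seq)
        fix s3 assume core3: "bisect_core D q s3"
        have "graph_data (set_var ''t'' (fst s3 ''hi'' - fst s3 ''lo'') s3)"
          using core3 by (simp add: graph_data_def bisect_core_def)
        then have "bisect_core D q (set_var ''t'' (fst s3 ''hi'' - fst s3 ''lo'') s3)"
          using core3 by (simp add: bisect_core_def)
        moreover have "fst s3 ''hi'' \<le> 2 * D"
          using core3 by (simp add: bisect_core_def)
        then have "fst s3 ''hi'' - fst s3 ''lo'' < W"
          using D by (intro small_W) simp
        ultimately show "tri W (Sub ''t'' (Var ''hi'') (Var ''lo'')) s3 1
          ?P"
          by (intro tri_straight) simp_all
      qed (use X in linarith)
    qed (use X in linarith)
  qed (use X in linarith)
qed

lemma bisect:
  assumes data: "graph_data s" and inc: "orient (snd s ''inc'')"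
    and out: "\<And>k. k < m \<Longrightarrow> snd s ''out'' k = snd s ''inc'' (Suc k)"
    and D: "fst s ''D'' = D" "\<And>v. v < n \<Longrightarrow> degr v \<le> D" "D \<le> n" "0 < D \<Longrightarrow> 0 < m"
    and half: "\<And>i. i \<le> 4 * D \<Longrightarrow> snd s ''half'' i = i div 2" and q: "2 * D \<le> 2 ^ q"
  shows "tri W bisect s (460 * ((n + 2 * m + 1) * (L + 1)) * (q + 1)) least_level_output"
proof -
  define X where "X = (n + 2 * m + 1) * (L + 1)"
  have X: "1 \<le> X"
    by (simp add: X_def)
  let ?I = "\<lambda>q s'. bisect_core D q s' \<and> fst s' ''t'' = fst s' ''hi'' - fst s' ''lo''"
  have W0: "0 < W" "2 * D < W" "D + D < W"
    using D(3) by (auto intro!: small_W)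
  let ?loop = "While (Less (Const 1) (Var ''t'')) bisect_step"
  have loop: "tri W ?loop s1 (451 * X * q + 1) least_level_output"
    if I: "?I q s1" and half1: "snd s1 ''half'' = snd s ''half''" for s1
  proof -
    have "tri W ?loop s1 (451 * X * q + 1) (\<lambda>s'. (\<exists>q. ?I q s') \<and> \<not> tval (Less (Const 1) (Var ''t'')) s')"
    proof (rule tri_While[where I = ?I and q = q and T = "450 * X"])
      fix q s' assume I: "?I q s'" and u: "unchanged bisect_step s1 s'"
        and b: "tval (Less (Const 1) (Var ''t'')) s'"
      have gap: "Suc (fst s' ''lo'') < fst s' ''hi''"
        using I b by simp
      (* q is positive, since an interval of length at least 2 does not fit into 2 ^ 0 *)
    obtain q' where q': "q = Suc q'"
        using I gap by (cases q) (auto simp: bisect_core_def)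
      have half': "snd s' ''half'' i = i div 2" if "i \<le> 4 * D" for i
        using unchanged_array[OF u, of "''half''"] half[OF that] half1 by (simp add: bisect_defs)
      have core: "bisect_core D (Suc q') s'"
        using I q' by simp
      show "tri W bisect_step s' (450 * X) (\<lambda>s''. \<exists>q'<q. ?I q' s'')"
        unfolding X_def by (rule tri_mono[OF bisect_step[OF core gap half' D(3)]]) (use q' in auto)
    qed (use I X in \<open>simp_all add: algebra_simps\<close>)
    then show ?thesis
    proof (rule tri_mono)
      fix s' assume "(\<exists>q. ?I q s') \<and> \<not> tval (Less (Const 1) (Var ''t'')) s'"
      then obtain q where core: "bisect_core D q s'" and le: "fst s' ''hi'' - fst s' ''lo'' \<le> 1"
        by auto
      have "\<not> feasible (level_cap (fst s' ''hi'' - 1))" if "0 < fst s' ''hi''"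
      proof -
        have "fst s' ''lo'' = fst s' ''hi'' - 1"
          using core le that by (auto simp: bisect_core_def)
        then show ?thesis
          using core that by (simp add: bisect_core_def)
      qed
      moreover from core obtain inc where "orient inc" "\<forall>k<m. snd s' ''out'' k = inc (Suc k)"
          "\<forall>v<n. indeg inc v \<le> level_cap (fst s' ''hi'') v"
        unfolding bisect_core_def by blast
      ultimately show "least_level_output s'"
        unfolding least_level_output_def by (intro exI[of _ inc] exI[of _ "fst s' ''hi''"]) simp
    qed simp
  qed
  have "tri W bisect s (460 * X * (q + 1)) least_level_output"
    unfolding bisect_def
  proof -
    let ?s = "set_var ''t'' (2 * D) (set_var ''hi'' (D + D) (set_var ''lo'' 0 s))"
    have "indeg (snd s ''inc'') v \<le> level_cap (2 * D) v" if "v < n" for v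
      using indeg_le_degr[of _ v] level_cap_top[OF D(2)[OF that]] by simp
    then have "\<exists>inc. orient inc \<and> (\<forall>k<m. snd s ''out'' k = inc (Suc k)) \<and>
        (\<forall>v<n. indeg inc v \<le> level_cap (2 * D) v)"
      using inc out by blast
    moreover have "graph_data ?s"
      using data by (simp add: graph_data_def)
    ultimately have "bisect_core D q ?s"
      using inc q D(4) infeasible_0 by (simp add: bisect_core_def flip: mult_2)
    then have "tri W ?loop ?s (451 * X * q + 1) least_level_output"
      by (intro loop) simp_all
    then have "tri W (Sub ''t'' (Var ''hi'') (Var ''lo'') ;; ?loop) (set_var ''hi'' (D + D) (set_var ''lo'' 0 s))
        (451 * X * q + 2) least_level_output"
      by (intro tri_Sub_Seq[where T = "451 * X * q + 1"]) (use W0 in \<open>simp_all add: mult_2\<close>)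
    then show "tri W (Copy ''lo'' (Const 0) ;; Add ''hi'' (Var ''D'') (Var ''D'') ;;
        Sub ''t'' (Var ''hi'') (Var ''lo'') ;; ?loop) s (460 * X * (q + 1)) least_level_output"
      by (intro tri_Copy_Seq[where T = "451 * X * q + 3"] tri_Add_Seq[where T = "451 * X * q + 2"])
        (use W0 X D(1) in \<open>simp_all add: algebra_simps\<close>)
  qed
  then show ?thesis
    by (simp add: X_def)
qed

end

subsection \<open>Preparation\<close>

text \<open>The value of \<open>L\<close>, the bound on the labels and the number of rounds of augmentation.\<close>

definition search_limit :: "nat \<Rightarrow> nat \<Rightarrow> nat" where
  "search_limit n m = (LEAST l. m \<le> l * l \<or> n * n \<le> l * l * l)"

lemma search_limit: "m \<le> search_limit n m * search_limit n m \<or>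
    n * n \<le> search_limit n m * search_limit n m * search_limit n m"
  unfolding search_limit_def by (rule LeastI[of _ m]) (cases m, auto)

lemma search_limit_least: "m \<le> l * l \<or> n * n \<le> l * l * l \<Longrightarrow> search_limit n m \<le> l"
  unfolding search_limit_def by (rule Least_le)

lemma search_limit_le: "search_limit n m \<le> m"
  by (rule search_limit_least) (cases m, auto)

locale ram_graph = encoded_graph +
  fixes W :: nat
  assumes word_bound: "8 * ((length vs + length es + 2) * (length vs + length es + 2) * (length vs + length es + 2)) \<le> W"
begin

abbreviation nn :: nat where "nn \<equiv> length vs"
abbreviation mm :: nat where "mm \<equiv> length es"
abbreviation lim :: nat where "lim \<equiv> search_limit nn mm"

sublocale half_edges_ram "length vs" "length es" "own_of es" "opp_of (length es)" W
  "search_limit (length vs) (length es)"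
  by unfold_locales (rule word_bound search_limit_le search_limit)+

definition edge_inv :: "nat \<Rightarrow> state \<Rightarrow> bool" where
  "edge_inv k s \<longleftrightarrow> (\<forall>i<k. snd s ''own'' (Suc i) = fst (es ! i) \<and> snd s ''own'' (Suc (i + mm)) = snd (es ! i) \<and>
       snd s ''opp'' (Suc i) = Suc (i + mm) \<and> snd s ''opp'' (Suc (i + mm)) = Suc i \<and>
       snd s ''inc'' (Suc (i + mm)) = 1) \<and>
     (\<forall>i\<le>mm. snd s ''inc'' i = 0)"

definition input_data :: "state \<Rightarrow> bool" where
  "input_data s \<longleftrightarrow> fst s ''n'' = nn \<and> fst s ''m'' = mm \<and> fst s ''mm'' = 2 * mm \<and>
     (\<forall>h. is_half h \<longrightarrow> snd s ''own'' h = own_of es h \<and> snd s ''opp'' h = opp_of mm h) \<and>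
     orient (snd s ''inc'') \<and> (\<forall>k<mm. snd s ''out'' k = snd s ''inc'' (Suc k))"

lemma input_data_unchanged:
  assumes "input_data s" "unchanged c s s'"
    and "written_vars c \<inter> {''n'', ''m'', ''mm''} = {}"
    and "written_arrays c \<inter> {''own'', ''opp'', ''inc'', ''out''} = {}"
  shows "input_data s'"
proof -
  have "\<forall>x\<in>{''n'', ''m'', ''mm''}. fst s' x = fst s x"
    by (intro ballI unchanged_var[OF assms(2)]) (use assms(3) in \<open>simp only: disjoint_iff, blast\<close>)
  moreover have "\<forall>x\<in>{''own'', ''opp'', ''inc'', ''out''}. snd s' x = snd s x"
    by (intro ballI unchanged_array[OF assms(2)]) (use assms(4) in \<open>simp only: disjoint_iff, blast\<close>)
  ultimately show ?thesis
    using assms(1) by (simp add: input_data_def)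
qed

lemma edge_loop:
  assumes s: "s = set_var ''mm'' (2 * mm) (input_state nn es)"
  shows "tri W (For ''i'' ''m'' edge_step) s (20 * mm + 2) input_data"
proof -
  have "tri W (For ''i'' ''m'' edge_step) s (20 * mm + 2) (edge_inv mm)"
  proof (rule tri_For_straight[where I = edge_inv])
    fix k s' assume k: "k < mm" and I: "edge_inv k s'" and u: "unchanged (For ''i'' ''m'' edge_step) s s'"
      and ki: "fst s' ''i'' = k"
    have arr: "snd s' ''src'' k = fst (es ! k)" "snd s' ''dst'' k = snd (es ! k)" "fst s' ''m'' = mm"
      using unchanged_array[OF u] unchanged_var[OF u] s k by (simp_all add: edge_step_def input_state_def)
    have bounds: "fst (es ! k) < W" "snd (es ! k) < W" "k < W" "Suc k < W" "Suc (k + mm) < W" "Suc 0 < W"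
      using endpoints[OF k] k by (auto intro!: small_W)
    show "wp W edge_step (\<lambda>s''. edge_inv (Suc k) (set_var ''i'' (Suc k) s'')) s'"
      using I k by (auto simp: edge_step_def edge_inv_def arr ki bounds less_Suc_eq)
  qed (use small_W[of mm] s in \<open>auto simp: edge_step_def input_state_def edge_inv_def\<close>)
  then show ?thesis
  proof (rule tri_mono)
    fix s' assume u: "unchanged (For ''i'' ''m'' edge_step) s s'" and I: "edge_inv mm s'"
    have vars: "fst s' ''n'' = nn" "fst s' ''m'' = mm" "fst s' ''mm'' = 2 * mm" "snd s' ''out'' = (\<lambda>_. 0)"
      using unchanged_array[OF u] unchanged_var[OF u] s by (simp_all add: edge_step_def input_state_def)
    have half: "snd s' ''own'' h = own_of es h \<and> snd s' ''opp'' h = opp_of mm h \<and>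
        snd s' ''inc'' h = (if h \<le> mm then 0 else 1)" if h: "is_half h" for h
    proof (cases "h \<le> mm")
      case True
      then obtain i where "h = Suc i" "i < mm"
        using h by (cases h) auto
      then show ?thesis
        using I by (simp add: edge_inv_def own_of_def opp_of_def)
    next
      case False
      then have i: "h = Suc (h - mm - 1 + mm)" "h - mm - 1 < mm"
        using h by auto
      obtain i where "h = Suc (i + mm)" "i < mm"
        using i by blast
      then show ?thesis
        using I by (simp add: edge_inv_def own_of_def opp_of_def)
    qed
    have "orient (snd s' ''inc'')"
      unfolding orient_def
    proof (intro allI impI)
      fix h assume h: "is_half h"
      then have "h \<le> mm \<longleftrightarrow> \<not> opp_of mm h \<le> mm"
        by (auto simp: opp_of_def)
      then show "snd s' ''inc'' h \<le> 1 \<and> snd s' ''inc'' h + snd s' ''inc'' (opp_of mm h) = 1"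
        using half[OF h] half[OF opp_half[OF h]] by simp
    qed
    then show "input_data s'"
      using half vars by (simp add: input_data_def)
  qed simp
qed

definition list_inv :: "nat \<Rightarrow> state \<Rightarrow> bool" where
  "list_inv k s \<longleftrightarrow>
     (\<forall>v<nn. snd s ''head'' v = below v (Suc k) \<and> snd s ''deg'' v = halves_upto v k) \<and>
     (\<forall>h. 0 < h \<longrightarrow> h \<le> k \<longrightarrow> snd s ''next'' h = below (own_of es h) h)"

lemma list_loop:
  assumes data: "input_data s" and zero: "snd s ''head'' = (\<lambda>_. 0)" "snd s ''deg'' = (\<lambda>_. 0)"
  shows "tri W (For ''i'' ''mm'' list_step) s (24 * mm + 2) (list_inv (2 * mm))"
proof (rule tri_For_straight[where I = list_inv])
  fix k s' assume k: "k < 2 * mm" and I: "list_inv k s'" and u: "unchanged (For ''i'' ''mm'' list_step) s s'"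
    and ki: "fst s' ''i'' = k"
  have h: "is_half (Suc k)"
    using k by simp
  let ?v = "own_of es (Suc k)"
  have "input_data s'"
    by (rule input_data_unchanged[OF data u]) (simp_all add: list_step_def)
  then have own: "snd s' ''own'' (Suc k) = ?v"
    using h by (simp add: input_data_def)
  have v: "?v < nn"
    using own_less[of "Suc k"] h by simp
  have old: "snd s' ''head'' ?v = below ?v (Suc k)" "snd s' ''deg'' ?v = halves_upto ?v k"
    using I v by (simp_all add: list_inv_def)
  have "below ?v (Suc k) \<le> 2 * mm"
    using below_le_half[of "Suc k" ?v] k by simp
  moreover have "halves_upto ?v k \<le> (\<Sum>v<nn. halves_upto v k)"
    by (rule member_le_sum) (use v in auto)
  then have "halves_upto ?v k \<le> 2 * mm"
    using sum_halves_upto[of k] k by simp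
  ultimately have bounds: "Suc k < W" "?v < W" "below ?v (Suc k) < W" "halves_upto ?v k < W"
    "Suc (halves_upto ?v k) < W"
    using k v by (auto intro!: small_W)
  show "wp W list_step (\<lambda>s''. list_inv (Suc k) (set_var ''i'' (Suc k) s'')) s'"
    using I by (auto simp: list_step_def ki own old bounds list_inv_def below_Suc halves_upto_Suc le_Suc_eq)
qed (use small_W[of "2 * mm"] data zero in \<open>auto simp: list_step_def input_data_def list_inv_def\<close>)

definition max_inv :: "nat \<Rightarrow> state \<Rightarrow> bool" where
  "max_inv k s \<longleftrightarrow> (\<forall>v<k. degr v \<le> fst s ''D'') \<and> (fst s ''D'' = 0 \<or> (\<exists>v<k. fst s ''D'' = degr v))"

lemma max_loop:
  assumes data: "fst s ''n'' = nn" and deg: "\<And>v. v < nn \<Longrightarrow> snd s ''deg'' v = degr v" and D: "fst s ''D'' = 0"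
  shows "tri W (For ''i'' ''n'' max_step) s (6 * nn + 2) (max_inv nn)"
proof (rule tri_For_straight[where I = max_inv])
  fix k s' assume k: "k < nn" and I: "max_inv k s'" and u: "unchanged (For ''i'' ''n'' max_step) s s'"
    and ki: "fst s' ''i'' = k"
  have deg': "snd s' ''deg'' k = degr k"
    using unchanged_array[OF u, of "''deg''"] deg[OF k] by (simp add: max_step_def)
  have bounds: "k < W" "degr k < W"
    using k degr_le[of k] by (auto intro!: small_W)
  show "wp W max_step (\<lambda>s''. max_inv (Suc k) (set_var ''i'' (Suc k) s'')) s'"
    using I bounds by (auto simp: max_step_def ki deg' max_inv_def less_Suc_eq)
qed (use small_W[of nn] data D in \<open>auto simp: max_step_def max_inv_def\<close>)

definition halve_inv :: "nat \<Rightarrow> state \<Rightarrow> bool" where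
  "halve_inv k s \<longleftrightarrow> (\<forall>i<2 * k. snd s ''half'' i = i div 2)"

lemma halve_loop:
  assumes q: "fst s ''q'' = q" "q \<le> 2 * nn + 1"
  shows "tri W (For ''i'' ''q'' halve_step) s (6 * q + 2) (halve_inv q)"
proof (rule tri_For_straight[where I = halve_inv])
  fix k s' assume k: "k < q" and I: "halve_inv k s'" and ki: "fst s' ''i'' = k"
  have bounds: "k < W" "k + k < W" "Suc (k + k) < W"
    using k q by (auto intro!: small_W)
  show "wp W halve_step (\<lambda>s''. halve_inv (Suc k) (set_var ''i'' (Suc k) s'')) s'"
    using I bounds by (auto simp: halve_step_def ki halve_inv_def less_Suc_eq mult_2)
qed (use small_W[of q] q in \<open>auto simp: halve_step_def halve_inv_def\<close>)

lemma square_loop: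
  assumes data: "fst s ''n'' = nn" and q: "fst s ''q'' = 0"
  shows "tri W (For ''i'' ''n'' square_step) s (3 * nn + 2) (\<lambda>s'. fst s' ''q'' = nn * nn)"
proof (rule tri_For[where I = "\<lambda>k s'. fst s' ''q'' = k * nn" and T = 1])
  fix k s' assume k: "k < nn" and I: "fst s' ''q'' = k * nn" and u: "unchanged (For ''i'' ''n'' square_step) s s'"
    and ki: "fst s' ''i'' = k"
  have n: "fst s' ''n'' = nn"
    using unchanged_var[OF u, of "''n''"] data by (simp add: square_step_def)
  have "Suc k * nn \<le> 1 * ((nn + mm + 2) * (nn + mm + 2))"
    by (rule square_bound) (use k in simp_all)
  then have "k * nn + nn < W"
    by (intro less_W) simp
  then show "tri W square_step s' 1 (\<lambda>s''. fst (set_var ''i'' (Suc k) s'') ''q'' = Suc k * nn)"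
    using I n by (intro tri_straight) (simp_all add: square_step_def add.commute)
qed (use small_W[of nn] data q in \<open>auto simp: square_step_def\<close>)

definition limit_inv :: "state \<Rightarrow> bool" where
  "limit_inv s \<longleftrightarrow> fst s ''L'' \<le> lim \<and> fst s ''y'' = fst s ''L'' * fst s ''L'' \<and>
     fst s ''z'' = fst s ''L'' * fst s ''L'' * fst s ''L'' \<and> fst s ''t'' \<le> 1 \<and>
     (fst s ''t'' = 0 \<longrightarrow> fst s ''L'' = lim)"

lemma limit_loop:
  assumes data: "fst s ''m'' = mm" "fst s ''q'' = nn * nn" and inv: "limit_inv s"
  shows "tri W (While (Equal (Var ''t'') (Const 1)) limit_step) s (20 * mm + 30) (\<lambda>s'. fst s' ''L'' = lim)"
proof -
  let ?\<Phi> = "\<lambda>s'. (lim - fst s' ''L'') + fst s' ''t''"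
  have "tri W (While (Equal (Var ''t'') (Const 1)) limit_step) s (20 * mm + 30)
      (\<lambda>s'. limit_inv s' \<and> \<not> tval (Equal (Var ''t'') (Const 1)) s')"
  proof (rule tri_While_potential[where \<Phi> = ?\<Phi>])
    fix s' assume I: "limit_inv s'" and u: "unchanged limit_step s s'" and b: "tval (Equal (Var ''t'') (Const 1)) s'"
    have data': "fst s' ''m'' = mm" "fst s' ''q'' = nn * nn"
      using unchanged_var[OF u] data by (simp_all add: limit_step_def)
    define l y z where "l = fst s' ''L''" and "y = fst s' ''y''" and "z = fst s' ''z''"
    have yz: "y = l * l" "z = l * l * l" "l \<le> lim" and t: "fst s' ''t'' = 1"
      using I b by (auto simp: limit_inv_def l_def y_def z_def)
    note vals = l_def[symmetric] y_def[symmetric] z_def[symmetric] t data'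
    have W0: "0 < W"
      by (rule small_W) simp
    show "wp W limit_step (\<lambda>s''. limit_inv s'' \<and> ?\<Phi> s'' < ?\<Phi> s') s'"
    proof (cases "mm \<le> y \<or> nn * nn \<le> z")
      case True
      (* lim is the least value that stops the loop, and l is at most lim *)
      then have "l = lim"
        using search_limit_least[of mm l nn] yz by auto
      then show ?thesis
        using True yz W0 by (cases "mm \<le> y") (simp_all add: limit_step_def limit_inv_def vals)
    next
      case False
      then have "l \<noteq> lim"
        using search_limit[of mm nn] yz by auto
      then have l: "l < lim"
        using yz by simp
      then have "Suc l \<le> nn + mm + 2"
        using search_limit_le[of nn mm] by linarith
      then have "Suc l * Suc l * Suc l \<le> (nn + mm + 2) * (nn + mm + 2) * (nn + mm + 2)"
        by (intro mult_le_mono)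
      moreover have "0 < (nn + mm + 2) * (nn + mm + 2) * (nn + mm + 2)"
        by simp
      ultimately have "Suc l * Suc l * Suc l < W"
        using word_bound by linarith
      moreover have cube: "Suc l * Suc l * Suc l = Suc (z + y + y + y + l + l + l)"
        by (simp add: yz algebra_simps)
      ultimately have bound: "Suc (z + y + y + y + l + l + l) < W"
        by simp
      have square: "Suc l * Suc l = Suc (y + l + l)"
        by (simp add: yz)
      have "wp W limit_step (\<lambda>s''. fst s'' ''L'' = Suc l \<and> fst s'' ''y'' = Suc (y + l + l) \<and>
          fst s'' ''z'' = Suc (z + y + y + y + l + l + l) \<and> fst s'' ''t'' = 1) s'"
        using bound False by (simp add: limit_step_def vals)
      then show ?thesis
      proof (rule wp_mono)
        fix s'' :: state assume "fst s'' ''L'' = Suc l \<and> fst s'' ''y'' = Suc (y + l + l) \<and>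
          fst s'' ''z'' = Suc (z + y + y + y + l + l + l) \<and> fst s'' ''t'' = 1"
        then show "limit_inv s'' \<and> ?\<Phi> s'' < ?\<Phi> s'"
          using l by (simp add: limit_inv_def square[symmetric] cube[symmetric] vals del: mult_Suc mult_Suc_right)
      qed
    qed
  next
    have "?\<Phi> s \<le> mm + 1"
      using inv search_limit_le[of nn mm] by (auto simp: limit_inv_def)
    then have "?\<Phi> s * (cost limit_step + 1) + 1 \<le> (mm + 1) * (cost limit_step + 1) + 1"
      by (intro add_right_mono mult_right_mono) auto
    also have "\<dots> \<le> 20 * mm + 30"
      by (simp add: limit_step_def)
    finally show "?\<Phi> s * (cost limit_step + 1) + 1 \<le> 20 * mm + 30" .
  qed (rule inv)
  then show ?thesis
    by (rule tri_mono) (auto simp: limit_inv_def le_Suc_eq)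
qed

lemma list_inv_unchanged:
  "list_inv k s \<Longrightarrow> unchanged c s s' \<Longrightarrow> ''head'' \<notin> written_arrays c \<Longrightarrow> ''deg'' \<notin> written_arrays c \<Longrightarrow>
    ''next'' \<notin> written_arrays c \<Longrightarrow> list_inv k s'"
  by (simp add: list_inv_def unchanged_array)

lemma max_inv_unchanged:
  "max_inv k s \<Longrightarrow> unchanged c s s' \<Longrightarrow> ''D'' \<notin> written_vars c \<Longrightarrow> max_inv k s'"
  by (simp add: max_inv_def unchanged_var)

lemma halve_inv_unchanged:
  "halve_inv k s \<Longrightarrow> unchanged c s s' \<Longrightarrow> ''half'' \<notin> written_arrays c \<Longrightarrow> halve_inv k s'"
  by (simp add: halve_inv_def unchanged_array)

definition prepared :: "state \<Rightarrow> bool" where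
  "prepared s \<longleftrightarrow> input_data s \<and> list_inv (2 * mm) s \<and> max_inv nn s \<and> halve_inv (2 * fst s ''D'' + 1) s"

lemma prepared_unchanged:
  assumes "prepared s" "unchanged c s s'"
    and "written_vars c \<inter> {''n'', ''m'', ''mm'', ''D''} = {}"
    and "written_arrays c \<inter> {''own'', ''opp'', ''inc'', ''out'', ''head'', ''deg'', ''next'', ''half''} = {}"
  shows "prepared s'"
proof -
  have "''D'' \<notin> written_vars c" "written_vars c \<inter> {''n'', ''m'', ''mm''} = {}"
    "''head'' \<notin> written_arrays c" "''deg'' \<notin> written_arrays c" "''next'' \<notin> written_arrays c"
    "''half'' \<notin> written_arrays c" "written_arrays c \<inter> {''own'', ''opp'', ''inc'', ''out''} = {}"
    using assms(3,4) by simp_all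
  note written = this
  have P: "input_data s" "list_inv (2 * mm) s" "max_inv nn s" "halve_inv (2 * fst s ''D'' + 1) s"
    using assms(1) by (simp_all add: prepared_def)
  have "fst s' ''D'' = fst s ''D''"
    by (rule unchanged_var[OF assms(2) written(1)])
  then show ?thesis
    unfolding prepared_def
    using input_data_unchanged[OF P(1) assms(2) written(2,7)] list_inv_unchanged[OF P(2) assms(2) written(3-5)]
      max_inv_unchanged[OF P(3) assms(2) written(1)] halve_inv_unchanged[OF P(4) assms(2) written(6)]
    by simp
qed

lemma prepare:
  "tri W prepare (input_state nn es) (200 * (nn + 2 * mm + 1)) (\<lambda>s. prepared s \<and> fst s ''L'' = lim)"
proof -
  let ?S = "nn + 2 * mm + 1" and ?s0 = "input_state nn es"
  let ?s1 = "set_var ''mm'' (2 * mm) ?s0"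
  let ?Q = "\<lambda>s. prepared s \<and> fst s ''L'' = lim"
  have W0: "0 < W" "Suc 0 < W" "2 * mm < W"
    by (auto intro!: small_W)
  define c6 where "c6 = While (Equal (Var ''t'') (Const 1)) limit_step"
  define c5 where "c5 = (Copy ''L'' (Const 0) ;; Copy ''y'' (Const 0) ;; Copy ''z'' (Const 0) ;;
     Copy ''t'' (Const 1) ;; c6)"
  define c4 where "c4 = (Copy ''q'' (Const 0) ;; For ''i'' ''n'' square_step ;; c5)"
  define c3 where "c3 = (Add ''q'' (Var ''D'') (Var ''D'') ;; Add ''q'' (Var ''q'') (Const 1) ;;
     For ''i'' ''q'' halve_step ;; c4)"
  define c2 where "c2 = (Copy ''D'' (Const 0) ;; For ''i'' ''n'' max_step ;; c3)"
  define c1 where "c1 = (For ''i'' ''mm'' list_step ;; c2)"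
  have t5: "tri W c5 s (20 * mm + 34) ?Q" if P: "prepared s" and q: "fst s ''q'' = nn * nn" for s
  proof -
    let ?s = "set_var ''t'' 1 (set_var ''z'' 0 (set_var ''y'' 0 (set_var ''L'' 0 s)))"
    have P': "prepared ?s"
      using P by (simp add: prepared_def input_data_def list_inv_def max_inv_def halve_inv_def)
    have "tri W c6 ?s (20 * mm + 30) (\<lambda>s'. fst s' ''L'' = lim)"
      unfolding c6_def
      by (rule limit_loop) (use P q in \<open>simp_all add: prepared_def input_data_def limit_inv_def\<close>)
    then have "tri W c6 ?s (20 * mm + 30) ?Q"
    proof (rule tri_mono)
      fix s' assume u: "unchanged c6 ?s s'" and L: "fst s' ''L'' = lim"
      have "prepared s'"
        by (rule prepared_unchanged[OF P' u]) (simp_all add: c6_def limit_step_def)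
      then show "?Q s'"
        using L by simp
    qed simp
    then show ?thesis
      unfolding c5_def
      by (intro tri_Copy_Seq[where T = "20 * mm + 33"] tri_Copy_Seq[where T = "20 * mm + 32"]
          tri_Copy_Seq[where T = "20 * mm + 31"] tri_Copy_Seq[where T = "20 * mm + 30"])
        (use W0 in simp_all)
  qed
  have t4: "tri W c4 s (3 * nn + 20 * mm + 40) ?Q" if P: "prepared s" for s
  proof -
    let ?s = "set_var ''q'' 0 s"
    have P': "prepared ?s"
      using P by (simp add: prepared_def input_data_def list_inv_def max_inv_def halve_inv_def)
    have sq: "tri W (For ''i'' ''n'' square_step) ?s (3 * nn + 2) (\<lambda>s'. fst s' ''q'' = nn * nn)"
      by (rule square_loop) (use P in \<open>simp_all add: prepared_def input_data_def\<close>)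
    have "tri W (For ''i'' ''n'' square_step ;; c5) ?s (3 * nn + 20 * mm + 36) ?Q"
    proof (rule tri_Seq[OF sq])
      fix s' assume q: "fst s' ''q'' = nn * nn" and u: "unchanged (For ''i'' ''n'' square_step) ?s s'"
      have "prepared s'"
        by (rule prepared_unchanged[OF P' u]) (simp_all add: square_step_def)
      then show "tri W c5 s' (20 * mm + 34) ?Q"
        using q by (rule t5)
    qed simp
    then show ?thesis
      unfolding c4_def
      by (intro tri_Copy_Seq[where T = "3 * nn + 20 * mm + 36"]) (use W0 in simp_all)
  qed
  have t3: "tri W c3 s (15 * nn + 20 * mm + 60) ?Q"
    if P: "input_data s" "list_inv (2 * mm) s" "max_inv nn s" for s
  proof -
    let ?D = "fst s ''D''"
    let ?s = "set_var ''q'' (Suc (?D + ?D)) (set_var ''q'' (?D + ?D) s)"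
    have D: "?D \<le> nn"
      using P(3) degr_less by (auto simp: max_inv_def)
    have P': "input_data ?s" "list_inv (2 * mm) ?s" "max_inv nn ?s"
      using P by (simp_all add: input_data_def list_inv_def max_inv_def)
    have h: "tri W (For ''i'' ''q'' halve_step) ?s (6 * Suc (?D + ?D) + 2) (halve_inv (Suc (?D + ?D)))"
      by (rule halve_loop) (use D in simp_all)
    have "tri W (For ''i'' ''q'' halve_step ;; c4) ?s (15 * nn + 20 * mm + 50) ?Q"
    proof (rule tri_Seq[OF h])
      fix s' assume I: "halve_inv (Suc (?D + ?D)) s'" and u: "unchanged (For ''i'' ''q'' halve_step) ?s s'"
      have "input_data s'"
        by (rule input_data_unchanged[OF P'(1) u]) (simp_all add: halve_step_def)
      moreover have "list_inv (2 * mm) s'"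
        by (rule list_inv_unchanged[OF P'(2) u]) (simp_all add: halve_step_def)
      moreover have "max_inv nn s'"
        by (rule max_inv_unchanged[OF P'(3) u]) (simp_all add: halve_step_def)
      moreover have "fst s' ''D'' = ?D"
        using unchanged_var[OF u, of "''D''"] by (simp add: halve_step_def)
      ultimately have "prepared s'"
        using I by (simp add: prepared_def mult_2)
      then show "tri W c4 s' (3 * nn + 20 * mm + 40) ?Q"
        by (rule t4)
    qed (use D in simp)
    moreover have "?D + ?D < W" "Suc (?D + ?D) < W"
      using D by (auto intro!: small_W)
    ultimately show ?thesis
      unfolding c3_def
      by (intro tri_Add_Seq[where T = "15 * nn + 20 * mm + 51"] tri_Add_Seq[where T = "15 * nn + 20 * mm + 50"])
        simp_all
  qed
  have t2: "tri W c2 s (21 * nn + 20 * mm + 70) ?Q" if P: "input_data s" "list_inv (2 * mm) s" for s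
  proof -
    let ?s = "set_var ''D'' 0 s"
    have P': "input_data ?s" "list_inv (2 * mm) ?s"
      using P by (simp_all add: input_data_def list_inv_def)
    have mx: "tri W (For ''i'' ''n'' max_step) ?s (6 * nn + 2) (max_inv nn)"
      by (rule max_loop) (use P in \<open>simp_all add: input_data_def list_inv_def\<close>)
    have "tri W (For ''i'' ''n'' max_step ;; c3) ?s (21 * nn + 20 * mm + 65) ?Q"
    proof (rule tri_Seq[OF mx])
      fix s' assume I: "max_inv nn s'" and u: "unchanged (For ''i'' ''n'' max_step) ?s s'"
      have "input_data s'"
        by (rule input_data_unchanged[OF P'(1) u]) (simp_all add: max_step_def)
      moreover have "list_inv (2 * mm) s'"
        by (rule list_inv_unchanged[OF P'(2) u]) (simp_all add: max_step_def)
      ultimately show "tri W c3 s' (15 * nn + 20 * mm + 60) ?Q"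
        using I by (rule t3)
    qed simp
    then show ?thesis
      unfolding c2_def
      by (intro tri_Copy_Seq[where T = "21 * nn + 20 * mm + 65"]) (use W0 in simp_all)
  qed
  have t1: "tri W c1 s (21 * nn + 50 * mm + 80) ?Q"
    if P: "input_data s" and zero: "snd s ''head'' = (\<lambda>_. 0)" "snd s ''deg'' = (\<lambda>_. 0)" for s
    unfolding c1_def
  proof (rule tri_Seq[OF list_loop[OF P zero]])
    fix s' assume I: "list_inv (2 * mm) s'" and u: "unchanged (For ''i'' ''mm'' list_step) s s'"
    have "input_data s'"
      by (rule input_data_unchanged[OF P u]) (simp_all add: list_step_def)
    then show "tri W c2 s' (21 * nn + 20 * mm + 70) ?Q"
      using I by (rule t2)
  qed simp
  have "tri W (For ''i'' ''m'' edge_step ;; c1) ?s1 (21 * nn + 70 * mm + 90) ?Q"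
  proof (rule tri_Seq[OF edge_loop[OF refl]])
    fix s' assume I: "input_data s'" and u: "unchanged (For ''i'' ''m'' edge_step) ?s1 s'"
    show "tri W c1 s' (21 * nn + 50 * mm + 80) ?Q"
      by (rule t1[OF I]) (use unchanged_array[OF u] in \<open>simp_all add: edge_step_def input_state_def\<close>)
  qed simp
  then show ?thesis
    unfolding prepare_def c6_def[symmetric] c5_def[symmetric] c4_def[symmetric] c3_def[symmetric]
      c2_def[symmetric] c1_def[symmetric]
    by (intro tri_Add_Seq[where T = "21 * nn + 70 * mm + 90"])
      (use W0 in \<open>simp_all add: input_state_def mult_2\<close>)
qed

end

context ram_graph
begin

lemma star_ind:
  assumes C: "inj_on C V" and q: "2 * max_degree V E \<le> 2 ^ q"
  shows "tri W star_ind (input_state nn es)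
    (200 * (nn + 2 * mm + 1) + 460 * ((nn + 2 * mm + 1) * (lim + 1)) * (q + 1))
    (\<lambda>s. MinMaxStar_optimal V E C (output_orientation vs es s) \<and>
      MinMaxInd_optimal V E (output_orientation vs es s))"
  unfolding star_ind_def
proof (rule tri_Seq[OF prepare])
  fix s assume s: "prepared s \<and> fst s ''L'' = lim"
  let ?D = "fst s ''D''"
  have input: "input_data s" and lists: "list_inv (2 * mm) s" and max: "max_inv nn s"
    and halve: "halve_inv (2 * ?D + 1) s"
    using s by (simp_all add: prepared_def)
  have data: "graph_data s"
    using input lists s by (simp add: graph_data_def input_data_def list_inv_def)
  have "?D \<le> max_degree V E"
    using max degr_le_max by (auto simp: max_inv_def)
  then have q': "2 * ?D \<le> 2 ^ q"
    using q by linarith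
  have D: "?D \<le> nn" "0 < ?D \<Longrightarrow> 0 < mm"
    using max degr_less degr_le by (auto simp: max_inv_def)
  have deg: "degr v \<le> ?D" if "v < nn" for v
    using max that by (simp add: max_inv_def)
  have half: "snd s ''half'' i = i div 2" if "i \<le> 4 * ?D" for i
    using halve that by (simp add: halve_inv_def)
  have inc: "orient (snd s ''inc'')" and out: "\<And>k. k < mm \<Longrightarrow> snd s ''out'' k = snd s ''inc'' (Suc k)"
    using input by (simp_all add: input_data_def)
  show "tri W bisect s (460 * ((nn + 2 * mm + 1) * (lim + 1)) * (q + 1))
    (\<lambda>s. MinMaxStar_optimal V E C (output_orientation vs es s) \<and>
      MinMaxInd_optimal V E (output_orientation vs es s))"
  proof (rule tri_mono[OF bisect[OF data inc out refl deg D half q']])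
    fix s' :: state assume "least_level_output s'"
    then obtain inc j where r: "orient inc" "\<forall>k<mm. snd s' ''out'' k = inc (Suc k)"
      "\<forall>v<nn. indeg inc v \<le> level_cap j v" "0 < j \<Longrightarrow> \<not> feasible (level_cap (j - 1))"
      unfolding least_level_output_def by blast
    have "output_orientation vs es s' = arcs inc"
      by (rule output_arcs[OF r(1)]) (use r(2) in simp)
    then show "MinMaxStar_optimal V E C (output_orientation vs es s') \<and>
      MinMaxInd_optimal V E (output_orientation vs es s')"
      using least_level_optimal[OF C r(1,3,4)] by simp
  qed (assumption | rule order_refl)+
qed (rule order_refl)

end

section \<open>The time bound\<close>

lemma search_limit_real:
  "real (search_limit n m) \<le> 1 + min (real n powr (2/3)) (real m powr (1/2))"
proof (cases "search_limit n m")
  case 0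
  then show ?thesis
    by simp
next
  case (Suc l)
  then have *: "\<not> (m \<le> l * l \<or> n * n \<le> l * l * l)"
    using search_limit_least[of m l n] by auto
  then have "0 < n"
    by (cases n) auto
  from * have l: "real (l * l) < real m" "real (l * l * l) < real (n * n)"
    by (simp_all only: of_nat_less_iff not_le de_Morgan_disj)
  have "real l = (real l ^ 2) powr (1/2)"
    by (simp add: powr_half_sqrt)
  also have "\<dots> \<le> real m powr (1/2)"
    by (rule powr_mono2) (use l(1) in \<open>simp_all add: power2_eq_square\<close>)
  finally have 1: "real l \<le> real m powr (1/2)" .
  have "real l \<le> real n powr (2/3)"
  proof (cases "l = 0")
    case False
    then have "real l = (real l ^ 3) powr (1/3)"
      by (simp add: powr_powr flip: powr_numeral)
    also have "\<dots> \<le> (real n ^ 2) powr (1/3)"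
      by (rule powr_mono2) (use l(2) in \<open>simp_all add: power2_eq_square power3_eq_cube\<close>)
    also have "\<dots> = real n powr (2/3)"
      using \<open>0 < n\<close> by (simp add: powr_powr flip: powr_numeral)
    finally show ?thesis .
  qed simp
  then show ?thesis
    using 1 Suc by simp
qed

lemma (in encoded_graph) edges_le_degree: "length es \<le> length vs * max_degree V E"
proof -
  have "2 * length es = (\<Sum>v<length vs. degr v)"
    using sum_halves_upto[of "2 * length es"] by simp
  also have "\<dots> \<le> (\<Sum>v<length vs. max_degree V E)"
    by (rule sum_mono) (use degr_le_max in simp)
  finally show ?thesis
    by simp
qed

lemma (in encoded_graph) no_edges_degree: "es = [] \<Longrightarrow> max_degree V E = 0"
proof -
  assume "es = []"
  then have "degr ` {..<length vs} = {0}"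
    using nodes_nonempty degr_le by auto
  then show ?thesis
    by (simp add: max_degree)
qed

text \<open>For \<open>\<Delta> \<ge> 2\<close> all additive constants are absorbed: \<open>n + 2 * m + 1 \<le> 6 * m\<close>, the minimum is at least 1
  and bounds \<open>L + 1\<close> up to the factor 3, and \<open>q + 1\<close> is at most \<open>log 2 \<Delta> + 3\<close>. For
  smaller \<open>\<Delta>\<close> the logarithm contributes 0 and the graph has at most two nodes.\<close>

lemma (in encoded_graph) time_bound:
  fixes \<Delta> :: nat
  defines "\<Delta> \<equiv> max_degree V E"
  assumes con: "connected_graph V E"
  shows "\<exists>q. 2 * \<Delta> \<le> 2 ^ q \<and>
    real (200 * (length vs + 2 * length es + 1) +
      460 * ((length vs + 2 * length es + 1) * (search_limit (length vs) (length es) + 1)) * (q + 1))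
    \<le> 100000 * (log 2 (real \<Delta>) * real (length es) *
       min (real (length vs) powr (2/3)) (real (length es) powr (1/2))) + 100000"
proof -
  let ?n = "length vs" and ?m = "length es"
  let ?l = "search_limit ?n ?m" and ?M = "min (real ?n powr (2/3)) (real ?m powr (1/2))"
  have mn: "?m \<le> ?n * \<Delta>"
    unfolding \<Delta>_def by (rule edges_le_degree)
  have n: "0 < ?n" "?n \<le> 2 * ?m + 1"
    using nodes_nonempty connected_nodes_le[OF con] by auto
  show ?thesis
  proof (cases "\<Delta> \<le> 1")
    case True
    then have "?n \<le> 2"
      using connected_degree_1[OF con] by (simp add: \<Delta>_def)
    moreover have "?m \<le> ?n * 1"
      using mn True mult_le_mono2[OF True, of ?n] by linarith
    ultimately have m: "?m \<le> 2"
      by simp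
    have l: "?l \<le> 2"
      using search_limit_le[of ?n ?m] m by simp
    have prod: "(?n + 2 * ?m + 1) * (?l + 1) \<le> 7 * 3"
      by (rule mult_le_mono) (use \<open>?n \<le> 2\<close> m l in simp_all)
    have time: "200 * a + 460 * b * (1 + 1) \<le> 100000" if "a \<le> 7" "b \<le> 7 * 3" for a b :: nat
      using that by simp
    have "200 * (?n + 2 * ?m + 1) + 460 * ((?n + 2 * ?m + 1) * (?l + 1)) * (1 + 1) \<le> 100000"
      by (rule time) (use \<open>?n \<le> 2\<close> m prod in simp_all)
    then have "real (200 * (?n + 2 * ?m + 1) + 460 * ((?n + 2 * ?m + 1) * (?l + 1)) * (1 + 1)) \<le> real 100000"
      by (simp only: of_nat_le_iff)
    moreover have "log 2 (real \<Delta>) = 0"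
      using True by (cases "\<Delta> = 0") (auto simp: log_def le_Suc_eq)
    ultimately show ?thesis
      using True by (intro exI[of _ 1]) simp
  next
    case False
    define x where "x = log 2 (real \<Delta>)"
    have x: "1 \<le> x"
      using False by (simp add: x_def le_log_iff)
    define q where "q = Suc (nat \<lceil>x\<rceil>)"
    have q: "real q \<le> x + 2"
      using x by (simp add: q_def) linarith
    have "real \<Delta> = 2 powr x"
      using False by (simp add: x_def)
    also have "\<dots> \<le> 2 powr real (nat \<lceil>x\<rceil>)"
      by (rule powr_mono) (use x in linarith, simp)
    finally have "real (2 * \<Delta>) \<le> real (2 ^ q)"
      by (simp add: powr_realpow q_def)
    then have q2: "2 * \<Delta> \<le> 2 ^ q"
      by (simp only: of_nat_le_iff)
    have m: "1 \<le> ?m"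
    proof (rule ccontr)
      assume "\<not> ?thesis"
      then have "es = []"
        by (cases es) auto
      then show False
        using no_edges_degree False by (simp add: \<Delta>_def)
    qed
    have M: "1 \<le> ?M"
      using m n by (simp add: ge_one_powr_ge_zero Suc_le_eq)
    have l: "real (?l + 1) \<le> 3 * ?M"
      using search_limit_real[of ?n ?m] M by linarith
    have S: "real (?n + 2 * ?m + 1) \<le> 6 * real ?m"
      using n m by linarith
    have "real ((?n + 2 * ?m + 1) * (?l + 1)) \<le> (6 * real ?m) * (3 * ?M)"
      unfolding of_nat_mult by (rule mult_mono[OF S l]) simp_all
    then have "real ((?n + 2 * ?m + 1) * (?l + 1)) * real (q + 1) \<le> ((6 * real ?m) * (3 * ?M)) * (4 * x)"
      by (rule mult_mono) (use q x M in simp_all)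
    moreover have "real (?n + 2 * ?m + 1) \<le> 6 * (x * real ?m * ?M)"
    proof -
      have "1 * 1 \<le> x * ?M"
        by (rule mult_mono) (use x M in auto)
      then have "real ?m * 1 \<le> real ?m * (x * ?M)"
        by (intro mult_left_mono) auto
      then show ?thesis
        using S by (simp add: mult_ac)
    qed
    moreover have "0 \<le> x * real ?m * ?M"
      using x M by (intro mult_nonneg_nonneg) auto
    ultimately have "real (200 * (?n + 2 * ?m + 1) + 460 * ((?n + 2 * ?m + 1) * (?l + 1)) * (q + 1))
        \<le> 100000 * (x * real ?m * ?M) + 100000"
      by (simp add: algebra_simps)
    then show ?thesis
      using q2 by (intro exI[of _ q]) (simp add: x_def)
  qed
qed

theorem theorem4:
  shows "\<exists>(P :: com) (c :: real) (r :: nat).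
    \<forall>(V :: 'a set) (E :: 'a set set) (C :: 'a \<Rightarrow> 'c) (vs :: 'a list) (es :: (nat \<times> nat) list).
      simple_graph V E \<longrightarrow> connected_graph V E \<longrightarrow> inj_on C V \<longrightarrow> encodes_graph vs es V E \<longrightarrow>
      (\<exists>(t :: nat) (s :: state).
        runs ((card V + card E + 2) ^ r) P (input_state (card V) es) t s \<and>
        real t \<le> c * (log 2 (real (max_degree V E)) * real (card E) *
                     min (real (card V) powr (2/3)) (real (card E) powr (1/2))) + c \<and>
        MinMaxStar_optimal V E C (output_orientation vs es s) \<and>
        MinMaxInd_optimal V E (output_orientation vs es s))"
proof (rule exI[of _ star_ind], rule exI[of _ 100000], rule exI[of _ 6], intro allI impI)
  fix V :: "'a set" and E :: "'a set set" and C :: "'a \<Rightarrow> 'c" and vs :: "'a list"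
    and es :: "(nat \<times> nat) list"
  assume graph: "simple_graph V E" and con: "connected_graph V E" and C: "inj_on C V"
    and enc: "encodes_graph vs es V E"
  interpret encoded_graph V E vs es
    by unfold_locales (rule graph enc)+
  let ?W = "(card V + card E + 2) ^ 6"
  have W: "8 * ((length vs + length es + 2) * (length vs + length es + 2) * (length vs + length es + 2)) \<le> ?W"
  proof -
    (* z is at least 2, so three of the six factors z absorb the constant 8 *)
    define z where "z = card V + card E + 2"
    have "2 ^ 3 \<le> z ^ 3"
      by (rule power_mono) (simp_all add: z_def)
    then have "8 * z ^ 3 \<le> z ^ 3 * z ^ 3"
      by (intro mult_right_mono) simp_all
    also have "z ^ 3 * z ^ 3 = z ^ 6"
      by (simp only: power_add[symmetric]) simp
    finally have "8 * (z * z * z) \<le> z ^ 6"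
      by (simp only: power3_eq_cube)
    then show ?thesis
      unfolding z_def length_vs length_es .
  qed
  interpret ram_graph V E vs es ?W
    by unfold_locales (rule W)
  obtain q where q: "2 * max_degree V E \<le> 2 ^ q" and bound:
    "real (200 * (length vs + 2 * length es + 1) +
      460 * ((length vs + 2 * length es + 1) * (search_limit (length vs) (length es) + 1)) * (q + 1))
    \<le> 100000 * (log 2 (real (max_degree V E)) * real (length es) *
       min (real (length vs) powr (2/3)) (real (length es) powr (1/2))) + 100000"
    using time_bound[OF con] by (elim exE conjE) (rule that)
  obtain t s where run: "runs ?W star_ind (input_state (length vs) es) t s"
    and t: "t \<le> 200 * (length vs + 2 * length es + 1) +
      460 * ((length vs + 2 * length es + 1) * (search_limit (length vs) (length es) + 1)) * (q + 1)"
    and opt: "MinMaxStar_optimal V E C (output_orientation vs es s)"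
      "MinMaxInd_optimal V E (output_orientation vs es s)"
    using star_ind[OF C q] unfolding tri_def by (elim exE conjE) (rule that)
  have "real t \<le> 100000 * (log 2 (real (max_degree V E)) * real (card E) *
       min (real (card V) powr (2/3)) (real (card E) powr (1/2))) + 100000"
    using order_trans[OF of_nat_mono[OF t] bound] by (simp only: length_vs length_es)
  then show "\<exists>t s. runs ?W star_ind (input_state (card V) es) t s \<and>
        real t \<le> 100000 * (log 2 (real (max_degree V E)) * real (card E) *
                     min (real (card V) powr (2/3)) (real (card E) powr (1/2))) + 100000 \<and>
        MinMaxStar_optimal V E C (output_orientation vs es s) \<and>
        MinMaxInd_optimal V E (output_orientation vs es s)"
    using run opt by (intro exI[of _ t] exI[of _ s]) (simp add: length_vs)
qed

end
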